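(* Let $\alpha\in(2,3)$. The functional $E^{(\alpha)}$ is continuously (Fréchet) differentiable on the open subset of $H^{(1+\alpha)/2,2}(\mathbb R/\mathbb Z,\mathbb R^n)$ consisting of all injective regular curves. Moreover, if such a curve $\gamma$ is parametrized by arc-length (i.e. $|\gamma'|\equiv 1$), then for every $h\in H^{(1+\alpha)/2,2}(\mathbb R/\mathbb Z,\mathbb R^n)$ the derivative of $E^{(\alpha)}$ at $\gamma$ in direction $h$ is $$\delta E^{(\alpha)}(\gamma;h)=\lim_{\varepsilon\searrow 0}\iint_{U_\varepsilon}\Big((\alpha-2)\frac{\langle\gamma'(u),h'(u)\rangle}{|w|^\alpha}+2\frac{\langle\gamma'(u),h'(u)\rangle}{|\gamma(u+w)-\gamma(u)|^\alpha}-\alpha\frac{\langle\gamma(u+w)-\gamma(u),h(u+w)-h(u)\rangle}{|\gamma(u+w)-\gamma(u)|^{\alpha+2}}\Big)\,dw\,du,$$ where the limit exists.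
   Context: For $\gamma\in C^{0,1}(\mathbb R/\mathbb Z,\mathbb R^n)$ let $\mathscr L(\gamma)=\int_0^1|\gamma'(\theta)|d\theta$ and, for $|w|\le 1/2$, $d_\gamma(u+w,u)=\min\{\mathscr L(\gamma|_{[u,u+w]}),\mathscr L(\gamma)-\mathscr L(\gamma|_{[u,u+w]})\}$ (intrinsic distance on the curve). O'Hara's energy is $$E^{(\alpha)}(\gamma)=\int_{\mathbb R/\mathbb Z}\int_{-1/2}^{1/2}\Big(\frac1{|\gamma(u+w)-\gamma(u)|^\alpha}-\frac1{d_\gamma(u+w,u)^\alpha}\Big)|\gamma'(u+w)||\gamma'(u)|\,dw\,du\in[0,\infty].$$ $H^{s,p}(\mathbb R/\mathbb Z,\mathbb R^n)=(\mathrm{id}-\Delta)^{-s/2}L^p$ denotes the Bessel potential (fractional Sobolev) space; for $p=2$, $s=k+\sigma$, $k\in\mathbb N_0$, $\sigma\in(0,1)$, its norm is equivalent to $\|f\|_{H^{k,2}}+\big(\int_{\mathbb R/\mathbb Z}\int_{-1/2}^{1/2}\frac{|f^{(k)}(u+w)-f^{(k)}(u)|^2}{|w|^{1+2\sigma}}dw\,du\big)^{1/2}$. A curve $\gamma\in C^1$ is regular if $\gamma'(u)\neq0$ for all $u$, and injective if it is injective on $\mathbb R/\mathbb Z$. For $\varepsilon>0$, $U_\varepsilon=\mathbb R/\mathbb Z\times([-\tfrac12,-\varepsilon]\cup[\varepsilon,\tfrac12])$. *)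

theory Defs
  imports "HOL-Analysis.Analysis"
begin

text \<open>Closed curves on R/Z are represented as 1-periodic functions real => real^'n.\<close>

definition periodic1 :: "(real \<Rightarrow> 'a) \<Rightarrow> bool" where
  "periodic1 f \<longleftrightarrow> (\<forall>x. f (x + 1) = f x)"

definition weak_deriv :: "(real \<Rightarrow> real^'n) \<Rightarrow> (real \<Rightarrow> real^'n) \<Rightarrow> bool" where
  "weak_deriv f g \<longleftrightarrow> periodic1 g \<and> g \<in> borel_measurable lborel \<and>
     (\<forall>a b. a \<le> b \<longrightarrow> set_integrable lborel {a..b} g \<and>
            f b - f a = set_lebesgue_integral lborel {a..b} g) \<and>
     set_nn_integral lborel {0..1} (\<lambda>x. ennreal ((norm (g x))\<^sup>2)) < \<infinity>"

definition gagliardo :: "real \<Rightarrow> (real \<Rightarrow> real^'n) \<Rightarrow> ennreal" where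
  "gagliardo \<sigma> g = set_nn_integral lborel {0..1} (\<lambda>u.
      set_nn_integral lborel {-1/2..1/2} (\<lambda>w.
        ennreal ((norm (g (u + w) - g u))\<^sup>2 / \<bar>w\<bar> powr (1 + 2 * \<sigma>))))"

text \<open>Hsob sigma f: f belongs to H^{1+sigma,2}(R/Z,R^n), for 0 < sigma < 1.\<close>
definition Hsob :: "real \<Rightarrow> (real \<Rightarrow> real^'n) \<Rightarrow> bool" where
  "Hsob \<sigma> f \<longleftrightarrow> periodic1 f \<and> (\<exists>g. weak_deriv f g \<and> gagliardo \<sigma> g < \<infinity>)"

text \<open>A norm equivalent to the H^{1+sigma,2} norm.\<close>
definition Hnorm :: "real \<Rightarrow> (real \<Rightarrow> real^'n) \<Rightarrow> real" where
  "Hnorm \<sigma> f = (let g = (SOME g. weak_deriv f g) in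
      sqrt (set_lebesgue_integral lborel {0..1} (\<lambda>x. (norm (f x))\<^sup>2))
    + sqrt (set_lebesgue_integral lborel {0..1} (\<lambda>x. (norm (g x))\<^sup>2))
    + sqrt (enn2real (gagliardo \<sigma> g)))"

definition C1_curve :: "(real \<Rightarrow> real^'n) \<Rightarrow> bool" where
  "C1_curve \<gamma> \<longleftrightarrow> (\<forall>u. \<gamma> differentiable (at u)) \<and>
     continuous_on UNIV (\<lambda>u. vector_derivative \<gamma> (at u))"

definition regular_curve :: "(real \<Rightarrow> real^'n) \<Rightarrow> bool" where
  "regular_curve \<gamma> \<longleftrightarrow> C1_curve \<gamma> \<and> (\<forall>u. vector_derivative \<gamma> (at u) \<noteq> 0)"

definition injective_RZ :: "(real \<Rightarrow> real^'n) \<Rightarrow> bool" where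
  "injective_RZ \<gamma> \<longleftrightarrow> (\<forall>u v. \<gamma> u = \<gamma> v \<longrightarrow> u - v \<in> \<int>)"

definition curve_length :: "(real \<Rightarrow> real^'n) \<Rightarrow> real" where
  "curve_length \<gamma> = integral {0..1} (\<lambda>t. norm (vector_derivative \<gamma> (at t)))"

definition arc_length :: "(real \<Rightarrow> real^'n) \<Rightarrow> real \<Rightarrow> real \<Rightarrow> real" where
  "arc_length \<gamma> u w = integral {min u (u + w)..max u (u + w)} (\<lambda>t. norm (vector_derivative \<gamma> (at t)))"

definition intr_dist :: "(real \<Rightarrow> real^'n) \<Rightarrow> real \<Rightarrow> real \<Rightarrow> real" where
  "intr_dist \<gamma> u w = min (arc_length \<gamma> u w) (curve_length \<gamma> - arc_length \<gamma> u w)"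

text \<open>Integrand of O'Hara's energy; value infinity where gamma(u+w) = gamma(u)
  (1/0^alpha = infinity).\<close>
definition ohara_integrand :: "real \<Rightarrow> (real \<Rightarrow> real^'n) \<Rightarrow> real \<Rightarrow> real \<Rightarrow> ennreal" where
  "ohara_integrand \<alpha> \<gamma> u w =
     (if \<gamma> (u + w) = \<gamma> u then \<infinity>
      else ennreal ((norm (\<gamma> (u + w) - \<gamma> u) powr (-\<alpha>) - intr_dist \<gamma> u w powr (-\<alpha>))
                    * norm (vector_derivative \<gamma> (at (u + w))) * norm (vector_derivative \<gamma> (at u))))"

definition OHara :: "real \<Rightarrow> (real \<Rightarrow> real^'n) \<Rightarrow> ennreal" where
  "OHara \<alpha> \<gamma> = set_nn_integral lborel {0..1} (\<lambda>u.
      set_nn_integral lborel {-1/2..1/2} (\<lambda>w. ohara_integrand \<alpha> \<gamma> u w))"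

definition dE_integrand :: "real \<Rightarrow> (real \<Rightarrow> real^'n) \<Rightarrow> (real \<Rightarrow> real^'n) \<Rightarrow> real \<Rightarrow> real \<Rightarrow> real" where
  "dE_integrand \<alpha> \<gamma> h u w =
    (let dg = vector_derivative \<gamma> (at u); dh = vector_derivative h (at u);
         D = \<gamma> (u + w) - \<gamma> u; Dh = h (u + w) - h u in
      (\<alpha> - 2) * (dg \<bullet> dh) / \<bar>w\<bar> powr \<alpha>
      + 2 * (dg \<bullet> dh) / norm D powr \<alpha>
      - \<alpha> * (D \<bullet> Dh) / norm D powr (\<alpha> + 2))"

definition Ieps :: "real \<Rightarrow> (real \<Rightarrow> real^'n) \<Rightarrow> (real \<Rightarrow> real^'n) \<Rightarrow> real \<Rightarrow> real" where
  "Ieps \<alpha> \<gamma> h \<epsilon> = set_lebesgue_integral lborel {0..1} (\<lambda>u.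
      set_lebesgue_integral lborel ({-1/2..-\<epsilon>} \<union> {\<epsilon>..1/2}) (\<lambda>w. dE_integrand \<alpha> \<gamma> h u w))"

definition admissible :: "real \<Rightarrow> (real \<Rightarrow> real^'n) \<Rightarrow> bool" where
  "admissible \<sigma> \<gamma> \<longleftrightarrow> Hsob \<sigma> \<gamma> \<and> regular_curve \<gamma> \<and> injective_RZ \<gamma>"

end

theory Submission
  imports Defs "HOL-Library.Landau_Symbols"
begin

text \<open>
  Write \<open>g\<close> for the velocity of a curve. If the intrinsic distance in the energy is replaced by the length of
  the arc from \<open>u\<close> to \<open>u + w\<close>, the inner integral changes by a quantity with an explicit antiderivative,
  which depends on the lengths of the two halves of the curve seen from \<open>u\<close> and is smooth in the \<open>C\<^sup>1\<close> topology.
  So the kink of the minimum disappears after integration in \<open>w\<close>.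

  The remaining density compares chord and arc. Like its derivatives in \<open>g\<close>, it vanishes to second
  order when \<open>g\<close> is constant on the arc, hence is bounded by squared increments of \<open>g\<close> and of
  the direction of variation, and these are integrable against \<open>\<bar>w\<bar> powr (-\<alpha>)\<close> by finiteness of the Gagliardo
  seminorm. Since \<open>(\<alpha> - 1) / 2 > 1/2\<close>, velocities are continuous and small perturbations keep the chord-arc
  ratio away from zero, so that all bounds are uniform near an injective regular curve, and differentiability
  follows from the mean value theorem applied pointwise under the integral.

  For a curve parametrized by arc length the derivative of the density differs from the integrand of the
  first variation by terms that cancel after integrating over \<open>u\<close>, by periodicity, and over the symmetric
  range of \<open>w\<close>.
\<close>

section \<open>Uniform Lipschitz families\<close>

text \<open>The values \<open>X i False\<close> and \<open>X i True\<close> are of order \<open>z i\<close> and their difference is of order \<open>\<nu> i * z i\<close>,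
  uniformly in \<open>i \<in> S\<close>. Such families multiply like orders of magnitude, which replaces estimates
  of second derivatives: every quantity below is assembled from a few of them by products.\<close>

definition lip_family ::
    "'i set \<Rightarrow> ('i \<Rightarrow> real) \<Rightarrow> ('i \<Rightarrow> real) \<Rightarrow> ('i \<Rightarrow> bool \<Rightarrow> 'a::real_normed_vector) \<Rightarrow> bool" where
  "lip_family S \<nu> z X \<longleftrightarrow>
     (\<forall>t. (\<lambda>i. norm (X i t)) \<in> O[principal S](z)) \<and>
     (\<lambda>i. norm (X i True - X i False)) \<in> O[principal S](\<lambda>i. \<nu> i * z i)"

lemma lip_familyD:
  assumes "lip_family S \<nu> z X"
  shows "(\<lambda>i. norm (X i t)) \<in> O[principal S](z)"
    and "(\<lambda>i. norm (X i True - X i False)) \<in> O[principal S](\<lambda>i. \<nu> i * z i)"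
  using assms by (simp_all add: lip_family_def)

lemma lip_familyE:
  assumes "lip_family S \<nu> z X"
  obtains K where "0 \<le> K" "\<And>i t. i \<in> S \<Longrightarrow> norm (X i t) \<le> K * \<bar>z i\<bar>"
    "\<And>i. i \<in> S \<Longrightarrow> norm (X i True - X i False) \<le> K * \<bar>\<nu> i * z i\<bar>"
proof -
  have bound: "\<exists>K>0. \<forall>i\<in>S. norm (X i t) \<le> K * \<bar>z i\<bar>" for t
    using lip_familyD(1)[OF assms, of t] by (auto simp: bigo_def eventually_principal)
  obtain K1 K2 where K12: "K1 > 0" "\<forall>i\<in>S. norm (X i True) \<le> K1 * \<bar>z i\<bar>"
    "K2 > 0" "\<forall>i\<in>S. norm (X i False) \<le> K2 * \<bar>z i\<bar>"
    using bound[of True] bound[of False] by blast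
  obtain K3 where K3: "K3 > 0" "\<forall>i\<in>S. norm (X i True - X i False) \<le> K3 * \<bar>\<nu> i * z i\<bar>"
    using lip_familyD(2)[OF assms] by (auto simp: bigo_def eventually_principal)
  define K where "K = max K1 (max K2 K3)"
  have "K1 \<le> K" "K2 \<le> K" "K3 \<le> K" by (auto simp: K_def)
  have enlarge: "x \<le> K * \<bar>y\<bar>" if "x \<le> L * \<bar>y\<bar>" "L \<le> K" for x y L
    using that mult_right_mono[of L K "\<bar>y\<bar>"] by simp
  show thesis
  proof
    show "norm (X i t) \<le> K * \<bar>z i\<bar>" if "i \<in> S" for i t
      using K12 that \<open>K1 \<le> K\<close> \<open>K2 \<le> K\<close> by (cases t) (auto intro: enlarge)
    show "norm (X i True - X i False) \<le> K * \<bar>\<nu> i * z i\<bar>" if "i \<in> S" for i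
      using K3 that \<open>K3 \<le> K\<close> by (auto intro: enlarge)
    show "0 \<le> K" using K3(1) \<open>K3 \<le> K\<close> by simp
  qed
qed

lemma bigo_principal_norm_mono:
  fixes g :: "'i \<Rightarrow> real"
  assumes "g \<in> O[principal S](h)" "\<And>i. i \<in> S \<Longrightarrow> norm (f i) \<le> g i"
  shows "(\<lambda>i. norm (f i)) \<in> O[principal S](h)"
proof (rule landau_o.big_trans[OF _ assms(1)], rule bigoI[where c=1])
  have "norm (norm (f i)) \<le> 1 * norm (g i)" if "i \<in> S" for i
    using assms(2)[OF that] by simp
  then show "\<forall>\<^sub>F i in principal S. norm (norm (f i)) \<le> 1 * norm (g i)"
    by (simp add: eventually_principal)
qed

lemma lip_family_cong:
  assumes "lip_family S \<nu> z X" "\<And>i t. i \<in> S \<Longrightarrow> X i t = Y i t"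
  shows "lip_family S \<nu> z Y"
  unfolding lip_family_def
proof (intro conjI allI)
  note X = lip_familyD[OF assms(1)]
  show "(\<lambda>i. norm (Y i t)) \<in> O[principal S](z)" for t
    by (rule bigo_principal_norm_mono[OF X(1)[of t]]) (simp add: assms(2))
  show "(\<lambda>i. norm (Y i True - Y i False)) \<in> O[principal S](\<lambda>i. \<nu> i * z i)"
    by (rule bigo_principal_norm_mono[OF X(2)]) (simp add: assms(2))
qed

lemma lip_family_reindex:
  assumes "lip_family S \<nu> z X" "\<phi> ` T \<subseteq> S"
  shows "lip_family T (\<lambda>j. \<nu> (\<phi> j)) (\<lambda>j. z (\<phi> j)) (\<lambda>j. X (\<phi> j))"
proof -
  have "filterlim \<phi> (principal S) (principal T)"
    using assms(2) by (auto simp: filterlim_principal eventually_principal)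
  then show ?thesis
    using lip_familyD[OF assms(1)] unfolding lip_family_def
    by (auto dest: landau_o.big.compose)
qed

lemma lip_family_lift:
  "lip_family S \<nu> z X \<Longrightarrow> lip_family (S \<times> T) (\<lambda>x. \<nu> (fst x)) (\<lambda>x. z (fst x)) (\<lambda>x. X (fst x))"
  by (rule lip_family_reindex[where \<phi>=fst]) auto

lemma lip_family_at:
  "lip_family (S \<times> T) (\<lambda>x. \<nu> (fst x)) z X \<Longrightarrow> s \<in> T \<Longrightarrow> lip_family S \<nu> (\<lambda>i. z (i, s)) (\<lambda>i. X (i, s))"
  using lip_family_reindex[of "S \<times> T" "\<lambda>x. \<nu> (fst x)" z X "\<lambda>i. (i, s)" S] by auto

lemma lip_family_mono:
  assumes "lip_family S \<nu> z X" "z \<in> O[principal S](z')"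
  shows "lip_family S \<nu> z' X"
  using lip_familyD[OF assms(1)] assms(2) landau_o.big.mult_left[OF assms(2), of \<nu>]
  unfolding lip_family_def by (meson landau_o.big_trans)

lemma lip_family_stationary:
  assumes "(\<lambda>i. norm (X i)) \<in> O[principal S](z)"
  shows "lip_family S \<nu> z (\<lambda>i t. X i)"
  using assms by (simp add: lip_family_def)

lemma lip_family_const: "lip_family S \<nu> (\<lambda>_. 1) (\<lambda>i t. c)"
  by (rule lip_family_stationary) simp

lemma lip_family_add:
  assumes "lip_family S \<nu> z X" "lip_family S \<nu> z Y"
  shows "lip_family S \<nu> z (\<lambda>i t. X i t + Y i t)"
  unfolding lip_family_def
proof (intro conjI allI)
  note X = lip_familyD[OF assms(1)] and Y = lip_familyD[OF assms(2)]
  show "(\<lambda>i. norm (X i t + Y i t)) \<in> O[principal S](z)" for t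
    by (rule bigo_principal_norm_mono[OF sum_in_bigo(1)[OF X(1) Y(1)]]) (rule norm_triangle_ineq)
  show "(\<lambda>i. norm (X i True + Y i True - (X i False + Y i False))) \<in> O[principal S](\<lambda>i. \<nu> i * z i)"
    by (rule bigo_principal_norm_mono[OF sum_in_bigo(1)[OF X(2) Y(2)]])
       (rule norm_diff_triangle_ineq)
qed

lemma (in bounded_bilinear) lip_family:
  assumes "lip_family S \<nu> z X" "lip_family S \<nu> z' Y"
  shows "lip_family S \<nu> (\<lambda>i. z i * z' i) (\<lambda>i t. prod (X i t) (Y i t))"
  unfolding lip_family_def
proof (intro conjI allI)
  note X = lip_familyD[OF assms(1)] and Y = lip_familyD[OF assms(2)]
  obtain K where K: "K > 0" "\<And>a b. norm (prod a b) \<le> norm a * norm b * K"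
    using pos_bounded by blast
  show "(\<lambda>i. norm (prod (X i t) (Y i t))) \<in> O[principal S](\<lambda>i. z i * z' i)" for t
    using landau_o.big.mult[OF X(1) Y(1), of t t] K
    by (intro bigo_principal_norm_mono[where g="\<lambda>i. norm (X i t) * norm (Y i t) * K"]) simp_all
  have "(\<lambda>i. norm (X i True) * norm (Y i True - Y i False) * K) \<in> O[principal S](\<lambda>i. \<nu> i * (z i * z' i))"
    using landau_o.big.mult[OF X(1) Y(2), of True] K(1) by (simp add: mult_ac)
  moreover have "(\<lambda>i. norm (X i True - X i False) * norm (Y i False) * K) \<in> O[principal S](\<lambda>i. \<nu> i * (z i * z' i))"
    using landau_o.big.mult[OF X(2) Y(1), of False] K(1) by (simp add: mult_ac)
  ultimately have "(\<lambda>i. norm (X i True) * norm (Y i True - Y i False) * K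
      + norm (X i True - X i False) * norm (Y i False) * K) \<in> O[principal S](\<lambda>i. \<nu> i * (z i * z' i))"
    by (rule sum_in_bigo)
  then show "(\<lambda>i. norm (prod (X i True) (Y i True) - prod (X i False) (Y i False)))
      \<in> O[principal S](\<lambda>i. \<nu> i * (z i * z' i))"
  proof (rule bigo_principal_norm_mono)
    fix i
    have "prod (X i True) (Y i True) - prod (X i False) (Y i False)
      = prod (X i True) (Y i True - Y i False) + prod (X i True - X i False) (Y i False)"
      by (simp add: diff_left diff_right)
    then show "norm (prod (X i True) (Y i True) - prod (X i False) (Y i False))
      \<le> norm (X i True) * norm (Y i True - Y i False) * K
        + norm (X i True - X i False) * norm (Y i False) * K"
      by (metis K(2) add_mono norm_triangle_mono)
  qed
qed

lemmas lip_family_mult = bounded_bilinear.lip_family[OF bounded_bilinear_mult]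
lemmas lip_family_scaleR = bounded_bilinear.lip_family[OF bounded_bilinear_scaleR]
lemmas lip_family_inner = bounded_bilinear.lip_family[OF bounded_bilinear_inner]

lemmas lip_family_mult_bounded = lip_family_mult[where z'="\<lambda>_. 1", simplified]
lemmas lip_family_bounded_mult = lip_family_mult[where z="\<lambda>_. 1", simplified]
lemmas lip_family_scaleR_bounded = lip_family_scaleR[where z'="\<lambda>_. 1", simplified]
lemmas lip_family_bounded_scaleR = lip_family_scaleR[where z="\<lambda>_. 1", simplified]
lemmas lip_family_inner_bounded = lip_family_inner[where z'="\<lambda>_. 1", simplified]
lemmas lip_family_bounded_inner = lip_family_inner[where z="\<lambda>_. 1", simplified]

lemma lip_family_cmult:
  fixes X :: "'i \<Rightarrow> bool \<Rightarrow> real"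
  shows "lip_family S \<nu> z X \<Longrightarrow> lip_family S \<nu> z (\<lambda>i t. c * X i t)"
  by (rule lip_family_bounded_mult[OF lip_family_const])

lemma lip_family_uminus: "lip_family S \<nu> z X \<Longrightarrow> lip_family S \<nu> z (\<lambda>i t. - X i t)"
  using lip_family_bounded_scaleR[OF lip_family_const, of S \<nu> z X "-1"] by simp

lemma lip_family_diff:
  assumes "lip_family S \<nu> z X" "lip_family S \<nu> z Y"
  shows "lip_family S \<nu> z (\<lambda>i t. X i t - Y i t)"
  using lip_family_add[OF assms(1) lip_family_uminus[OF assms(2)]] by simp

lemma lip_family_norm:
  assumes "lip_family S \<nu> z X"
  shows "lip_family S \<nu> z (\<lambda>i t. norm (X i t))"
  unfolding lip_family_def
proof (intro conjI allI)
  show "(\<lambda>i. norm (norm (X i t))) \<in> O[principal S](z)" for t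
    using lip_familyD(1)[OF assms] by simp
  show "(\<lambda>i. norm (norm (X i True) - norm (X i False))) \<in> O[principal S](\<lambda>i. \<nu> i * z i)"
    by (rule bigo_principal_norm_mono[OF lip_familyD(2)[OF assms]]) (simp add: norm_triangle_ineq3)
qed

lemma lip_family_step:
  assumes "(\<lambda>i. norm (f i)) \<in> O[principal S](z)" "\<nu> \<in> O[principal S](\<lambda>_. 1)"
  shows "lip_family S \<nu> z (\<lambda>i t. (if t then \<nu> i else 0) *\<^sub>R f i)"
  unfolding lip_family_def
proof (intro conjI allI)
  have norm_eq: "\<bar>\<nu> i * norm (f i)\<bar> = norm (\<nu> i *\<^sub>R f i)" for i
    by (simp add: abs_mult)
  have "(\<lambda>i. \<bar>\<nu> i * norm (f i)\<bar>) \<in> O[principal S](z)" "(\<lambda>i. \<bar>\<nu> i * norm (f i)\<bar>) \<in> O[principal S](\<lambda>i. \<nu> i * z i)"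
    using landau_o.big.mult[OF assms(2,1)] landau_o.big.mult_left[OF assms(1), of \<nu>] by simp_all
  note order = this[unfolded norm_eq]
  show "(\<lambda>i. norm ((if t then \<nu> i else 0) *\<^sub>R f i)) \<in> O[principal S](z)" for t
    using order(1) by (cases t) simp_all
  show "(\<lambda>i. norm ((if True then \<nu> i else 0) *\<^sub>R f i - (if False then \<nu> i else 0) *\<^sub>R f i))
      \<in> O[principal S](\<lambda>i. \<nu> i * z i)"
    using order(2) by simp
qed

lemma powr_le_sum_endpoints:
  fixes x :: real
  assumes "0 < c" "c \<le> x" "x \<le> B"
  shows "x powr a \<le> c powr a + B powr a"
proof (cases "0 \<le> a")
  case True
  then have "x powr a \<le> B powr a" using assms by (intro powr_mono2) auto
  then show ?thesis by (simp add: add_increasing)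
next
  case False
  then have "x powr a \<le> c powr a" using assms by (intro powr_mono2') auto
  then show ?thesis by (simp add: add_increasing2)
qed

lemma powr_lipschitz:
  fixes x y :: real
  assumes "0 < c" "x \<in> {c..B}" "y \<in> {c..B}"
  shows "\<bar>y powr a - x powr a\<bar> \<le> \<bar>a\<bar> * (c powr (a - 1) + B powr (a - 1)) * \<bar>y - x\<bar>"
proof -
  have "norm (y powr a - x powr a) \<le> (\<bar>a\<bar> * (c powr (a - 1) + B powr (a - 1))) * norm (y - x)"
  proof (rule field_differentiable_bound[where S="{c..B}" and f'="\<lambda>x. a * x powr (a - 1)"])
    fix z assume z: "z \<in> {c..B}"
    show "((\<lambda>x. x powr a) has_real_derivative a * z powr (a - 1)) (at z within {c..B})"
      using z assms by (auto intro!: derivative_eq_intros)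
    show "norm (a * z powr (a - 1)) \<le> \<bar>a\<bar> * (c powr (a - 1) + B powr (a - 1))"
      using z assms by (auto simp: abs_mult intro!: mult_left_mono powr_le_sum_endpoints)
  qed (use assms in auto)
  then show ?thesis by simp
qed

lemma lip_family_powr:
  fixes X :: "'i \<Rightarrow> bool \<Rightarrow> real"
  assumes X: "lip_family S \<nu> (\<lambda>_. 1) X" and c: "c > 0" "\<And>i t. i \<in> S \<Longrightarrow> c \<le> X i t"
  shows "lip_family S \<nu> (\<lambda>_. 1) (\<lambda>i t. X i t powr a)"
proof -
  obtain B where "0 \<le> B" and B: "\<And>i t. i \<in> S \<Longrightarrow> norm (X i t) \<le> B * \<bar>1\<bar>"
    using lip_familyE[OF X] by metis
  have X_range: "X i t \<in> {c..B}" if "i \<in> S" for i t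
    using B[OF that, of t] c(2)[OF that, of t] by simp
  define L where "L = \<bar>a\<bar> * (c powr (a - 1) + B powr (a - 1))"
  show ?thesis
    unfolding lip_family_def
  proof (intro conjI allI)
    show "(\<lambda>i. norm (X i t powr a)) \<in> O[principal S](\<lambda>_. 1)" for t
      by (rule bigo_principal_norm_mono[where g="\<lambda>_. c powr a + B powr a"])
         (use X_range c(1) in \<open>auto intro: powr_le_sum_endpoints\<close>)
    have "(\<lambda>i. L * norm (X i True - X i False)) \<in> O[principal S](\<lambda>i. \<nu> i * 1)"
      using lip_familyD(2)[OF X] by simp
    then show "(\<lambda>i. norm (X i True powr a - X i False powr a)) \<in> O[principal S](\<lambda>i. \<nu> i * 1)"
      by (rule bigo_principal_norm_mono)
         (use powr_lipschitz[OF c(1) X_range X_range] in \<open>simp add: L_def\<close>)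
  qed
qed

lemma lip_family_inverse:
  fixes X :: "'i \<Rightarrow> bool \<Rightarrow> real"
  assumes "lip_family S \<nu> (\<lambda>_. 1) X" "c > 0" "\<And>i t. i \<in> S \<Longrightarrow> c \<le> X i t"
  shows "lip_family S \<nu> (\<lambda>_. 1) (\<lambda>i t. inverse (X i t))"
proof (rule lip_family_cong[OF lip_family_powr[OF assms, of "-1"]])
  fix i t assume "i \<in> S"
  then have "0 < X i t" using assms(2) assms(3)[of i t] by simp
  then show "X i t powr -1 = inverse (X i t)" by (simp add: powr_minus)
qed

lemma lip_family_sgn:
  assumes "lip_family S \<nu> (\<lambda>_. 1) X" "c > 0" "\<And>i t. i \<in> S \<Longrightarrow> c \<le> norm (X i t)"
  shows "lip_family S \<nu> (\<lambda>_. 1) (\<lambda>i t. sgn (X i t))"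
  unfolding sgn_div_norm
  by (rule lip_family_bounded_scaleR[OF lip_family_inverse[OF lip_family_norm[OF assms(1)] assms(2,3)] assms(1)])

lemma inner_diff_add_eq_norm:
  fixes v w :: "'a::real_inner"
  shows "(v - w) \<bullet> (v + w) = (norm v - norm w) * (norm v + norm w)"
  by (simp add: inner_diff_left inner_add_right inner_commute algebra_simps flip: power2_norm_eq_inner)
     (simp add: power2_eq_square)

lemma lip_family_norm_diff:
  fixes X Y :: "'i \<Rightarrow> bool \<Rightarrow> 'a::real_inner"
  assumes X: "lip_family S \<nu> (\<lambda>_. 1) X" and Y: "lip_family S \<nu> (\<lambda>_. 1) Y"
    and XY: "lip_family S \<nu> z (\<lambda>i t. X i t - Y i t)"
    and c: "c > 0" "\<And>i t. i \<in> S \<Longrightarrow> c \<le> norm (X i t)"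
  shows "lip_family S \<nu> z (\<lambda>i t. norm (X i t) - norm (Y i t))"
proof (rule lip_family_cong)
  have "lip_family S \<nu> (\<lambda>_. 1) (\<lambda>i t. inverse (norm (X i t) + norm (Y i t)))"
    by (rule lip_family_inverse[OF lip_family_add[OF lip_family_norm[OF X] lip_family_norm[OF Y]] c(1)])
       (simp add: add_increasing2 c(2))
  then show "lip_family S \<nu> z
      (\<lambda>i t. inverse (norm (X i t) + norm (Y i t)) * ((X i t - Y i t) \<bullet> (X i t + Y i t)))"
    by (rule lip_family_bounded_mult) (rule lip_family_inner_bounded[OF XY lip_family_add[OF X Y]])
  show "inverse (norm (X i t) + norm (Y i t)) * ((X i t - Y i t) \<bullet> (X i t + Y i t))
      = norm (X i t) - norm (Y i t)" if "i \<in> S" for i t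
  proof -
    have "0 < norm (X i t) + norm (Y i t)"
      using c(1) c(2)[OF that, of t] by (intro add_pos_nonneg) auto
    then show ?thesis unfolding inner_diff_add_eq_norm by simp
  qed
qed

lemma lip_family_sgn_diff:
  fixes X Y :: "'i \<Rightarrow> bool \<Rightarrow> 'a::real_inner"
  assumes X: "lip_family S \<nu> (\<lambda>_. 1) X" and Y: "lip_family S \<nu> (\<lambda>_. 1) Y"
    and XY: "lip_family S \<nu> z (\<lambda>i t. X i t - Y i t)"
    and c: "c > 0" "\<And>i t. i \<in> S \<Longrightarrow> c \<le> norm (X i t)" "\<And>i t. i \<in> S \<Longrightarrow> c \<le> norm (Y i t)"
  shows "lip_family S \<nu> z (\<lambda>i t. sgn (X i t) - sgn (Y i t))"
proof (rule lip_family_cong)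
  have X_inverse: "lip_family S \<nu> (\<lambda>_. 1) (\<lambda>i t. inverse (norm (X i t)))"
    by (rule lip_family_inverse[OF lip_family_norm[OF X] c(1,2)])
  show "lip_family S \<nu> z (\<lambda>i t. inverse (norm (X i t)) *\<^sub>R (X i t - Y i t)
      - (inverse (norm (X i t)) * (norm (X i t) - norm (Y i t))) *\<^sub>R sgn (Y i t))"
    by (intro lip_family_diff lip_family_bounded_scaleR[OF X_inverse XY]
        lip_family_scaleR_bounded[OF lip_family_bounded_mult[OF X_inverse]]
        lip_family_norm_diff[OF X Y XY c(1,2)] lip_family_sgn[OF Y c(1,3)])
  show "inverse (norm (X i t)) *\<^sub>R (X i t - Y i t)
      - (inverse (norm (X i t)) * (norm (X i t) - norm (Y i t))) *\<^sub>R sgn (Y i t)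
    = sgn (X i t) - sgn (Y i t)" if "i \<in> S" for i t
  proof -
    have "X i t \<noteq> 0" "Y i t \<noteq> 0" using c(1) c(2,3)[OF that, of t] by auto
    then show ?thesis
      by (simp add: sgn_div_norm scaleR_diff_left scaleR_diff_right left_diff_distrib right_diff_distrib)
  qed
qed

lemma bigo_principal_integral:
  fixes Y :: "'i \<times> real \<Rightarrow> 'a::banach" and z :: "'i \<times> real \<Rightarrow> real"
  assumes Y: "(\<lambda>x. norm (Y x)) \<in> O[principal (S \<times> {0..1})](\<lambda>x. \<nu> (fst x) * z x)"
    and Y_cont: "\<And>i. i \<in> S \<Longrightarrow> continuous_on {0..1} (\<lambda>s. Y (i, s))"
    and z_cont: "\<And>i. i \<in> S \<Longrightarrow> continuous_on {0..1} (\<lambda>s. z (i, s))"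
    and z_nonneg: "\<And>i s. i \<in> S \<Longrightarrow> s \<in> {0..1} \<Longrightarrow> 0 \<le> z (i, s)"
  shows "(\<lambda>i. norm (integral {0..1} (\<lambda>s. Y (i, s)))) \<in> O[principal S](\<lambda>i. \<nu> i * integral {0..1} (\<lambda>s. z (i, s)))"
proof -
  obtain K where "\<forall>x\<in>S \<times> {0..1}. norm (norm (Y x)) \<le> K * norm (\<nu> (fst x) * z x)"
    using Y unfolding bigo_def eventually_principal by blast
  then have K: "norm (Y (i, s)) \<le> K * \<bar>\<nu> i * z (i, s)\<bar>" if "i \<in> S" "s \<in> {0..1}" for i s
    using that by force
  have "norm (integral {0..1} (\<lambda>s. Y (i, s))) \<le> K * \<bar>\<nu> i * integral {0..1} (\<lambda>s. z (i, s))\<bar>" if i: "i \<in> S" for i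
  proof -
    have "norm (integral {0..1} (\<lambda>s. Y (i, s))) \<le> integral {0..1} (\<lambda>s. (K * \<bar>\<nu> i\<bar>) * z (i, s))"
      using K[OF i] z_nonneg[OF i]
      by (intro integral_norm_bound_integral integrable_continuous_real continuous_intros Y_cont z_cont i)
         (auto simp: abs_mult mult.assoc)
    moreover have "0 \<le> integral {0..1} (\<lambda>s. z (i, s))"
      by (intro integral_nonneg integrable_continuous_real z_cont z_nonneg i)
    ultimately show ?thesis by (simp add: abs_mult mult.assoc)
  qed
  then show ?thesis by (intro bigoI[where c=K]) (simp add: eventually_principal)
qed

lemma lip_family_integral:
  fixes X :: "'i \<times> real \<Rightarrow> bool \<Rightarrow> 'a::banach"
  assumes X: "lip_family (S \<times> {0..1}) (\<lambda>x. \<nu> (fst x)) z X"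
    and X_cont: "\<And>i t. i \<in> S \<Longrightarrow> continuous_on {0..1} (\<lambda>s. X (i, s) t)"
    and z: "\<And>i. i \<in> S \<Longrightarrow> continuous_on {0..1} (\<lambda>s. z (i, s))"
      "\<And>i s. i \<in> S \<Longrightarrow> s \<in> {0..1} \<Longrightarrow> 0 \<le> z (i, s)"
  shows "lip_family S \<nu> (\<lambda>i. integral {0..1} (\<lambda>s. z (i, s))) (\<lambda>i t. integral {0..1} (\<lambda>s. X (i, s) t))"
  unfolding lip_family_def
proof (intro conjI allI)
  show "(\<lambda>i. norm (integral {0..1} (\<lambda>s. X (i, s) t))) \<in> O[principal S](\<lambda>i. integral {0..1} (\<lambda>s. z (i, s)))" for t
    using bigo_principal_integral[where \<nu>="\<lambda>_. 1" and Y="\<lambda>x. X x t", OF _ X_cont z] lip_familyD(1)[OF X]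
    by simp
  have "(\<lambda>i. norm (integral {0..1} (\<lambda>s. X (i, s) True - X (i, s) False)))
      \<in> O[principal S](\<lambda>i. \<nu> i * integral {0..1} (\<lambda>s. z (i, s)))"
    using lip_familyD(2)[OF X] X_cont z by (intro bigo_principal_integral continuous_intros)
  then show "(\<lambda>i. norm (integral {0..1} (\<lambda>s. X (i, s) True) - integral {0..1} (\<lambda>s. X (i, s) False)))
      \<in> O[principal S](\<lambda>i. \<nu> i * integral {0..1} (\<lambda>s. z (i, s)))"
    by (rule bigo_principal_norm_mono)
       (simp add: integral_diff integrable_continuous_real X_cont)
qed

lemma lip_family_integral_bounded:
  fixes X :: "'i \<times> real \<Rightarrow> bool \<Rightarrow> 'a::banach"
  assumes "lip_family (S \<times> {0..1}) (\<lambda>x. \<nu> (fst x)) (\<lambda>_. 1) X"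
    and "\<And>i t. i \<in> S \<Longrightarrow> continuous_on {0..1} (\<lambda>s. X (i, s) t)"
  shows "lip_family S \<nu> (\<lambda>_. 1) (\<lambda>i t. integral {0..1} (\<lambda>s. X (i, s) t))"
  using lip_family_integral[OF assms] by simp

lemma powr_diff_eq_integral:
  fixes x y :: real
  assumes "0 < x" "0 < y"
  shows "x powr a - y powr a = (x - y) * integral {0..1} (\<lambda>\<theta>. a * (y + \<theta> * (x - y)) powr (a - 1))"
proof -
  have "((\<lambda>\<theta>. (x - y) * (a * (y + \<theta> * (x - y)) powr (a - 1))) has_integral
      (y + 1 * (x - y)) powr a - (y + 0 * (x - y)) powr a) {0..1}"
  proof (rule fundamental_theorem_of_calculus)
    fix \<theta> :: real assume "\<theta> \<in> {0..1}"
    then have "0 < (1 - \<theta>) * y + \<theta> * x"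
      using assms by (cases "\<theta> = 0") (auto intro!: add_nonneg_pos)
    then have "0 < y + \<theta> * (x - y)" by (simp add: algebra_simps)
    then have "((\<lambda>\<theta>. (y + \<theta> * (x - y)) powr a) has_real_derivative
        (x - y) * (a * (y + \<theta> * (x - y)) powr (a - 1))) (at \<theta> within {0..1})"
      by (auto intro!: derivative_eq_intros)
    then show "((\<lambda>\<theta>. (y + \<theta> * (x - y)) powr a) has_vector_derivative
        (x - y) * (a * (y + \<theta> * (x - y)) powr (a - 1))) (at \<theta> within {0..1})"
      by (simp add: has_real_derivative_iff_has_vector_derivative)
  qed simp
  then show ?thesis by (simp add: integral_unique flip: integral_mult_right)
qed

lemma lip_family_powr_diff:
  fixes X Y :: "'i \<Rightarrow> bool \<Rightarrow> real"
  assumes X: "lip_family S \<nu> (\<lambda>_. 1) X" and Y: "lip_family S \<nu> (\<lambda>_. 1) Y"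
    and XY: "lip_family S \<nu> z (\<lambda>i t. X i t - Y i t)"
    and c: "c > 0" "\<And>i t. i \<in> S \<Longrightarrow> c \<le> X i t" "\<And>i t. i \<in> S \<Longrightarrow> c \<le> Y i t"
  shows "lip_family S \<nu> z (\<lambda>i t. X i t powr a - Y i t powr a)"
proof (rule lip_family_cong)
  let ?Z = "\<lambda>i \<theta> t. Y i t + \<theta> * (X i t - Y i t)"
  have Z_ge: "c \<le> ?Z i \<theta> t" if "i \<in> S" "\<theta> \<in> {0..1}" for i \<theta> t
  proof -
    have "c = (1 - \<theta>) * c + \<theta> * c" by (simp add: algebra_simps)
    also have "\<dots> \<le> (1 - \<theta>) * Y i t + \<theta> * X i t"
      using that c by (intro add_mono mult_left_mono) auto
    finally show ?thesis by (simp add: algebra_simps)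
  qed
  have "(\<lambda>x::'i \<times> real. norm (snd x)) \<in> O[principal (S \<times> {0..1})](\<lambda>_. 1)"
    by (rule bigo_principal_norm_mono[where g="\<lambda>_. 1"]) auto
  then have "lip_family (S \<times> {0..1}) (\<lambda>x. \<nu> (fst x)) (\<lambda>_. 1) (\<lambda>x t. ?Z (fst x) (snd x) t)"
    by (intro lip_family_add lip_family_bounded_mult[OF lip_family_stationary]
        lip_family_lift[OF Y] lip_family_lift[OF lip_family_diff[OF X Y]])
  then have "lip_family (S \<times> {0..1}) (\<lambda>x. \<nu> (fst x)) (\<lambda>_. 1) (\<lambda>x t. ?Z (fst x) (snd x) t powr (a - 1))"
    by (rule lip_family_powr[OF _ c(1)]) (auto intro: Z_ge)
  then have "lip_family (S \<times> {0..1}) (\<lambda>x. \<nu> (fst x)) (\<lambda>_. 1) (\<lambda>x t. a * ?Z (fst x) (snd x) t powr (a - 1))"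
    by (rule lip_family_cmult)
  moreover have "continuous_on {0..1} (\<lambda>\<theta>. a * ?Z i \<theta> t powr (a - 1))" if "i \<in> S" for i t
    using Z_ge[OF that, of _ t] c(1) by (intro continuous_intros) force+
  ultimately have "lip_family S \<nu> (\<lambda>_. 1) (\<lambda>i t. integral {0..1} (\<lambda>\<theta>. a * ?Z i \<theta> t powr (a - 1)))"
    using lip_family_integral_bounded[where X="\<lambda>x t. a * ?Z (fst x) (snd x) t powr (a - 1)"] by simp
  then show "lip_family S \<nu> z (\<lambda>i t. (X i t - Y i t) * integral {0..1} (\<lambda>\<theta>. a * ?Z i \<theta> t powr (a - 1)))"
    by (rule lip_family_mult_bounded[OF XY])
  show "(X i t - Y i t) * integral {0..1} (\<lambda>\<theta>. a * ?Z i \<theta> t powr (a - 1)) = X i t powr a - Y i t powr a"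
    if "i \<in> S" for i t
    using c(1) c(2,3)[OF that, of t] by (intro powr_diff_eq_integral[symmetric]) auto
qed

section \<open>Functionals of velocity paths\<close>

definition mean_velocity :: "(real \<Rightarrow> 'a::euclidean_space) \<Rightarrow> 'a" where
  "mean_velocity p = integral {0..1} p"

definition mean_speed :: "(real \<Rightarrow> 'a::euclidean_space) \<Rightarrow> real" where
  "mean_speed p = integral {0..1} (\<lambda>s. norm (p s))"

definition mean_speed_deriv :: "(real \<Rightarrow> 'a::euclidean_space) \<Rightarrow> (real \<Rightarrow> 'a) \<Rightarrow> real" where
  "mean_speed_deriv p k = integral {0..1} (\<lambda>s. sgn (p s) \<bullet> k s)"

text \<open>If \<open>p\<close> is the velocity along the arc from \<open>u\<close> to \<open>u + w\<close>, rescaled to the unit interval, then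
  \<open>\<bar>w\<bar> powr (-\<alpha>) * chord_arc_density \<alpha> p\<close> is the energy integrand in which the length of that arc
  replaces the intrinsic distance.\<close>

definition chord_arc_density :: "real \<Rightarrow> (real \<Rightarrow> 'a::euclidean_space) \<Rightarrow> real" where
  "chord_arc_density \<alpha> p =
     (norm (mean_velocity p) powr (-\<alpha>) - mean_speed p powr (-\<alpha>)) * (norm (p 1) * norm (p 0))"

definition chord_arc_density_deriv ::
    "real \<Rightarrow> (real \<Rightarrow> 'a::euclidean_space) \<Rightarrow> (real \<Rightarrow> 'a) \<Rightarrow> real" where
  "chord_arc_density_deriv \<alpha> p k =
     \<alpha> * (mean_speed p powr (-\<alpha> - 1) * mean_speed_deriv p k
          - norm (mean_velocity p) powr (-\<alpha> - 1) * (sgn (mean_velocity p) \<bullet> mean_velocity k))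
       * (norm (p 1) * norm (p 0))
     + (norm (mean_velocity p) powr (-\<alpha>) - mean_speed p powr (-\<alpha>))
       * (sgn (p 1) \<bullet> k 1 * norm (p 0) + norm (p 1) * (sgn (p 0) \<bullet> k 0))"

definition subarc :: "(real \<Rightarrow> 'a) \<Rightarrow> real \<times> real \<Rightarrow> real \<Rightarrow> 'a" where
  "subarc g x s = g (fst x + s * snd x)"

definition wrap_term :: "real \<Rightarrow> real \<Rightarrow> real \<Rightarrow> real \<Rightarrow> real" where
  "wrap_term \<alpha> v a b =
     v * (a powr (1 - \<alpha>) + b powr (1 - \<alpha>) - 2 * ((a + b) / 2) powr (1 - \<alpha>)) / (\<alpha> - 1)"

definition wrap_term_deriv :: "real \<Rightarrow> real \<Rightarrow> real \<Rightarrow> real \<Rightarrow> real \<Rightarrow> real \<Rightarrow> real \<Rightarrow> real" where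
  "wrap_term_deriv \<alpha> v a b v' a' b' =
     v' * (a powr (1 - \<alpha>) + b powr (1 - \<alpha>) - 2 * ((a + b) / 2) powr (1 - \<alpha>)) / (\<alpha> - 1)
     - v * (a powr (-\<alpha>) * a' + b powr (-\<alpha>) * b' - ((a + b) / 2) powr (-\<alpha>) * (a' + b'))"

text \<open>If \<open>p\<close> is the velocity over the period from \<open>u\<close> to \<open>u + 1\<close>, its two halves are the arcs that
  the intrinsic distance has to choose from, and \<open>wrap_defect \<alpha> p\<close> is the integral over \<open>w\<close> of the
  difference between the integrands with the intrinsic distance and with the length of the arc.\<close>

definition wrap_defect :: "real \<Rightarrow> (real \<Rightarrow> 'a::euclidean_space) \<Rightarrow> real" where
  "wrap_defect \<alpha> p = wrap_term \<alpha> (norm (p 0))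
     (mean_speed (subarc p (0, 1/2)) / 2) (mean_speed (subarc p (1/2, 1/2)) / 2)"

definition wrap_defect_deriv :: "real \<Rightarrow> (real \<Rightarrow> 'a::euclidean_space) \<Rightarrow> (real \<Rightarrow> 'a) \<Rightarrow> real" where
  "wrap_defect_deriv \<alpha> p k = wrap_term_deriv \<alpha> (norm (p 0))
     (mean_speed (subarc p (0, 1/2)) / 2) (mean_speed (subarc p (1/2, 1/2)) / 2)
     (sgn (p 0) \<bullet> k 0)
     (mean_speed_deriv (subarc p (0, 1/2)) (subarc k (0, 1/2)) / 2)
     (mean_speed_deriv (subarc p (1/2, 1/2)) (subarc k (1/2, 1/2)) / 2)"

lemma mean_velocity_scaleR: "mean_velocity (\<lambda>s. c *\<^sub>R p s) = c *\<^sub>R mean_velocity p"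
  by (simp add: mean_velocity_def)

lemma has_integral_mean_velocity:
  "continuous_on {0..1} p \<Longrightarrow> (p has_integral mean_velocity p) {0..1}"
  unfolding mean_velocity_def by (intro integrable_integral integrable_continuous_real)

lemma has_integral_mean_velocity_inner:
  "continuous_on {0..1} p \<Longrightarrow> ((\<lambda>s. p s \<bullet> v) has_integral mean_velocity p \<bullet> v) {0..1}"
  using has_integral_linear[OF has_integral_mean_velocity bounded_linear_inner_left] by (simp add: o_def)

lemma has_integral_mean_speed:
  "continuous_on {0..1} p \<Longrightarrow> ((\<lambda>s. norm (p s)) has_integral mean_speed p) {0..1}"
  unfolding mean_speed_def by (intro integrable_integral integrable_continuous_real continuous_intros)

lemma has_integral_mean_speed_deriv:
  assumes "continuous_on {0..1} p" "\<And>s. s \<in> {0..1} \<Longrightarrow> p s \<noteq> 0" "continuous_on {0..1} k"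
  shows "((\<lambda>s. sgn (p s) \<bullet> k s) has_integral mean_speed_deriv p k) {0..1}"
  unfolding mean_speed_deriv_def using assms
  by (intro integrable_integral integrable_continuous_real continuous_intros) auto

lemma mean_velocity_add_scaleR:
  assumes "continuous_on {0..1} p" "continuous_on {0..1} k"
  shows "mean_velocity (\<lambda>s. p s + t *\<^sub>R k s) = mean_velocity p + t *\<^sub>R mean_velocity k"
  using has_integral_add[OF has_integral_mean_velocity[OF assms(1)]
      has_integral_cmul[OF has_integral_mean_velocity[OF assms(2)]]]
  by (simp add: integral_unique mean_velocity_def)

lemma norm_mean_velocity_le:
  assumes "continuous_on {0..1} p" "\<And>s. s \<in> {0..1} \<Longrightarrow> norm (p s) \<le> B"
  shows "norm (mean_velocity p) \<le> B"
  using integral_bound[of 0 1 p B] assms by (simp add: mean_velocity_def)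

lemma norm_mean_velocity_le_mean_speed:
  assumes "continuous_on {0..1} p"
  shows "norm (mean_velocity p) \<le> mean_speed p"
  unfolding mean_velocity_def mean_speed_def
  by (intro integral_norm_bound_integral integrable_continuous_real continuous_intros assms) simp

lemma mean_speed_ge:
  assumes "continuous_on {0..1} p" "\<And>s. s \<in> {0..1} \<Longrightarrow> c \<le> norm (p s)"
  shows "c \<le> mean_speed p"
  using has_integral_le[OF has_integral_const_real[of c 0 1] has_integral_mean_speed[OF assms(1)]] assms(2)
  by simp

lemma mean_speed_deriv_add_scaleR:
  assumes "continuous_on {0..1} p" "\<And>s. s \<in> {0..1} \<Longrightarrow> p s \<noteq> 0"
    and "continuous_on {0..1} k" "continuous_on {0..1} k'"
  shows "mean_speed_deriv p (\<lambda>s. k s + c *\<^sub>R k' s) = mean_speed_deriv p k + c * mean_speed_deriv p k'"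
proof -
  have "((\<lambda>s. sgn (p s) \<bullet> k s + c * (sgn (p s) \<bullet> k' s)) has_integral
      mean_speed_deriv p k + c * mean_speed_deriv p k') {0..1}"
    by (intro has_integral_add has_integral_mult_right has_integral_mean_speed_deriv assms)
  then show ?thesis
    by (simp add: mean_speed_deriv_def[of p "\<lambda>s. k s + c *\<^sub>R k' s"] inner_add_right integral_unique)
qed

lemma mean_speed_deriv_scaleR: "mean_speed_deriv p (\<lambda>s. c *\<^sub>R k s) = c * mean_speed_deriv p k"
  by (simp add: mean_speed_deriv_def)

lemma chord_arc_density_deriv_add_scaleR:
  assumes "continuous_on {0..1} p" "\<And>s. s \<in> {0..1} \<Longrightarrow> p s \<noteq> 0"
    and "continuous_on {0..1} k" "continuous_on {0..1} k'"
  shows "chord_arc_density_deriv \<alpha> p (\<lambda>s. k s + c *\<^sub>R k' s) =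
    chord_arc_density_deriv \<alpha> p k + c * chord_arc_density_deriv \<alpha> p k'"
proof -
  have "mean_speed_deriv p (\<lambda>s. k s + c *\<^sub>R k' s) = mean_speed_deriv p k + c * mean_speed_deriv p k'"
    by (rule mean_speed_deriv_add_scaleR[OF assms])
  then show ?thesis
    by (simp add: chord_arc_density_deriv_def mean_velocity_add_scaleR[OF assms(3,4)] inner_add_right ring_distribs)
qed

lemma chord_arc_density_deriv_scaleR:
  "chord_arc_density_deriv \<alpha> p (\<lambda>s. c *\<^sub>R k s) = c * chord_arc_density_deriv \<alpha> p k"
  by (simp add: chord_arc_density_deriv_def mean_speed_deriv_scaleR mean_velocity_scaleR ring_distribs mult_ac)

lemma subarc_0 [simp]: "subarc g x 0 = g (fst x)"
  and subarc_1 [simp]: "subarc g x 1 = g (fst x + snd x)"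
  by (simp_all add: subarc_def)

lemma subarc_subarc: "subarc (subarc g (u, w)) (a, b) = subarc g (u + a * w, b * w)"
  by (simp add: subarc_def fun_eq_iff algebra_simps)

lemma subarc_add_scaleR: "subarc (\<lambda>s. p s + t *\<^sub>R k s) x = (\<lambda>s. subarc p x s + t *\<^sub>R subarc k x s)"
  by (simp add: subarc_def fun_eq_iff)

lemma subarc_scaleR: "subarc (\<lambda>s. c *\<^sub>R k s) x = (\<lambda>s. c *\<^sub>R subarc k x s)"
  by (simp add: subarc_def fun_eq_iff)

lemma continuous_on_subarc:
  assumes "continuous_on T g" "\<And>s. s \<in> S \<Longrightarrow> fst x + s * snd x \<in> T"
  shows "continuous_on S (subarc g x)"
  unfolding subarc_def[abs_def]
  by (rule continuous_on_compose2[OF assms(1)]) (auto intro!: continuous_intros assms(2))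

lemma half_mem_unit_interval:
  assumes "x \<in> {(0, 1/2), (1/2, 1/2)}" "s \<in> {0..1::real}"
  shows "fst x + s * snd x \<in> {0..1}"
  using assms by auto

lemma continuous_on_half:
  assumes "continuous_on {0..1} g" "x \<in> {(0, 1/2), (1/2, 1/2)}"
  shows "continuous_on {0..1} (subarc g x)"
  by (rule continuous_on_subarc[OF assms(1) half_mem_unit_interval[OF assms(2)]])

lemma wrap_term_deriv_add_mult:
  "wrap_term_deriv \<alpha> v a b (v1 + c * v2) (a1 + c * a2) (b1 + c * b2) =
    wrap_term_deriv \<alpha> v a b v1 a1 b1 + c * wrap_term_deriv \<alpha> v a b v2 a2 b2"
  by (simp add: wrap_term_deriv_def add_divide_distrib diff_divide_distrib ring_distribs mult_ac)

lemma wrap_term_deriv_mult: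
  "wrap_term_deriv \<alpha> v a b (c * v') (c * a') (c * b') = c * wrap_term_deriv \<alpha> v a b v' a' b'"
  by (simp add: wrap_term_deriv_def ring_distribs mult_ac)

lemma wrap_defect_deriv_add_scaleR:
  assumes p: "continuous_on {0..1} p" "\<And>s. s \<in> {0..1} \<Longrightarrow> p s \<noteq> 0"
    and k: "continuous_on {0..1} k" "continuous_on {0..1} k'"
  shows "wrap_defect_deriv \<alpha> p (\<lambda>s. k s + c *\<^sub>R k' s) =
    wrap_defect_deriv \<alpha> p k + c * wrap_defect_deriv \<alpha> p k'"
proof -
  have half: "mean_speed_deriv (subarc p x) (subarc (\<lambda>s. k s + c *\<^sub>R k' s) x) / 2
    = mean_speed_deriv (subarc p x) (subarc k x) / 2 + c * (mean_speed_deriv (subarc p x) (subarc k' x) / 2)"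
    if x: "x \<in> {(0, 1/2), (1/2, 1/2)}" for x
  proof -
    have "subarc p x s \<noteq> 0" if "s \<in> {0..1}" for s
      using p(2)[OF half_mem_unit_interval[OF x that]] by (simp add: subarc_def)
    then have "mean_speed_deriv (subarc p x) (\<lambda>s. subarc k x s + c *\<^sub>R subarc k' x s)
        = mean_speed_deriv (subarc p x) (subarc k x) + c * mean_speed_deriv (subarc p x) (subarc k' x)"
      by (intro mean_speed_deriv_add_scaleR continuous_on_half p(1) k x)
    then show ?thesis by (simp add: subarc_add_scaleR add_divide_distrib)
  qed
  show ?thesis
    unfolding wrap_defect_deriv_def inner_add_right inner_scaleR_right
      half[OF insertI1] half[OF insertI2[OF singletonI]]
    by (rule wrap_term_deriv_add_mult)
qed

lemma wrap_defect_deriv_scaleR: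
  "wrap_defect_deriv \<alpha> p (\<lambda>s. c *\<^sub>R k s) = c * wrap_defect_deriv \<alpha> p k"
  by (simp add: wrap_defect_deriv_def subarc_scaleR mean_speed_deriv_scaleR flip: wrap_term_deriv_mult)

lemma increment_eq_mean_velocity:
  fixes f :: "real \<Rightarrow> 'a::euclidean_space"
  assumes "\<And>x. (f has_vector_derivative g x) (at x)"
  shows "f (u + w) - f u = w *\<^sub>R mean_velocity (subarc g (u, w))"
proof -
  have "((\<lambda>s. w *\<^sub>R g (u + s * w)) has_integral f (u + 1 * w) - f (u + 0 * w)) {0..1}"
  proof (rule fundamental_theorem_of_calculus)
    fix s :: real
    have "((\<lambda>s. u + s * w) has_vector_derivative w) (at s)" by (auto intro!: derivative_eq_intros)
    from vector_diff_chain_at[OF this assms]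
    show "((\<lambda>s. f (u + s * w)) has_vector_derivative w *\<^sub>R g (u + s * w)) (at s within {0..1})"
      by (auto simp: o_def intro: has_vector_derivative_at_within)
  qed simp
  from integral_unique[OF this] show ?thesis by (simp add: mean_velocity_def subarc_def[abs_def])
qed

lemma continuous_on_unit_integral:
  fixes H :: "'b::topological_space \<Rightarrow> real \<Rightarrow> 'a::banach"
  assumes "continuous_on UNIV (\<lambda>(x, s). H x s)"
  shows "continuous_on UNIV (\<lambda>x. integral {0..1} (H x))"
  using integral_continuous_on_param[OF continuous_on_subset[OF assms], of UNIV 0 1] by simp

lemma continuous_on_mean_velocity_subarc:
  fixes g :: "real \<Rightarrow> 'a::euclidean_space"
  assumes g: "continuous_on UNIV g"
  shows "continuous_on UNIV (\<lambda>x. mean_velocity (subarc g x))"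
  unfolding mean_velocity_def subarc_def[abs_def]
  by (intro continuous_on_unit_integral)
     (auto simp: split_def intro!: continuous_intros continuous_on_compose2[OF g])

lemma continuous_on_mean_speed_subarc:
  fixes g :: "real \<Rightarrow> 'a::euclidean_space"
  assumes g: "continuous_on UNIV g"
  shows "continuous_on UNIV (\<lambda>x. mean_speed (subarc g x))"
  unfolding mean_speed_def subarc_def
  by (intro continuous_on_unit_integral)
     (auto simp: split_def intro!: continuous_intros continuous_on_compose2[OF g])

lemma continuous_on_mean_speed_deriv_subarc:
  fixes g k :: "real \<Rightarrow> 'a::euclidean_space"
  assumes g: "continuous_on UNIV g" "\<And>u. g u \<noteq> 0" and k: "continuous_on UNIV k"
  shows "continuous_on UNIV (\<lambda>x. mean_speed_deriv (subarc g x) (subarc k x))"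
  unfolding mean_speed_deriv_def subarc_def
  by (intro continuous_on_unit_integral)
     (auto simp: split_def g(2) intro!: continuous_intros continuous_on_compose2[OF g(1)] continuous_on_compose2[OF k])

lemma norm_line_derivative:
  fixes x k :: "'a::real_inner"
  assumes "x + t *\<^sub>R k \<noteq> 0"
  shows "((\<lambda>t. norm (x + t *\<^sub>R k)) has_real_derivative sgn (x + t *\<^sub>R k) \<bullet> k) (at t within U)"
proof -
  have line: "((\<lambda>t. x + t *\<^sub>R k) has_derivative (\<lambda>r. r *\<^sub>R k)) (at t within U)"
    by (auto intro!: derivative_eq_intros)
  have "(\<lambda>r. r *\<^sub>R k \<bullet> sgn (x + t *\<^sub>R k)) = (*) (sgn (x + t *\<^sub>R k) \<bullet> k)"
    by (auto simp: inner_commute)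
  then show ?thesis
    using has_derivative_compose[OF line has_derivative_norm[OF assms]]
    by (simp add: has_field_derivative_def)
qed

lemma mean_speed_line_derivative:
  fixes p k :: "real \<Rightarrow> 'a::euclidean_space"
  assumes p: "continuous_on {0..1} p" and k: "continuous_on {0..1} k"
    and nz: "\<And>t s. t \<in> U \<Longrightarrow> s \<in> {0..1} \<Longrightarrow> p s + t *\<^sub>R k s \<noteq> 0" and U: "t \<in> U" "convex U"
  shows "((\<lambda>t. mean_speed (\<lambda>s. p s + t *\<^sub>R k s)) has_real_derivative
    mean_speed_deriv (\<lambda>s. p s + t *\<^sub>R k s) k) (at t within U)"
proof -
  have snd_cont: "continuous_on (U \<times> {0..1::real}) (\<lambda>x. p (snd x))"
     "continuous_on (U \<times> {0..1::real}) (\<lambda>x. k (snd x))"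
    by (auto intro!: continuous_intros continuous_on_compose2[OF p] continuous_on_compose2[OF k])
  have "((\<lambda>t. integral (cbox 0 1) (\<lambda>s. norm (p s + t *\<^sub>R k s))) has_real_derivative
      integral (cbox 0 1) (\<lambda>s. sgn (p s + t *\<^sub>R k s) \<bullet> k s)) (at t within U)"
  proof (rule leibniz_rule_field_derivative[where fx="\<lambda>t s. sgn (p s + t *\<^sub>R k s) \<bullet> k s"])
    show "continuous_on (U \<times> cbox 0 1) (\<lambda>(t, s). sgn (p s + t *\<^sub>R k s) \<bullet> k s)"
      unfolding split_def using nz by (intro continuous_intros) (auto intro!: snd_cont continuous_intros)
  qed (use nz U in \<open>auto intro!: norm_line_derivative integrable_continuous_real continuous_intros p k\<close>)
  then show ?thesis by (simp add: mean_speed_def mean_speed_deriv_def)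
qed

lemma chord_arc_density_line_derivative:
  fixes p k :: "real \<Rightarrow> 'a::euclidean_space"
  assumes p: "continuous_on {0..1} p" and k: "continuous_on {0..1} k"
    and nz: "\<And>t s. t \<in> U \<Longrightarrow> s \<in> {0..1} \<Longrightarrow> p s + t *\<^sub>R k s \<noteq> 0" and U: "t \<in> U" "convex U"
    and mean_nz: "mean_velocity (\<lambda>s. p s + t *\<^sub>R k s) \<noteq> 0"
  shows "((\<lambda>t. chord_arc_density \<alpha> (\<lambda>s. p s + t *\<^sub>R k s)) has_real_derivative
    chord_arc_density_deriv \<alpha> (\<lambda>s. p s + t *\<^sub>R k s) k) (at t within U)"
proof -
  let ?p = "\<lambda>t s. p s + t *\<^sub>R k s"
  note mean = mean_velocity_add_scaleR[OF p k]
  define D where "D t = norm (mean_velocity (?p t))" for t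
  define L where "L t = mean_speed (?p t)" for t
  have D_pos: "0 < D t" using mean_nz by (simp add: D_def)
  have "D t \<le> L t"
    unfolding D_def L_def by (intro norm_mean_velocity_le_mean_speed continuous_intros p k)
  with D_pos have L_pos: "0 < L t" by simp
  have D_deriv: "(D has_real_derivative sgn (mean_velocity (?p t)) \<bullet> mean_velocity k) (at t within U)"
    using mean_nz unfolding D_def[abs_def] mean by (intro norm_line_derivative)
  have L_deriv: "(L has_real_derivative mean_speed_deriv (?p t) k) (at t within U)"
    unfolding L_def[abs_def] by (rule mean_speed_line_derivative[OF p k nz U])
  have end_deriv: "((\<lambda>t. norm (?p t s)) has_real_derivative sgn (?p t s) \<bullet> k s) (at t within U)"
    if "s \<in> {0..1}" for s
    using nz[OF U(1) that] by (rule norm_line_derivative)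
  have powr_pred: "D t powr (-\<alpha> - 1) = D t powr (-\<alpha>) / D t" "L t powr (-\<alpha> - 1) = L t powr (-\<alpha>) / L t"
    using D_pos L_pos by (auto simp: powr_diff)
  show ?thesis
    unfolding chord_arc_density_def chord_arc_density_deriv_def D_def[symmetric] L_def[symmetric]
    by (rule derivative_eq_intros D_deriv L_deriv end_deriv[of 1] end_deriv[of 0] D_pos L_pos refl | simp)+
       (simp add: powr_pred algebra_simps)
qed

lemma wrap_term_has_derivative:
  assumes v: "(v has_real_derivative v') (at t within U)"
    and a: "(a has_real_derivative a') (at t within U)" "0 < a t"
    and b: "(b has_real_derivative b') (at t within U)" "0 < b t"
    and \<alpha>: "\<alpha> \<noteq> 1"
  shows "((\<lambda>t. wrap_term \<alpha> (v t) (a t) (b t)) has_real_derivative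
    wrap_term_deriv \<alpha> (v t) (a t) (b t) v' a' b') (at t within U)"
proof -
  have powr_deriv: "((\<lambda>t. X t powr (1 - \<alpha>)) has_real_derivative (1 - \<alpha>) * X t powr (-\<alpha>) * X') (at t within U)"
    if "(X has_real_derivative X') (at t within U)" "0 < X t" for X X'
    using DERIV_chain2[OF has_real_derivative_powr[OF that(2), of "1 - \<alpha>"] that(1)] by simp
  have mean_deriv: "((\<lambda>t. (a t + b t) / 2) has_real_derivative (a' + b') / 2) (at t within U)"
    by (intro DERIV_cdivide DERIV_add a b)
  let ?A = "a t powr (-\<alpha>)" and ?B = "b t powr (-\<alpha>)" and ?M = "((a t + b t) / 2) powr (-\<alpha>)"
  let ?Q = "a t powr (1 - \<alpha>) + b t powr (1 - \<alpha>) - 2 * ((a t + b t) / 2) powr (1 - \<alpha>)"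
  have "((\<lambda>t. wrap_term \<alpha> (v t) (a t) (b t)) has_real_derivative
     (v' * ?Q + ((1 - \<alpha>) * ?A * a' + (1 - \<alpha>) * ?B * b' - 2 * ((1 - \<alpha>) * ?M * ((a' + b') / 2))) * v t) / (\<alpha> - 1))
     (at t within U)"
    unfolding wrap_term_def using a b
    by (intro DERIV_cdivide DERIV_mult v DERIV_diff DERIV_add DERIV_cmult powr_deriv mean_deriv) auto
  moreover have "((1 - \<alpha>) * ?A * a' + (1 - \<alpha>) * ?B * b' - 2 * ((1 - \<alpha>) * ?M * ((a' + b') / 2))) * v t
     = - (v t * (?A * a' + ?B * b' - ?M * (a' + b'))) * (\<alpha> - 1)"
    by (simp add: field_simps)
  ultimately show ?thesis
    using \<alpha> by (simp add: wrap_term_deriv_def add_divide_distrib)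
qed

lemma wrap_defect_line_derivative:
  fixes p k :: "real \<Rightarrow> 'a::euclidean_space"
  assumes p: "continuous_on {0..1} p" and k: "continuous_on {0..1} k"
    and c: "0 < c" "\<And>t s. t \<in> U \<Longrightarrow> s \<in> {0..1} \<Longrightarrow> c \<le> norm (p s + t *\<^sub>R k s)"
    and U: "t \<in> U" "convex U" and \<alpha>: "\<alpha> \<noteq> 1"
  shows "((\<lambda>t. wrap_defect \<alpha> (\<lambda>s. p s + t *\<^sub>R k s)) has_real_derivative
    wrap_defect_deriv \<alpha> (\<lambda>s. p s + t *\<^sub>R k s) k) (at t within U)"
proof -
  have half: "((\<lambda>t. mean_speed (subarc (\<lambda>s. p s + t *\<^sub>R k s) x) / 2) has_real_derivative
      mean_speed_deriv (subarc (\<lambda>s. p s + t *\<^sub>R k s) x) (subarc k x) / 2) (at t within U)"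
    "0 < mean_speed (subarc (\<lambda>s. p s + t *\<^sub>R k s) x) / 2"
    if x: "x \<in> {(0, 1/2), (1/2, 1/2)}" for x
  proof -
    have ge: "c \<le> norm (subarc p x s + t *\<^sub>R subarc k x s)" if "t \<in> U" "s \<in> {0..1}" for t s
      using c(2)[OF that(1) half_mem_unit_interval[OF x that(2)]] by (simp add: subarc_def)
    have nz: "subarc p x s + t *\<^sub>R subarc k x s \<noteq> 0" if "t \<in> U" "s \<in> {0..1}" for t s
      using ge[OF that] c(1) by auto
    note cont = continuous_on_half[OF p x] continuous_on_half[OF k x]
    show "((\<lambda>t. mean_speed (subarc (\<lambda>s. p s + t *\<^sub>R k s) x) / 2) has_real_derivative
      mean_speed_deriv (subarc (\<lambda>s. p s + t *\<^sub>R k s) x) (subarc k x) / 2) (at t within U)"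
      unfolding subarc_add_scaleR
      by (rule DERIV_cdivide[OF mean_speed_line_derivative[OF cont nz U]])
    have "c \<le> mean_speed (subarc (\<lambda>s. p s + t *\<^sub>R k s) x)"
      unfolding subarc_add_scaleR by (intro mean_speed_ge continuous_intros cont ge U)
    then show "0 < mean_speed (subarc (\<lambda>s. p s + t *\<^sub>R k s) x) / 2" using c(1) by simp
  qed
  have "p 0 + t *\<^sub>R k 0 \<noteq> 0" using c(1) c(2)[OF U(1), of 0] by auto
  then show ?thesis
    unfolding wrap_defect_def wrap_defect_deriv_def
    by (intro wrap_term_has_derivative norm_line_derivative half \<alpha>) auto
qed

section \<open>Variations of velocity paths\<close>

datatype 'a path_variation = Path_Variation
  (var_step: real) (var_base: "real \<Rightarrow> 'a") (var_shift: "real \<Rightarrow> 'a") (var_dir: "real \<Rightarrow> 'a")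

definition varied_path :: "'a::real_vector path_variation \<Rightarrow> bool \<Rightarrow> real \<Rightarrow> 'a" where
  "varied_path i t s = var_base i s + (if t then var_step i else 0) *\<^sub>R var_shift i s"

definition path_variations :: "real \<Rightarrow> real \<Rightarrow> 'a::euclidean_space path_variation set" where
  "path_variations c C = {i. 0 \<le> var_step i \<and> var_step i \<le> 1 \<and>
     continuous_on {0..1} (var_base i) \<and> continuous_on {0..1} (var_shift i) \<and>
     continuous_on {0..1} (var_dir i) \<and>
     (\<forall>s\<in>{0..1}. norm (var_base i s) \<le> C \<and> norm (var_shift i s) \<le> 1 \<and> norm (var_dir i s) \<le> 1 \<and>
       (\<forall>t. c \<le> norm (varied_path i t s)))}"

definition chord_variations :: "real \<Rightarrow> real \<Rightarrow> 'a::euclidean_space path_variation set" where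
  "chord_variations c C = {i \<in> path_variations c C. \<forall>t. c \<le> norm (mean_velocity (varied_path i t))}"

definition restrict_variation :: "real \<times> real \<Rightarrow> 'a path_variation \<Rightarrow> 'a path_variation" where
  "restrict_variation x i = Path_Variation (var_step i)
     (subarc (var_base i) x) (subarc (var_shift i) x) (subarc (var_dir i) x)"

lemma path_variationsD:
  assumes "i \<in> path_variations c C"
  shows "0 \<le> var_step i" "var_step i \<le> 1" "continuous_on {0..1} (var_base i)"
    "continuous_on {0..1} (var_shift i)" "continuous_on {0..1} (var_dir i)"
    "s \<in> {0..1} \<Longrightarrow> norm (var_base i s) \<le> C" "s \<in> {0..1} \<Longrightarrow> norm (var_shift i s) \<le> 1"
    "s \<in> {0..1} \<Longrightarrow> norm (var_dir i s) \<le> 1" "s \<in> {0..1} \<Longrightarrow> c \<le> norm (varied_path i t s)"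
  using assms by (simp_all add: path_variations_def)

lemma varied_path_continuous:
  "i \<in> path_variations c C \<Longrightarrow> continuous_on {0..1} (varied_path i t)"
  unfolding varied_path_def[abs_def] by (intro continuous_intros path_variationsD)

lemma mean_velocity_varied_path:
  "i \<in> path_variations c C \<Longrightarrow> mean_velocity (varied_path i t) =
    mean_velocity (var_base i) + (if t then var_step i else 0) *\<^sub>R mean_velocity (var_shift i)"
  unfolding varied_path_def[abs_def] by (intro mean_velocity_add_scaleR path_variationsD)

lemma restrict_variation_simps:
  "var_step (restrict_variation x i) = var_step i"
  "var_dir (restrict_variation x i) = subarc (var_dir i) x"
  by (simp_all add: restrict_variation_def)

lemma varied_path_restrict: "varied_path (restrict_variation x i) t = subarc (varied_path i t) x"
  by (simp add: varied_path_def restrict_variation_def subarc_def fun_eq_iff)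

lemma restrict_variation_mem:
  assumes x: "x \<in> {(0, 1/2), (1/2, 1/2)}" and i: "i \<in> path_variations c C"
  shows "restrict_variation x i \<in> path_variations c C"
proof -
  note in_unit = half_mem_unit_interval[OF x]
  have "c \<le> norm (varied_path (restrict_variation x i) t s)" if "s \<in> {0..1}" for s t
    using path_variationsD(9)[OF i in_unit[OF that]] unfolding varied_path_restrict by (simp add: subarc_def)
  moreover have "norm (subarc (var_base i) x s) \<le> C" "norm (subarc (var_shift i) x s) \<le> 1"
    "norm (subarc (var_dir i) x s) \<le> 1" if "s \<in> {0..1}" for s
    using path_variationsD(6,7,8)[OF i in_unit[OF that]] by (simp_all add: subarc_def)
  moreover note path_variationsD(3,4,5)[OF i, THEN continuous_on_half, OF x]
  ultimately show ?thesis
    using path_variationsD(1,2)[OF i] unfolding path_variations_def mem_Collect_eq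
    by (simp add: restrict_variation_def)
qed

lemma lip_wrap_term_deriv:
  assumes v: "lip_family S \<nu> (\<lambda>_. 1) v" "lip_family S \<nu> (\<lambda>_. 1) v'"
    and a: "lip_family S \<nu> (\<lambda>_. 1) a" "\<And>i t. i \<in> S \<Longrightarrow> c \<le> a i t" "lip_family S \<nu> (\<lambda>_. 1) a'"
    and b: "lip_family S \<nu> (\<lambda>_. 1) b" "\<And>i t. i \<in> S \<Longrightarrow> c \<le> b i t" "lip_family S \<nu> (\<lambda>_. 1) b'"
    and c: "0 < c"
  shows "lip_family S \<nu> (\<lambda>_. 1) (\<lambda>i t. wrap_term_deriv \<alpha> (v i t) (a i t) (b i t) (v' i t) (a' i t) (b' i t))"
proof -
  have mean: "lip_family S \<nu> (\<lambda>_. 1) (\<lambda>i t. (a i t + b i t) / 2)"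
    using lip_family_cmult[OF lip_family_add[OF a(1) b(1)], of "1/2"] by simp
  have mean_ge: "c \<le> (a i t + b i t) / 2" if "i \<in> S" for i t
    using a(2)[OF that, of t] b(2)[OF that, of t] by simp
  note powr = lip_family_powr[OF a(1) c a(2)] lip_family_powr[OF b(1) c b(2)]
    lip_family_powr[OF mean c mean_ge]
  have "lip_family S \<nu> (\<lambda>_. 1) (\<lambda>i t. (1 / (\<alpha> - 1)) * (v' i t *
      (a i t powr (1 - \<alpha>) + b i t powr (1 - \<alpha>) - 2 * ((a i t + b i t) / 2) powr (1 - \<alpha>)))
    - v i t * (a i t powr (-\<alpha>) * a' i t + b i t powr (-\<alpha>) * b' i t
        - ((a i t + b i t) / 2) powr (-\<alpha>) * (a' i t + b' i t)))"
    by (intro lip_family_diff lip_family_add lip_family_cmult lip_family_bounded_mult powr v a(3) b(3))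
  then show ?thesis by (simp add: wrap_term_deriv_def)
qed

definition var_oscillation :: "'a::euclidean_space path_variation \<Rightarrow> real \<Rightarrow> real" where
  "var_oscillation i s = norm (var_base i s - mean_velocity (var_base i))
     + norm (var_shift i s - mean_velocity (var_shift i)) + norm (var_dir i s - mean_velocity (var_dir i))"

definition square_oscillation :: "'a::euclidean_space path_variation \<Rightarrow> real" where
  "square_oscillation i = integral {0..1} (\<lambda>s. (var_oscillation i s)\<^sup>2)"

lemma var_oscillation_continuous:
  "i \<in> path_variations c C \<Longrightarrow> continuous_on {0..1} (var_oscillation i)"
  unfolding var_oscillation_def[abs_def] by (intro continuous_intros path_variationsD)

context
  fixes c C :: real
  assumes c: "0 < c"
begin

private abbreviation (input) "Paths \<equiv> path_variations c C"

lemma varied_path_nonzero: "i \<in> Paths \<Longrightarrow> s \<in> {0..1} \<Longrightarrow> varied_path i t s \<noteq> 0"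
  using path_variationsD(9)[of i c C s t] c by auto

lemma sgn_varied_path_continuous: "i \<in> Paths \<Longrightarrow> continuous_on {0..1} (\<lambda>s. sgn (varied_path i t s))"
  by (intro continuous_intros varied_path_continuous ballI varied_path_nonzero)

lemma lip_varied_path:
  "lip_family (Paths \<times> {0..1}) (\<lambda>x. var_step (fst x)) (\<lambda>_. 1) (\<lambda>x t. varied_path (fst x) t (snd x))"
  unfolding varied_path_def
  by (intro lip_family_add lip_family_stationary lip_family_step;
      rule bigo_principal_norm_mono[where g="\<lambda>_. max C 1"] bigoI[where c=1])
     (auto simp: eventually_principal path_variationsD le_max_iff_disj)

lemma lip_var_dir:
  "lip_family (Paths \<times> {0..1}) (\<lambda>x. var_step (fst x)) (\<lambda>_. 1) (\<lambda>x t. var_dir (fst x) (snd x))"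
  by (intro lip_family_stationary bigo_principal_norm_mono[where g="\<lambda>_. 1"])
     (auto simp: path_variationsD)

lemma lip_sgn_varied_path:
  "lip_family (Paths \<times> {0..1}) (\<lambda>x. var_step (fst x)) (\<lambda>_. 1) (\<lambda>x t. sgn (varied_path (fst x) t (snd x)))"
  by (rule lip_family_sgn[OF lip_varied_path c]) (auto intro: path_variationsD)

lemma lip_mean_velocity: "lip_family Paths var_step (\<lambda>_. 1) (\<lambda>i t. mean_velocity (varied_path i t))"
  unfolding mean_velocity_def
  by (rule lip_family_integral_bounded[OF lip_varied_path, unfolded fst_conv snd_conv])
     (rule varied_path_continuous)

lemma lip_mean_speed: "lip_family Paths var_step (\<lambda>_. 1) (\<lambda>i t. mean_speed (varied_path i t))"
  unfolding mean_speed_def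
  by (rule lip_family_integral_bounded[OF lip_family_norm[OF lip_varied_path], unfolded fst_conv snd_conv])
     (intro continuous_intros varied_path_continuous)

lemma lip_mean_speed_deriv:
  "lip_family Paths var_step (\<lambda>_. 1) (\<lambda>i t. mean_speed_deriv (varied_path i t) (var_dir i))"
  unfolding mean_speed_deriv_def
  by (rule lip_family_integral_bounded[OF lip_family_bounded_inner[OF lip_sgn_varied_path lip_var_dir],
        unfolded fst_conv snd_conv])
     (intro continuous_intros sgn_varied_path_continuous path_variationsD(5))

lemma mean_speed_varied_path_ge: "i \<in> Paths \<Longrightarrow> c \<le> mean_speed (varied_path i t)"
  by (intro mean_speed_ge varied_path_continuous path_variationsD(9))

lemma lip_wrap_defect_deriv:
  "lip_family Paths var_step (\<lambda>_. 1) (\<lambda>i t. wrap_defect_deriv \<alpha> (varied_path i t) (var_dir i))"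
proof -
  have half: "lip_family Paths var_step (\<lambda>_. 1) (\<lambda>i t. mean_speed (subarc (varied_path i t) x) / 2)"
    "lip_family Paths var_step (\<lambda>_. 1)
      (\<lambda>i t. mean_speed_deriv (subarc (varied_path i t) x) (subarc (var_dir i) x) / 2)"
    "i \<in> Paths \<Longrightarrow> c / 2 \<le> mean_speed (subarc (varied_path i t) x) / 2"
    if x: "x \<in> {(0, 1/2), (1/2, 1/2)}" for x i t
  proof -
    have "restrict_variation x ` Paths \<subseteq> Paths" using restrict_variation_mem[OF x] by blast
    from lip_family_reindex[OF lip_mean_speed this] lip_family_reindex[OF lip_mean_speed_deriv this]
    show "lip_family Paths var_step (\<lambda>_. 1) (\<lambda>i t. mean_speed (subarc (varied_path i t) x) / 2)"
      "lip_family Paths var_step (\<lambda>_. 1)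
        (\<lambda>i t. mean_speed_deriv (subarc (varied_path i t) x) (subarc (var_dir i) x) / 2)"
      unfolding varied_path_restrict restrict_variation_simps
      by (auto dest: lip_family_cmult[of _ _ _ _ "1/2"])
    show "c / 2 \<le> mean_speed (subarc (varied_path i t) x) / 2" if "i \<in> Paths"
      using mean_speed_varied_path_ge[OF restrict_variation_mem[OF x that], of t]
      by (simp add: varied_path_restrict)
  qed
  have at_0: "lip_family Paths var_step (\<lambda>_. 1) (\<lambda>i t. varied_path i t 0)"
    "lip_family Paths var_step (\<lambda>_. 1) (\<lambda>i t. sgn (varied_path i t 0))"
    "lip_family Paths var_step (\<lambda>_. 1) (\<lambda>i t. var_dir i 0)"
    using lip_family_at[OF lip_varied_path, of 0] lip_family_at[OF lip_sgn_varied_path, of 0]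
      lip_family_at[OF lip_var_dir, of 0] by simp_all
  have "0 < c / 2" using c by simp
  then show ?thesis
    unfolding wrap_defect_deriv_def
    by (intro lip_wrap_term_deriv[where c="c / 2"] lip_family_norm lip_family_bounded_inner at_0 half) auto
qed

lemma lip_varied_path_oscillation:
  "lip_family (Paths \<times> {0..1}) (\<lambda>x. var_step (fst x)) (\<lambda>x. var_oscillation (fst x) (snd x))
    (\<lambda>x t. varied_path (fst x) t (snd x) - mean_velocity (varied_path (fst x) t))"
proof (rule lip_family_cong)
  let ?S = "path_variations c C \<times> {0..1} :: ('a path_variation \<times> real) set"
  have bound: "(\<lambda>x. norm (f x)) \<in> O[principal ?S](\<lambda>x. var_oscillation (fst x) (snd x))"
    if "\<And>x. norm (f x) \<le> var_oscillation (fst x) (snd x)" for f :: "'a path_variation \<times> real \<Rightarrow> 'a"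
    by (rule bigo_principal_norm_mono[OF landau_o.big_refl that])
  have step: "(\<lambda>x. var_step (fst x)) \<in> O[principal ?S](\<lambda>_. 1)"
    by (rule bigoI[where c=1]) (auto simp: eventually_principal path_variationsD)
  show "lip_family ?S (\<lambda>x. var_step (fst x)) (\<lambda>x. var_oscillation (fst x) (snd x))
    (\<lambda>x t. (var_base (fst x) (snd x) - mean_velocity (var_base (fst x)))
       + (if t then var_step (fst x) else 0) *\<^sub>R (var_shift (fst x) (snd x) - mean_velocity (var_shift (fst x))))"
    by (intro lip_family_add lip_family_stationary lip_family_step step bound)
       (simp_all add: var_oscillation_def)
qed (auto simp: mean_velocity_varied_path varied_path_def scaleR_diff_right)

end

section \<open>Quadratic bounds for the path functionals\<close>

text \<open>Each integrand below is a product of two oscillations about the mean, which makes the defects quadratic.\<close>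

lemma mean_speed_defect:
  fixes p :: "real \<Rightarrow> 'a::euclidean_space"
  assumes p: "continuous_on {0..1} p" "\<And>s. s \<in> {0..1} \<Longrightarrow> p s \<noteq> 0" and mean: "mean_velocity p \<noteq> 0"
  shows "mean_speed p - norm (mean_velocity p) =
    integral {0..1} (\<lambda>s. 1/2 * norm (p s) * (norm (sgn (p s) - sgn (mean_velocity p)))\<^sup>2)"
proof -
  let ?D = "mean_velocity p"
  have pointwise: "1/2 * norm (p s) * (norm (sgn (p s) - sgn ?D))\<^sup>2 = norm (p s) - p s \<bullet> sgn ?D"
    if "s \<in> {0..1}" for s
  proof -
    have "(norm (sgn (p s) - sgn ?D))\<^sup>2 = 2 - 2 * (sgn (p s) \<bullet> sgn ?D)"
      using dot_norm_neg[of "sgn (p s)" "sgn ?D"] p(2)[OF that] mean by (simp add: norm_sgn)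
    moreover have "norm (p s) * (sgn (p s) \<bullet> sgn ?D) = p s \<bullet> sgn ?D"
      using p(2)[OF that] by (simp add: sgn_div_norm)
    ultimately show ?thesis by (simp add: right_diff_distrib)
  qed
  have "((\<lambda>s. norm (p s) - p s \<bullet> sgn ?D) has_integral mean_speed p - ?D \<bullet> sgn ?D) {0..1}"
    by (intro has_integral_diff has_integral_mean_speed has_integral_mean_velocity_inner p)
  moreover have "?D \<bullet> sgn ?D = norm ?D"
    using mean by (simp add: sgn_div_norm dot_square_norm power2_eq_square)
  ultimately have "((\<lambda>s. norm (p s) - p s \<bullet> sgn ?D) has_integral mean_speed p - norm ?D) {0..1}"
    by simp
  then have "((\<lambda>s. 1/2 * norm (p s) * (norm (sgn (p s) - sgn ?D))\<^sup>2) has_integral mean_speed p - norm ?D) {0..1}"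
    by (rule has_integral_eq[rotated]) (rule pointwise[symmetric])
  then show ?thesis by (rule integral_unique[symmetric])
qed

lemma mean_sgn_defect:
  fixes p :: "real \<Rightarrow> 'a::euclidean_space"
  assumes p: "continuous_on {0..1} p" "\<And>s. s \<in> {0..1} \<Longrightarrow> p s \<noteq> 0"
  defines "D \<equiv> mean_velocity p"
  assumes mean: "D \<noteq> 0"
  shows "norm D *\<^sub>R (mean_velocity (\<lambda>s. sgn (p s)) - sgn D) =
    - integral {0..1} (\<lambda>s. (norm (p s) - norm D) *\<^sub>R (sgn (p s) - sgn D)) - (mean_speed p - norm D) *\<^sub>R sgn D"
proof -
  have "((\<lambda>s. (p s - norm (p s) *\<^sub>R sgn D) - norm D *\<^sub>R (sgn (p s) - sgn D)) has_integral
      (D - mean_speed p *\<^sub>R sgn D) - norm D *\<^sub>R (mean_velocity (\<lambda>s. sgn (p s)) - sgn D)) {0..1}"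
    using p unfolding D_def
    by (intro has_integral_diff has_integral_cmul has_integral_scaleR_left has_integral_mean_velocity
        has_integral_mean_speed has_integral_const_real[of _ 0 1, simplified] continuous_intros) auto
  then have "((\<lambda>s. (norm (p s) - norm D) *\<^sub>R (sgn (p s) - sgn D)) has_integral
      (D - mean_speed p *\<^sub>R sgn D) - norm D *\<^sub>R (mean_velocity (\<lambda>s. sgn (p s)) - sgn D)) {0..1}"
    by (rule has_integral_eq[rotated]) (use p(2) in \<open>simp add: algebra_simps sgn_div_norm\<close>)
  moreover have "D = norm D *\<^sub>R sgn D" using mean by (simp add: sgn_div_norm)
  ultimately show ?thesis by (auto simp: algebra_simps dest!: integral_unique)
qed

lemma mean_speed_deriv_defect:
  fixes p k :: "real \<Rightarrow> 'a::euclidean_space"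
  assumes p: "continuous_on {0..1} p" "\<And>s. s \<in> {0..1} \<Longrightarrow> p s \<noteq> 0" and k: "continuous_on {0..1} k"
  shows "mean_speed_deriv p k - v \<bullet> mean_velocity k =
    integral {0..1} (\<lambda>s. (sgn (p s) - v) \<bullet> (k s - mean_velocity k))
    + (mean_velocity (\<lambda>s. sgn (p s)) - v) \<bullet> mean_velocity k"
proof -
  let ?K = "mean_velocity k"
  have "((\<lambda>s. (sgn (p s) \<bullet> k s - k s \<bullet> v) - (sgn (p s) \<bullet> ?K - v \<bullet> ?K)) has_integral
      (mean_speed_deriv p k - ?K \<bullet> v) - (mean_velocity (\<lambda>s. sgn (p s)) \<bullet> ?K - v \<bullet> ?K)) {0..1}"
    using p k
    by (intro has_integral_diff has_integral_mean_velocity_inner has_integral_mean_speed_deriv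
        has_integral_const_real[of _ 0 1, simplified] continuous_intros) auto
  then have "((\<lambda>s. (sgn (p s) - v) \<bullet> (k s - ?K)) has_integral
      (mean_speed_deriv p k - ?K \<bullet> v) - (mean_velocity (\<lambda>s. sgn (p s)) \<bullet> ?K - v \<bullet> ?K)) {0..1}"
    by (rule has_integral_eq[rotated]) (simp add: algebra_simps inner_commute)
  from integral_unique[OF this] show ?thesis by (simp add: inner_diff_left inner_diff_right inner_commute)
qed

context
  fixes c C :: real
  assumes c: "0 < c"
begin

private abbreviation (input) "Chords \<equiv> chord_variations c C"
private abbreviation (input) "Points \<equiv> chord_variations c C \<times> {0..1::real}"
private abbreviation (input) "step \<equiv> (\<lambda>x. var_step (fst x))"
private abbreviation (input) "osc \<equiv> (\<lambda>x. var_oscillation (fst x) (snd x))"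
private abbreviation (input) "vel \<equiv> (\<lambda>x t. varied_path (fst x) t (snd x))"
private abbreviation (input) "mean \<equiv> (\<lambda>i t. mean_velocity (varied_path i t))"
private abbreviation (input) "speed \<equiv> (\<lambda>i t. mean_speed (varied_path i t))"

lemma chord_variationsD:
  assumes "i \<in> Chords"
  shows "i \<in> path_variations c C" "c \<le> norm (mean i t)" "mean i t \<noteq> 0"
  using assms c by (auto simp: chord_variations_def dest: spec[of _ t])

lemma chord_restrict:
  "lip_family (path_variations c C) \<nu> z X \<Longrightarrow> lip_family Chords \<nu> z X"
  "lip_family (path_variations c C \<times> {0..1}) \<nu>' z' X' \<Longrightarrow> lip_family Points \<nu>' z' X'"
  by (auto elim!: lip_family_reindex[where \<phi>="\<lambda>x. x"] dest: chord_variationsD(1))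

lemmas chord_continuous =
  varied_path_continuous[OF chord_variationsD(1)] sgn_varied_path_continuous[OF c chord_variationsD(1)]
  path_variationsD(5)[OF chord_variationsD(1)] var_oscillation_continuous[OF chord_variationsD(1)]

lemma chord_path_ge: "x \<in> Points \<Longrightarrow> c \<le> norm (vel x t)"
  by (auto simp: mem_Times_iff intro: path_variationsD(9) chord_variationsD(1))

lemma lip_mean: "lip_family Chords var_step (\<lambda>_. 1) mean"
  by (rule chord_restrict(1)[OF lip_mean_velocity[OF c]])

lemma lip_mean_lift: "lip_family Points step (\<lambda>_. 1) (\<lambda>x. mean (fst x))"
  by (rule lip_family_lift[OF lip_mean])

lemma lip_sgn_mean: "lip_family Chords var_step (\<lambda>_. 1) (\<lambda>i t. sgn (mean i t))"
  by (rule lip_family_sgn[OF lip_mean c chord_variationsD(2)])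

lemma lip_path: "lip_family Points step (\<lambda>_. 1) vel"
  by (rule chord_restrict(2)[OF lip_varied_path[OF c]])

lemma lip_path_oscillation: "lip_family Points step osc (\<lambda>x t. vel x t - mean (fst x) t)"
  by (rule chord_restrict(2)[OF lip_varied_path_oscillation[OF c]])

lemma lip_norm_oscillation: "lip_family Points step osc (\<lambda>x t. norm (vel x t) - norm (mean (fst x) t))"
  by (rule lip_family_norm_diff[OF lip_path lip_mean_lift lip_path_oscillation c chord_path_ge])

lemma lip_sgn_oscillation: "lip_family Points step osc (\<lambda>x t. sgn (vel x t) - sgn (mean (fst x) t))"
  by (rule lip_family_sgn_diff[OF lip_path lip_mean_lift lip_path_oscillation c chord_path_ge])
     (auto intro: chord_variationsD)

lemma lip_dir_oscillation:
  "lip_family Points step osc (\<lambda>x t. var_dir (fst x) (snd x) - mean_velocity (var_dir (fst x)))"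
  by (intro lip_family_stationary bigo_principal_norm_mono[OF landau_o.big_refl])
     (simp add: var_oscillation_def)

lemma lip_dir_mean: "lip_family Chords var_step (\<lambda>_. 1) (\<lambda>i t. mean_velocity (var_dir i))"
  by (intro lip_family_stationary bigo_principal_norm_mono[where g="\<lambda>_. 1"])
     (auto intro!: norm_mean_velocity_le path_variationsD dest: chord_variationsD(1))

lemma lip_square_integral:
  fixes X :: "'a::euclidean_space path_variation \<times> real \<Rightarrow> bool \<Rightarrow> 'b::banach"
  assumes "lip_family Points step (\<lambda>x. osc x * osc x) X"
    and "\<And>i t. i \<in> Chords \<Longrightarrow> continuous_on {0..1} (\<lambda>s. X (i, s) t)"
  shows "lip_family Chords var_step square_oscillation (\<lambda>i t. integral {0..1} (\<lambda>s. X (i, s) t))"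
  unfolding square_oscillation_def power2_eq_square
  by (rule lip_family_integral[OF assms, unfolded fst_conv snd_conv])
     (auto intro!: continuous_intros chord_continuous)

lemma lip_speed_defect: "lip_family Chords var_step square_oscillation (\<lambda>i t. speed i t - norm (mean i t))"
proof (rule lip_family_cong)
  let ?X = "\<lambda>x t. (1/2 * norm (vel x t)) * (norm (sgn (vel x t) - sgn (mean (fst x) t)))\<^sup>2"
  have "lip_family Points step (\<lambda>x. osc x * osc x) ?X"
    unfolding power2_eq_square
    by (rule lip_family_bounded_mult[OF lip_family_cmult[OF lip_family_norm[OF lip_path]]
          lip_family_mult[OF lip_family_norm[OF lip_sgn_oscillation] lip_family_norm[OF lip_sgn_oscillation]]])
  then show "lip_family Chords var_step square_oscillation (\<lambda>i t. integral {0..1} (\<lambda>s. ?X (i, s) t))"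
    unfolding fst_conv snd_conv
    by (intro lip_square_integral[of ?X, unfolded fst_conv snd_conv])
       (auto intro!: continuous_intros chord_continuous)
  show "integral {0..1} (\<lambda>s. ?X (i, s) t) = speed i t - norm (mean i t)" if "i \<in> Chords" for i t
    unfolding fst_conv snd_conv
    by (intro mean_speed_defect[symmetric] chord_continuous chord_variationsD that
        varied_path_nonzero[OF c chord_variationsD(1)[OF that]])
qed

lemma lip_mean_sgn_defect:
  "lip_family Chords var_step square_oscillation
    (\<lambda>i t. mean_velocity (\<lambda>s. sgn (varied_path i t s)) - sgn (mean i t))"
proof (rule lip_family_cong)
  let ?X = "\<lambda>x t. (norm (vel x t) - norm (mean (fst x) t)) *\<^sub>R (sgn (vel x t) - sgn (mean (fst x) t))"
  let ?R = "\<lambda>i t. - integral {0..1} (\<lambda>s. ?X (i, s) t) - (speed i t - norm (mean i t)) *\<^sub>R sgn (mean i t)"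
  have "lip_family Points step (\<lambda>x. osc x * osc x) ?X"
    by (rule lip_family_scaleR[OF lip_norm_oscillation lip_sgn_oscillation])
  then have "lip_family Chords var_step square_oscillation (\<lambda>i t. integral {0..1} (\<lambda>s. ?X (i, s) t))"
    unfolding fst_conv snd_conv
    by (intro lip_square_integral[of ?X, unfolded fst_conv snd_conv])
       (auto intro!: continuous_intros chord_continuous)
  then have "lip_family Chords var_step square_oscillation ?R"
    by (intro lip_family_diff lip_family_uminus lip_family_scaleR_bounded[OF lip_speed_defect lip_sgn_mean])
  moreover have "lip_family Chords var_step (\<lambda>_. 1) (\<lambda>i t. inverse (norm (mean i t)))"
    by (rule lip_family_inverse[OF lip_family_norm[OF lip_mean] c chord_variationsD(2)])
  ultimately show "lip_family Chords var_step square_oscillation (\<lambda>i t. inverse (norm (mean i t)) *\<^sub>R ?R i t)"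
    by (rule lip_family_bounded_scaleR[rotated])
  show "inverse (norm (mean i t)) *\<^sub>R ?R i t = mean_velocity (\<lambda>s. sgn (varied_path i t s)) - sgn (mean i t)"
    if i: "i \<in> Chords" for i t
  proof -
    have "norm (mean i t) *\<^sub>R (mean_velocity (\<lambda>s. sgn (varied_path i t s)) - sgn (mean i t)) = ?R i t"
      using mean_sgn_defect[OF chord_continuous(1)[OF i] _ chord_variationsD(3)[OF i]]
        varied_path_nonzero[OF c chord_variationsD(1)[OF i]] by simp
    from this[symmetric] show ?thesis using chord_variationsD(3)[OF i, of t] by simp
  qed
qed

lemma lip_speed_deriv_defect:
  "lip_family Chords var_step square_oscillation
    (\<lambda>i t. mean_speed_deriv (varied_path i t) (var_dir i) - sgn (mean i t) \<bullet> mean_velocity (var_dir i))"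
proof (rule lip_family_cong)
  let ?X = "\<lambda>x t. (sgn (vel x t) - sgn (mean (fst x) t)) \<bullet> (var_dir (fst x) (snd x) - mean_velocity (var_dir (fst x)))"
  have "lip_family Points step (\<lambda>x. osc x * osc x) ?X"
    by (rule lip_family_inner[OF lip_sgn_oscillation lip_dir_oscillation])
  then have "lip_family Chords var_step square_oscillation (\<lambda>i t. integral {0..1} (\<lambda>s. ?X (i, s) t))"
    unfolding fst_conv snd_conv
    by (intro lip_square_integral[of ?X, unfolded fst_conv snd_conv])
       (auto intro!: continuous_intros chord_continuous)
  then show "lip_family Chords var_step square_oscillation (\<lambda>i t. integral {0..1} (\<lambda>s. ?X (i, s) t)
      + (mean_velocity (\<lambda>s. sgn (varied_path i t s)) - sgn (mean i t)) \<bullet> mean_velocity (var_dir i))"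
    by (rule lip_family_add) (rule lip_family_inner_bounded[OF lip_mean_sgn_defect lip_dir_mean])
  show "integral {0..1} (\<lambda>s. ?X (i, s) t)
      + (mean_velocity (\<lambda>s. sgn (varied_path i t s)) - sgn (mean i t)) \<bullet> mean_velocity (var_dir i)
    = mean_speed_deriv (varied_path i t) (var_dir i) - sgn (mean i t) \<bullet> mean_velocity (var_dir i)"
    if "i \<in> Chords" for i t
    unfolding fst_conv snd_conv
    by (intro mean_speed_deriv_defect[symmetric] chord_continuous that
        varied_path_nonzero[OF c chord_variationsD(1)[OF that]])
qed

lemma mean_speed_chord_ge: "i \<in> Chords \<Longrightarrow> c \<le> speed i t"
  by (rule mean_speed_varied_path_ge[OF c chord_variationsD(1)])

lemma lip_speed: "lip_family Chords var_step (\<lambda>_. 1) speed"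
  by (rule chord_restrict(1)[OF lip_mean_speed[OF c]])

lemma lip_powr_defect:
  "lip_family Chords var_step square_oscillation (\<lambda>i t. norm (mean i t) powr a - speed i t powr a)"
proof -
  have "lip_family Chords var_step square_oscillation (\<lambda>i t. - (speed i t - norm (mean i t)))"
    by (rule lip_family_uminus[OF lip_speed_defect])
  then have "lip_family Chords var_step square_oscillation (\<lambda>i t. norm (mean i t) - speed i t)" by simp
  then show ?thesis
    by (rule lip_family_powr_diff[OF lip_family_norm[OF lip_mean] lip_speed _ c chord_variationsD(2) mean_speed_chord_ge])
qed

lemma lip_chord_at:
  assumes "s \<in> {0..1}"
  shows "lip_family Chords var_step (\<lambda>_. 1) (\<lambda>i t. varied_path i t s)"
    and "lip_family Chords var_step (\<lambda>_. 1) (\<lambda>i t. sgn (varied_path i t s))"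
    and "lip_family Chords var_step (\<lambda>_. 1) (\<lambda>i t. var_dir i s)"
  by (rule chord_restrict(1)[OF lip_family_at[OF lip_varied_path[OF c] assms, unfolded fst_conv snd_conv]]
      chord_restrict(1)[OF lip_family_at[OF lip_sgn_varied_path[OF c] assms, unfolded fst_conv snd_conv]]
      chord_restrict(1)[OF lip_family_at[OF lip_var_dir[OF c] assms, unfolded fst_conv snd_conv]])+

lemma lip_density_deriv_oscillation:
  "lip_family Chords var_step square_oscillation
    (\<lambda>i t. chord_arc_density_deriv \<alpha> (varied_path i t) (var_dir i))"
proof (rule lip_family_cong)
  let ?speed_defect = "\<lambda>i t. mean_speed_deriv (varied_path i t) (var_dir i) - sgn (mean i t) \<bullet> mean_velocity (var_dir i)"
  let ?powr_defect = "\<lambda>a i t. norm (mean i t) powr a - speed i t powr a"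
  let ?ends = "\<lambda>i t. norm (varied_path i t 1) * norm (varied_path i t 0)"
  let ?ends_deriv = "\<lambda>i t. sgn (varied_path i t 1) \<bullet> var_dir i 1 * norm (varied_path i t 0)
    + norm (varied_path i t 1) * (sgn (varied_path i t 0) \<bullet> var_dir i 0)"
  have ends: "lip_family Chords var_step (\<lambda>_. 1) ?ends" "lip_family Chords var_step (\<lambda>_. 1) ?ends_deriv"
    by (intro lip_family_add lip_family_bounded_mult lip_family_norm lip_family_bounded_inner lip_chord_at; simp)+
  have speed_powr: "lip_family Chords var_step (\<lambda>_. 1) (\<lambda>i t. speed i t powr a)" for a
    by (rule lip_family_powr[OF lip_speed c mean_speed_chord_ge])
  show "lip_family Chords var_step square_oscillation (\<lambda>i t.
      \<alpha> * (speed i t powr (-\<alpha> - 1) * ?speed_defect i t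
        - ?powr_defect (-\<alpha> - 1) i t * (sgn (mean i t) \<bullet> mean_velocity (var_dir i))) * ?ends i t
      + ?powr_defect (-\<alpha>) i t * ?ends_deriv i t)"
    by (intro lip_family_add lip_family_mult_bounded[OF _ ends(1)] lip_family_mult_bounded[OF _ ends(2)]
        lip_family_cmult lip_family_diff lip_powr_defect
        lip_family_bounded_mult[OF speed_powr lip_speed_deriv_defect]
        lip_family_mult_bounded[OF lip_powr_defect lip_family_bounded_inner[OF lip_sgn_mean lip_dir_mean]])
qed (simp add: chord_arc_density_deriv_def algebra_simps)

lemma lip_density_oscillation:
  "lip_family Chords var_step square_oscillation (\<lambda>i t. chord_arc_density \<alpha> (varied_path i t))"
  unfolding chord_arc_density_def
  by (intro lip_family_mult_bounded[OF lip_powr_defect] lip_family_bounded_mult lip_family_norm lip_chord_at) simp_all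

end

definition square_increment :: "(real \<Rightarrow> 'a::euclidean_space) \<Rightarrow> real" where
  "square_increment p = integral {0..1} (\<lambda>s. (norm (p s - p 0))\<^sup>2)"

definition var_square_increment :: "'a::euclidean_space path_variation \<Rightarrow> real" where
  "var_square_increment i =
     square_increment (var_base i) + square_increment (var_shift i) + square_increment (var_dir i)"

lemma square_increment_nonneg:
  "continuous_on {0..1} p \<Longrightarrow> 0 \<le> square_increment p"
  unfolding square_increment_def by (intro integral_nonneg integrable_continuous_real continuous_intros) auto

lemma variance_le_square_increment:
  fixes p :: "real \<Rightarrow> 'a::euclidean_space"
  assumes p: "continuous_on {0..1} p"
  shows "integral {0..1} (\<lambda>s. (norm (p s - mean_velocity p))\<^sup>2) \<le> square_increment p"
proof -
  let ?D = "mean_velocity p" and ?d = "mean_velocity p - p 0"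
  have variance: "((\<lambda>s. (norm (p s - ?D))\<^sup>2) has_integral integral {0..1} (\<lambda>s. (norm (p s - ?D))\<^sup>2)) {0..1}"
    by (intro integrable_integral integrable_continuous_real continuous_intros p)
  have "((\<lambda>s. (norm (p s - ?D))\<^sup>2 + 2 * (p s \<bullet> ?d - ?D \<bullet> ?d) + (norm ?d)\<^sup>2) has_integral
      integral {0..1} (\<lambda>s. (norm (p s - ?D))\<^sup>2) + 2 * (?D \<bullet> ?d - ?D \<bullet> ?d) + (norm ?d)\<^sup>2) {0..1}"
    by (intro has_integral_add has_integral_diff has_integral_mult_right variance
        has_integral_mean_velocity_inner p has_integral_const_real[of _ 0 1, simplified])
  moreover have "(norm (p s - ?D))\<^sup>2 + 2 * (p s \<bullet> ?d - ?D \<bullet> ?d) + (norm ?d)\<^sup>2 = (norm (p s - p 0))\<^sup>2" for s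
    by (simp add: power2_norm_eq_inner algebra_simps inner_commute)
  ultimately have "square_increment p = integral {0..1} (\<lambda>s. (norm (p s - ?D))\<^sup>2) + (norm ?d)\<^sup>2"
    by (simp add: square_increment_def integral_unique)
  then show ?thesis by simp
qed

lemma square_oscillation_le:
  assumes "i \<in> path_variations c C"
  shows "square_oscillation i \<le> 3 * var_square_increment i"
proof -
  let ?V = "\<lambda>p s. (norm (p s - mean_velocity p))\<^sup>2"
  have variance: "(?V p has_integral integral {0..1} (?V p)) {0..1}" if "continuous_on {0..1} p" for p :: "real \<Rightarrow> 'a"
    by (intro integrable_integral integrable_continuous_real continuous_intros that)
  have square_sum: "(x + y + z)\<^sup>2 \<le> 3 * (x\<^sup>2 + y\<^sup>2 + z\<^sup>2)" for x y z :: real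
    using zero_le_power2[of "x - y"] zero_le_power2[of "y - z"] zero_le_power2[of "x - z"]
    by (simp add: power2_eq_square algebra_simps)
  note cont = path_variationsD(3-5)[OF assms]
  have "square_oscillation i \<le> 3 * (integral {0..1} (?V (var_base i))
      + integral {0..1} (?V (var_shift i)) + integral {0..1} (?V (var_dir i)))"
  proof (rule has_integral_le)
    show "((\<lambda>s. (var_oscillation i s)\<^sup>2) has_integral square_oscillation i) {0..1}"
      unfolding square_oscillation_def
      by (intro integrable_integral integrable_continuous_real continuous_intros var_oscillation_continuous[OF assms])
    show "((\<lambda>s. 3 * (?V (var_base i) s + ?V (var_shift i) s + ?V (var_dir i) s)) has_integral
      3 * (integral {0..1} (?V (var_base i)) + integral {0..1} (?V (var_shift i))
        + integral {0..1} (?V (var_dir i)))) {0..1}"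
      by (intro has_integral_mult_right has_integral_add variance cont)
    show "(var_oscillation i s)\<^sup>2 \<le> 3 * (?V (var_base i) s + ?V (var_shift i) s + ?V (var_dir i) s)" for s
      unfolding var_oscillation_def by (rule square_sum)
  qed
  then show ?thesis
    using cont[THEN variance_le_square_increment] by (simp add: var_square_increment_def)
qed

lemma square_oscillation_bigo:
  "square_oscillation \<in> O[principal (chord_variations c C :: 'a::euclidean_space path_variation set)](var_square_increment)"
proof (rule bigoI[where c=3])
  have "norm (square_oscillation i) \<le> 3 * norm (var_square_increment i)"
    if "i \<in> path_variations c C" for i :: "'a path_variation"
  proof -
    have "0 \<le> square_oscillation i"
      unfolding square_oscillation_def
      by (intro integral_nonneg integrable_continuous_real continuous_intros var_oscillation_continuous[OF that]) simp
    then show ?thesis using square_oscillation_le[OF that] by simp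
  qed
  then show "\<forall>\<^sub>F i::'a path_variation in principal (chord_variations c C).
      norm (square_oscillation i) \<le> 3 * norm (var_square_increment i)"
    by (simp add: eventually_principal chord_variations_def)
qed

lemma lip_chord_arc_density:
  "0 < c \<Longrightarrow> lip_family (chord_variations c C) var_step var_square_increment
    (\<lambda>i t. chord_arc_density \<alpha> (varied_path i t))"
  by (rule lip_family_mono[OF lip_density_oscillation square_oscillation_bigo])

lemma lip_chord_arc_density_deriv:
  "0 < c \<Longrightarrow> lip_family (chord_variations c C) var_step var_square_increment
    (\<lambda>i t. chord_arc_density_deriv \<alpha> (varied_path i t) (var_dir i))"
  by (rule lip_family_mono[OF lip_density_deriv_oscillation square_oscillation_bigo])

section \<open>Periodic functions and weak derivatives\<close>

lemma periodic1_of_int: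
  assumes "periodic1 f"
  shows "f (x + of_int n) = f x"
proof -
  have of_nat: "f (x + real m) = f x" for x and m :: nat
  proof (induction m)
    case (Suc m)
    have "f (x + real (Suc m)) = f ((x + real m) + 1)" by (simp add: algebra_simps)
    then show ?case using Suc assms by (simp add: periodic1_def)
  qed simp
  show ?thesis
  proof (cases "0 \<le> n")
    case True
    then show ?thesis using of_nat[of x "nat n"] by simp
  next
    case False
    then show ?thesis using of_nat[of "x + of_int n" "nat (- n)"] by simp
  qed
qed

lemma has_integral_set_lebesgue_lborel:
  fixes f :: "real \<Rightarrow> 'a::euclidean_space"
  assumes "continuous_on {a..b} f"
  shows "(f has_integral set_lebesgue_integral lborel {a..b} f) {a..b}"
  using set_borel_integral_eq_integral(2)[OF borel_integrable_atLeastAtMost'[OF assms]]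
    integrable_integral[OF integrable_continuous_real[OF assms]] by simp

lemma nn_integral_Ico_eq_Icc:
  fixes F :: "real \<Rightarrow> ennreal"
  shows "(\<integral>\<^sup>+x\<in>{a..<b}. F x \<partial>lborel) = (\<integral>\<^sup>+x\<in>{a..b}. F x \<partial>lborel)"
proof (rule nn_integral_cong_AE)
  have "AE x in lborel. x \<noteq> b" by (rule AE_lborel_singleton)
  then show "AE x in lborel. F x * indicator {a..<b} x = F x * indicator {a..b} x"
    by eventually_elim (auto simp: indicator_def)
qed

lemma nn_integral_periodic:
  fixes F :: "real \<Rightarrow> ennreal"
  assumes F[measurable]: "F \<in> borel_measurable borel" and per: "periodic1 F"
  shows "(\<integral>\<^sup>+x\<in>{a..a + 1}. F x \<partial>lborel) = (\<integral>\<^sup>+x\<in>{0..1}. F x \<partial>lborel)"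
proof -
  define n where "n = \<lfloor>a\<rfloor>"
  define t where "t = a - n"
  have t: "0 \<le> t" "t < 1" "a = n + t" unfolding t_def n_def by linarith+
  have translate: "(\<integral>\<^sup>+x\<in>{of_int m + b..<of_int m + c}. F x \<partial>lborel) = (\<integral>\<^sup>+x\<in>{b..<c}. F x \<partial>lborel)" for m b c
  proof -
    have "(\<integral>\<^sup>+x\<in>{of_int m + b..<of_int m + c}. F x \<partial>lborel)
       = (\<integral>\<^sup>+x. F (of_int m + 1 * x) * indicator {of_int m + b..<of_int m + c} (of_int m + 1 * x) \<partial>lborel)"
      by (subst nn_integral_real_affine[where c=1 and t="of_int m"]) auto
    also have "\<dots> = (\<integral>\<^sup>+x\<in>{b..<c}. F x \<partial>lborel)"
      using periodic1_of_int[OF per] by (intro nn_integral_cong) (auto simp: indicator_def add.commute)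
    finally show ?thesis .
  qed
  have split: "(\<integral>\<^sup>+x\<in>{b..<d}. F x \<partial>lborel) = (\<integral>\<^sup>+x\<in>{b..<c}. F x \<partial>lborel) + (\<integral>\<^sup>+x\<in>{c..<d}. F x \<partial>lborel)"
    if "b \<le> c" "c \<le> d" for b c d
    using that by (subst nn_integral_add[symmetric]) (auto intro!: nn_integral_cong simp: indicator_def)
  have "(\<integral>\<^sup>+x\<in>{a..<a + 1}. F x \<partial>lborel) = (\<integral>\<^sup>+x\<in>{t..<t + 1}. F x \<partial>lborel)"
    using translate[of n t "t + 1"] t(3) by (simp add: add.assoc)
  also have "\<dots> = (\<integral>\<^sup>+x\<in>{t..<1}. F x \<partial>lborel) + (\<integral>\<^sup>+x\<in>{0..<t}. F x \<partial>lborel)"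
    using t split[of t 1 "t + 1"] translate[of 1 0 t] by (simp add: add.commute)
  also have "\<dots> = (\<integral>\<^sup>+x\<in>{0..<1}. F x \<partial>lborel)"
    using t split[of 0 t 1] by (simp add: add.commute)
  finally show ?thesis by (simp add: nn_integral_Ico_eq_Icc)
qed

lemma periodic1_derivative:
  assumes "periodic1 f" "\<And>x. (f has_vector_derivative g x) (at x)"
  shows "periodic1 g"
  unfolding periodic1_def
proof
  fix x
  have "((\<lambda>y. y + 1) has_vector_derivative 1) (at x)" by (auto intro!: derivative_eq_intros)
  from vector_diff_chain_at[OF this assms(2)]
  have "(f has_vector_derivative g (x + 1)) (at x)"
    using assms(1) by (simp add: o_def periodic1_def)
  then show "g (x + 1) = g x" using assms(2) vector_derivative_unique_at by blast
qed

lemma AE_zero_if_atMost_integrals_zero: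
  fixes d :: "real \<Rightarrow> 'a::{second_countable_topology, banach}"
  assumes d: "integrable lborel d" and atMost: "\<And>a. set_lebesgue_integral lborel {..a} d = 0"
  shows "AE x in lborel. d x = 0"
proof (rule sigma_finite_measure.density_zero[OF lborel.sigma_finite_measure_axioms d])
  have "((\<lambda>a. set_lebesgue_integral lborel {..a} d) \<longlongrightarrow> integral\<^sup>L lborel d) at_top"
    unfolding set_lebesgue_integral_def by (rule tendsto_integral_at_top) (use d in auto)
  then have total: "integral\<^sup>L lborel d = 0"
    unfolding atMost by (rule tendsto_unique[OF trivial_limit_at_top_linorder tendsto_const, symmetric])
  have generator: "Int_stable (range (\<lambda>a::real. {..a}))" "range (\<lambda>a::real. {..a}) \<subseteq> Pow UNIV"
    by (auto simp: Int_stable_def)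
  fix A :: "real set" assume "A \<in> sets lborel"
  then have "A \<in> sigma_sets UNIV (range (\<lambda>a::real. {..a}))" by (simp add: borel_eq_atMost)
  with generator show "set_lebesgue_integral lborel A d = 0"
  proof (induction rule: sigma_sets_induct_disjoint)
    case (basic A)
    then show ?case using atMost by auto
  next
    case empty
    then show ?case by (simp add: set_lebesgue_integral_def)
  next
    case (compl A)
    then have A: "A \<in> sets lborel" by (simp add: borel_eq_atMost)
    have "set_lebesgue_integral lborel (UNIV - A) d = integral\<^sup>L lborel (\<lambda>x. d x - indicator A x *\<^sub>R d x)"
      unfolding set_lebesgue_integral_def by (intro Bochner_Integration.integral_cong) (auto simp: indicator_def)
    also have "\<dots> = integral\<^sup>L lborel d - set_lebesgue_integral lborel A d"
      unfolding set_lebesgue_integral_def using A d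
      by (intro Bochner_Integration.integral_diff integrable_mult_indicator) auto
    finally show ?case using compl total by simp
  next
    case (union A)
    then have A: "\<And>i. A i \<in> sets lborel" by (auto simp: borel_eq_atMost)
    have "set_lebesgue_integral lborel (\<Union>i. A i) d = (\<Sum>i. set_lebesgue_integral lborel (A i) d)"
      using union(1) A d
      by (intro lebesgue_integral_countable_add)
         (auto simp: disjoint_family_on_def set_integrable_def intro!: integrable_mult_indicator)
    then show ?case using union by simp
  qed
qed

lemma AE_eq_if_interval_integrals_eq:
  fixes g g' :: "real \<Rightarrow> 'a::{second_countable_topology, banach}"
  assumes int: "\<And>a b. set_integrable lborel {a..b} g" "\<And>a b. set_integrable lborel {a..b} g'"
    and eq: "\<And>a b. a \<le> b \<Longrightarrow> set_lebesgue_integral lborel {a..b} g = set_lebesgue_integral lborel {a..b} g'"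
  shows "AE x in lborel. g x = g' x"
proof -
  have "AE x in lborel. x \<in> {-real n..real n} \<longrightarrow> g x = g' x" for n
  proof -
    let ?d = "\<lambda>x. indicator {-real n..real n} x *\<^sub>R (g x - g' x)"
    have "AE x in lborel. ?d x = 0"
    proof (rule AE_zero_if_atMost_integrals_zero)
      show "integrable lborel ?d"
        using set_integral_diff(1)[OF int] unfolding set_integrable_def .
      fix a
      have "set_lebesgue_integral lborel {..a} ?d
          = set_lebesgue_integral lborel {-real n..min a (real n)} (\<lambda>x. g x - g' x)"
        unfolding set_lebesgue_integral_def by (intro Bochner_Integration.integral_cong) (auto simp: indicator_def)
      also have "\<dots> = 0"
        using eq[of "-real n" "min a (real n)"] int
        by (cases "-real n \<le> min a (real n)") (auto simp: set_integral_diff set_lebesgue_integral_def[of _ "{}"])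
      finally show "set_lebesgue_integral lborel {..a} ?d = 0" .
    qed
    then show ?thesis by eventually_elim (auto simp: indicator_def)
  qed
  then have "AE x in lborel. \<forall>n::nat. x \<in> {-real n..real n} \<longrightarrow> g x = g' x"
    unfolding AE_all_countable by blast
  then show ?thesis
  proof eventually_elim
    case (elim x)
    obtain n :: nat where "\<bar>x\<bar> \<le> real n" using real_arch_simple by blast
    then show ?case using elim by (auto simp: abs_le_iff)
  qed
qed

lemma weak_deriv_set_integrable:
  assumes "weak_deriv f g"
  shows "set_integrable lborel {a..b} g"
  using assms unfolding weak_deriv_def by (cases "a \<le> b") (auto simp: set_integrable_def)

lemma weak_deriv_integral:
  "weak_deriv f g \<Longrightarrow> a \<le> b \<Longrightarrow> set_lebesgue_integral lborel {a..b} g = f b - f a"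
  by (simp add: weak_deriv_def)

lemma weak_deriv_if_continuous_derivative:
  fixes f :: "real \<Rightarrow> real^'n"
  assumes f: "periodic1 f" "\<And>x. (f has_vector_derivative g x) (at x)" and g: "continuous_on UNIV g"
  shows "weak_deriv f g"
  unfolding weak_deriv_def
proof (intro conjI allI impI)
  show "periodic1 g" by (rule periodic1_derivative[OF f])
  show "g \<in> borel_measurable lborel" using borel_measurable_continuous_onI[OF g] by simp
  show int: "set_integrable lborel {a..b} g" for a b
    by (rule borel_integrable_atLeastAtMost'[OF continuous_on_subset[OF g]]) auto
  show "f b - f a = set_lebesgue_integral lborel {a..b} g" if "a \<le> b" for a b
  proof -
    have "(g has_integral f b - f a) {a..b}"
      by (rule fundamental_theorem_of_calculus[OF that]) (rule has_vector_derivative_at_within[OF f(2)])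
    then show ?thesis using set_borel_integral_eq_integral(2)[OF int] by (simp add: integral_unique)
  qed
  have "((\<lambda>x. (norm (g x))\<^sup>2) has_integral integral {0..1} (\<lambda>x. (norm (g x))\<^sup>2)) {0..1}"
    by (intro integrable_integral integrable_continuous_real continuous_intros continuous_on_subset[OF g]) auto
  from nn_integral_has_integral_lebesgue'[OF _ this]
  show "(\<integral>\<^sup>+x\<in>{0..1}. ennreal ((norm (g x))\<^sup>2) \<partial>lborel) < \<infinity>" by simp
qed

lemma weak_deriv_unique_AE:
  fixes f :: "real \<Rightarrow> real^'n"
  assumes "weak_deriv f g" "weak_deriv f g'"
  shows "AE x in lborel. g x = g' x"
proof (rule AE_eq_if_interval_integrals_eq[OF assms[THEN weak_deriv_set_integrable]])
  show "set_lebesgue_integral lborel {a..b} g = set_lebesgue_integral lborel {a..b} g'" if "a \<le> b" for a b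
    using assms[THEN weak_deriv_integral, OF that] by simp
qed

lemma weak_deriv_continuous:
  fixes f :: "real \<Rightarrow> real^'n"
  assumes "weak_deriv f g"
  shows "continuous_on UNIV f"
proof (rule continuous_at_imp_continuous_on, rule ballI)
  fix x
  note int = weak_deriv_set_integrable[OF assms]
  have "f (x - 1) + integral {x-1..y} g = f y" if "y \<in> {x-1..x+1}" for y
    using weak_deriv_integral[OF assms, of "x - 1" y] that
      set_borel_integral_eq_integral(2)[OF int, of "x - 1" y] by simp
  moreover have "continuous_on {x-1..x+1} (\<lambda>y. f (x - 1) + integral {x-1..y} g)"
    by (intro continuous_intros indefinite_integral_continuous_1 set_borel_integral_eq_integral(1)[OF int])
  ultimately have "continuous_on {x-1..x+1} f" by (rule continuous_on_eq[rotated])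
  then show "isCont f x" by (rule continuous_on_interior) simp
qed

lemma AE_translate:
  fixes P :: "real \<Rightarrow> bool"
  assumes "AE x in lborel. P x"
  shows "AE x in lborel. P (c + x)"
proof -
  obtain N where N: "N \<in> null_sets lborel" "{x. \<not> P x} \<subseteq> N"
    using assms by (auto elim!: AE_E simp: null_sets_def)
  have "AE x in lborel. c + 1 * x \<notin> N"
    by (rule AE_borel_affine[where P="\<lambda>x. x \<notin> N" and c=1, OF _ _ AE_not_in[OF N(1)]]) (use N(1) in auto)
  then show ?thesis by eventually_elim (use N(2) in auto)
qed

lemma gagliardo_cong_AE:
  fixes g g' :: "real \<Rightarrow> real^'n"
  assumes eq: "AE x in lborel. g x = g' x"
  shows "gagliardo \<sigma> g = gagliardo \<sigma> g'"
  unfolding gagliardo_def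
proof (rule nn_integral_cong_AE)
  let ?I = "\<lambda>g u. \<integral>\<^sup>+w\<in>{-1/2..1/2}. ennreal ((norm (g (u + w) - g u))\<^sup>2 / \<bar>w\<bar> powr (1 + 2 * \<sigma>)) \<partial>lborel"
  show "AE u in lborel. ?I g u * indicator {0..1} u = ?I g' u * indicator {0..1} u"
    using eq
  proof eventually_elim
    case (elim u)
    have "?I g u = ?I g' u"
      using AE_translate[OF eq, of u] by (intro nn_integral_cong_AE, eventually_elim) (simp add: elim)
    then show ?case by simp
  qed
qed

section \<open>The Sobolev embedding\<close>

lemma weighted_am_gm:
  fixes a l :: real
  assumes "0 < l"
  shows "a \<le> l / 2 + 1 / (2 * l) * a\<^sup>2"
proof -
  have "0 \<le> (a - l)\<^sup>2 / (2 * l)" using assms by simp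
  also have "\<dots> = l / 2 + 1 / (2 * l) * a\<^sup>2 - a" using assms by (simp add: field_simps power2_eq_square)
  finally show ?thesis by simp
qed

lemma set_nn_integral_cauchy_schwarz:
  fixes f :: "'a \<Rightarrow> real"
  assumes f[measurable]: "f \<in> borel_measurable M" and f_nonneg: "\<And>x. 0 \<le> f x"
    and A[measurable]: "A \<in> sets M" "emeasure M A = ennreal a" and a: "0 < a" and b: "0 \<le> b"
    and square: "(\<integral>\<^sup>+x\<in>A. ennreal ((f x)\<^sup>2) \<partial>M) \<le> ennreal b"
  shows "(\<integral>\<^sup>+x\<in>A. ennreal (f x) \<partial>M) \<le> ennreal (sqrt (a * b))"
proof (cases "b = 0")
  case True
  then have "(\<integral>\<^sup>+x\<in>A. ennreal ((f x)\<^sup>2) \<partial>M) = 0" using square by simp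
  then have "AE x in M. ennreal ((f x)\<^sup>2) * indicator A x = 0"
    by (subst (asm) nn_integral_0_iff_AE) auto
  then have "AE x in M. ennreal (f x) * indicator A x = 0"
    by eventually_elim (use f_nonneg in \<open>auto simp: indicator_def split: if_splits\<close>)
  then have "(\<integral>\<^sup>+x\<in>A. ennreal (f x) \<partial>M) = 0" by (subst nn_integral_0_iff_AE) auto
  then show ?thesis by simp
next
  case False
  define l where "l = sqrt (b / a)"
  have l: "0 < l" using a b False by (simp add: l_def)
  have "ennreal (f x) * indicator A x
      \<le> ennreal (l / 2) * indicator A x + ennreal (1 / (2 * l)) * (ennreal ((f x)\<^sup>2) * indicator A x)" for x
    using weighted_am_gm[OF l, of "f x"] l
    by (auto simp: indicator_def ennreal_mult[symmetric] ennreal_plus[symmetric] ennreal_leI simp del: ennreal_plus)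
  then have "(\<integral>\<^sup>+x\<in>A. ennreal (f x) \<partial>M)
      \<le> (\<integral>\<^sup>+x. ennreal (l / 2) * indicator A x + ennreal (1 / (2 * l)) * (ennreal ((f x)\<^sup>2) * indicator A x) \<partial>M)"
    by (intro nn_integral_mono)
  also have "\<dots> = ennreal (l / 2) * ennreal a + ennreal (1 / (2 * l)) * (\<integral>\<^sup>+x\<in>A. ennreal ((f x)\<^sup>2) \<partial>M)"
    by (simp add: nn_integral_add nn_integral_cmult A(2))
  also have "\<dots> \<le> ennreal (l / 2) * ennreal a + ennreal (1 / (2 * l)) * ennreal b"
    using square by (intro add_left_mono mult_left_mono) auto
  also have "\<dots> = ennreal (l / 2 * a + 1 / (2 * l) * b)"
    using l a b by (simp add: ennreal_mult[symmetric] ennreal_plus[symmetric] del: ennreal_plus)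
  also have "l / 2 * a + 1 / (2 * l) * b = sqrt (a * b)"
    using a b False by (simp add: l_def real_sqrt_divide real_sqrt_mult field_simps)
  finally show ?thesis .
qed

lemma norm_set_integral_le_nn_integral:
  fixes g :: "'a \<Rightarrow> 'b::{second_countable_topology, banach}"
  assumes "set_integrable M A g"
  shows "ennreal (norm (set_lebesgue_integral M A g)) \<le> (\<integral>\<^sup>+x\<in>A. ennreal (norm (g x)) \<partial>M)"
proof -
  have "ennreal (norm (set_lebesgue_integral M A g)) \<le> (\<integral>\<^sup>+x. norm (indicator A x *\<^sub>R g x) \<partial>M)"
    using assms unfolding set_lebesgue_integral_def set_integrable_def by (rule integral_norm_bound_ennreal)
  also have "\<dots> = (\<integral>\<^sup>+x\<in>A. ennreal (norm (g x)) \<partial>M)"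
    by (intro nn_integral_cong) (auto simp: indicator_def)
  finally show ?thesis .
qed

lemma norm_diff_of_integrals_le:
  fixes g :: "'a \<Rightarrow> 'b::{second_countable_topology, banach}"
  assumes [measurable]: "A \<in> sets M" "B \<in> sets M"
    and finite: "emeasure M A < \<infinity>" "emeasure M B < \<infinity>"
    and g: "set_integrable M A g" "set_integrable M B g"
  shows "ennreal (norm (measure M B *\<^sub>R set_lebesgue_integral M A g - measure M A *\<^sub>R set_lebesgue_integral M B g))
    \<le> (\<integral>\<^sup>+x\<in>A. (\<integral>\<^sup>+y\<in>B. ennreal (norm (g y - g x)) \<partial>M) \<partial>M)"
proof -
  let ?G = "set_lebesgue_integral M B g"
  have const: "set_integrable M A (\<lambda>_. v)" "set_integrable M B (\<lambda>_. v)" for v :: 'b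
    using finite by (simp_all add: set_integrable_def)
  have const_integral: "set_lebesgue_integral M A (\<lambda>_. v) = measure M A *\<^sub>R v"
    "set_lebesgue_integral M B (\<lambda>_. v) = measure M B *\<^sub>R v" for v :: 'b
    using finite by (simp_all add: set_lebesgue_integral_def)
  have inner: "ennreal (norm (measure M B *\<^sub>R g x - ?G)) \<le> (\<integral>\<^sup>+y\<in>B. ennreal (norm (g y - g x)) \<partial>M)" for x
    using norm_set_integral_le_nn_integral[OF set_integral_diff(1)[OF g(2) const(2)[of "g x"]]]
    by (simp add: set_integral_diff(2)[OF g(2) const(2)] const_integral norm_minus_commute)
  have scaled: "set_integrable M A (\<lambda>x. measure M B *\<^sub>R g x)"
    using g(1) by (intro set_integrable_scaleR_right) auto
  have "ennreal (norm (measure M B *\<^sub>R set_lebesgue_integral M A g - measure M A *\<^sub>R ?G))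
      = ennreal (norm (set_lebesgue_integral M A (\<lambda>x. measure M B *\<^sub>R g x - ?G)))"
    by (simp add: set_integral_diff(2)[OF scaled const(1)] const_integral)
  also have "\<dots> \<le> (\<integral>\<^sup>+x\<in>A. ennreal (norm (measure M B *\<^sub>R g x - ?G)) \<partial>M)"
    by (rule norm_set_integral_le_nn_integral[OF set_integral_diff(1)[OF scaled const(1)]])
  also have "\<dots> \<le> (\<integral>\<^sup>+x\<in>A. (\<integral>\<^sup>+y\<in>B. ennreal (norm (g y - g x)) \<partial>M) \<partial>M)"
    using inner by (intro nn_integral_mono mult_right_mono) auto
  finally show ?thesis .
qed

lemma square_difference_le_kernel:
  fixes g :: "real \<Rightarrow> 'a::real_normed_vector"
  assumes "0 < a" "\<bar>s - t\<bar> \<le> r"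
  shows "(norm (g s - g t))\<^sup>2 \<le> r powr a * ((norm (g s - g t))\<^sup>2 / \<bar>s - t\<bar> powr a)"
proof (cases "s = t")
  case False
  then have "1 \<le> r powr a / \<bar>s - t\<bar> powr a" using assms by (simp add: powr_mono2)
  from mult_right_mono[OF this, of "(norm (g s - g t))\<^sup>2"] show ?thesis by simp
qed simp

lemma nn_integral_square_difference_le_gagliardo:
  fixes g :: "real \<Rightarrow> real^'n"
  assumes g[measurable]: "g \<in> borel_measurable borel" and per: "periodic1 g"
    and \<sigma>: "0 < 1 + 2 * \<sigma>" and r: "0 < r" "r \<le> 1/2"
  shows "(\<integral>\<^sup>+t\<in>{x..x + r}. (\<integral>\<^sup>+s\<in>{x..x + r}. ennreal ((norm (g s - g t))\<^sup>2) \<partial>lborel) \<partial>lborel)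
    \<le> ennreal (r powr (1 + 2 * \<sigma>)) * gagliardo \<sigma> g"
proof -
  let ?J = "{x..x + r}" and ?a = "1 + 2 * \<sigma>"
  let ?G = "\<lambda>t w. ennreal ((norm (g (t + w) - g t))\<^sup>2 / \<bar>w\<bar> powr ?a)"
  have inner: "(\<integral>\<^sup>+s\<in>?J. ennreal ((norm (g s - g t))\<^sup>2) \<partial>lborel)
      \<le> ennreal (r powr ?a) * (\<integral>\<^sup>+w\<in>{-1/2..1/2}. ?G t w \<partial>lborel)" if t: "t \<in> ?J" for t
  proof -
    have "(\<integral>\<^sup>+s\<in>?J. ennreal ((norm (g s - g t))\<^sup>2) \<partial>lborel)
        = (\<integral>\<^sup>+w. ennreal ((norm (g (t + 1 * w) - g t))\<^sup>2) * indicator ?J (t + 1 * w) \<partial>lborel)"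
      by (subst nn_integral_real_affine[where c=1 and t=t]) auto
    also have "\<dots> \<le> (\<integral>\<^sup>+w. ennreal (r powr ?a) * (?G t w * indicator {-1/2..1/2} w) \<partial>lborel)"
    proof (rule nn_integral_mono)
      fix w
      have "(norm (g (t + w) - g t))\<^sup>2 \<le> r powr ?a * ((norm (g (t + w) - g t))\<^sup>2 / \<bar>w\<bar> powr ?a)" if "t + w \<in> ?J"
        using square_difference_le_kernel[OF \<sigma>, of "t + w" t r g] t that by auto
      moreover have "\<bar>w\<bar> \<le> 1/2" if "t + w \<in> ?J" using t that r by auto
      ultimately show "ennreal ((norm (g (t + 1 * w) - g t))\<^sup>2) * indicator ?J (t + 1 * w)
          \<le> ennreal (r powr ?a) * (?G t w * indicator {-1/2..1/2} w)"
        by (auto simp: indicator_def ennreal_mult[symmetric] abs_le_iff intro!: ennreal_leI)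
    qed
    also have "\<dots> = ennreal (r powr ?a) * (\<integral>\<^sup>+w\<in>{-1/2..1/2}. ?G t w \<partial>lborel)"
      by (rule nn_integral_cmult) measurable
    finally show ?thesis .
  qed
  have "(\<integral>\<^sup>+t\<in>?J. (\<integral>\<^sup>+s\<in>?J. ennreal ((norm (g s - g t))\<^sup>2) \<partial>lborel) \<partial>lborel)
      \<le> (\<integral>\<^sup>+t. ennreal (r powr ?a) * ((\<integral>\<^sup>+w\<in>{-1/2..1/2}. ?G t w \<partial>lborel) * indicator {x..x + 1} t) \<partial>lborel)"
    using inner r by (intro nn_integral_mono) (auto simp: indicator_def)
  also have "\<dots> = ennreal (r powr ?a) * (\<integral>\<^sup>+t\<in>{x..x + 1}. (\<integral>\<^sup>+w\<in>{-1/2..1/2}. ?G t w \<partial>lborel) \<partial>lborel)"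
    by (rule nn_integral_cmult) measurable
  also have "(\<integral>\<^sup>+t\<in>{x..x + 1}. (\<integral>\<^sup>+w\<in>{-1/2..1/2}. ?G t w \<partial>lborel) \<partial>lborel) = gagliardo \<sigma> g"
    unfolding gagliardo_def
  proof (rule nn_integral_periodic)
    have "g (t + 1 + w) = g (t + w)" for t w
      using per periodic1_of_int[OF per, of "t + w" 1] by (simp add: add_ac)
    then show "periodic1 (\<lambda>t. \<integral>\<^sup>+w\<in>{-1/2..1/2}. ?G t w \<partial>lborel)"
      using per by (simp add: periodic1_def)
  qed measurable
  finally show ?thesis .
qed

lemma half_integrals_difference:
  fixes g :: "real \<Rightarrow> real^'n"
  assumes g[measurable]: "g \<in> borel_measurable borel" and per: "periodic1 g"
    and int: "\<And>a b. set_integrable lborel {a..b} g"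
    and \<sigma>: "0 < 1 + 2 * \<sigma>" and gag: "gagliardo \<sigma> g \<le> ennreal (\<kappa>\<^sup>2)" and \<kappa>: "0 \<le> \<kappa>" and r: "0 < r" "r \<le> 1/2"
  shows "norm (set_lebesgue_integral lborel {x..x + r / 2} g - set_lebesgue_integral lborel {x + r / 2..x + r} g)
    \<le> \<kappa> * r powr (1/2 + \<sigma>)"
proof -
  let ?A = "{x..x + r / 2}" and ?B = "{x + r / 2..x + r}" and ?d = "r / 2" and ?J = "{x..x + r}"
  let ?F = "\<lambda>z::real \<times> real. norm (g (snd z) - g (fst z))"
  have iterated: "(\<integral>\<^sup>+z\<in>?A \<times> ?B. F z \<partial>(lborel \<Otimes>\<^sub>M lborel)) = (\<integral>\<^sup>+t\<in>?A. (\<integral>\<^sup>+s\<in>?B. F (t, s) \<partial>lborel) \<partial>lborel)"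
    if [measurable]: "F \<in> borel_measurable (lborel \<Otimes>\<^sub>M lborel)" for F :: "real \<times> real \<Rightarrow> ennreal"
    by (subst lborel.nn_integral_fst[symmetric]) (auto intro!: nn_integral_cong simp: indicator_def)
  have "(\<integral>\<^sup>+z\<in>?A \<times> ?B. ennreal ((?F z)\<^sup>2) \<partial>(lborel \<Otimes>\<^sub>M lborel))
      = (\<integral>\<^sup>+t\<in>?A. (\<integral>\<^sup>+s\<in>?B. ennreal ((norm (g s - g t))\<^sup>2) \<partial>lborel) \<partial>lborel)"
    by (subst iterated) simp_all
  also have "\<dots> \<le> (\<integral>\<^sup>+t\<in>?J. (\<integral>\<^sup>+s\<in>?J. ennreal ((norm (g s - g t))\<^sup>2) \<partial>lborel) \<partial>lborel)"
    using r by (intro nn_integral_mono mult_mono) (auto simp: indicator_def)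
  also have "\<dots> \<le> ennreal (r powr (1 + 2 * \<sigma>)) * gagliardo \<sigma> g"
    by (rule nn_integral_square_difference_le_gagliardo[OF g per \<sigma> r])
  also have "\<dots> \<le> ennreal (r powr (1 + 2 * \<sigma>)) * ennreal (\<kappa>\<^sup>2)" by (rule mult_left_mono[OF gag]) simp
  also have "\<dots> = ennreal (r powr (1 + 2 * \<sigma>) * \<kappa>\<^sup>2)" by (simp add: ennreal_mult)
  finally have square: "(\<integral>\<^sup>+z\<in>?A \<times> ?B. ennreal ((?F z)\<^sup>2) \<partial>(lborel \<Otimes>\<^sub>M lborel)) \<le> ennreal (r powr (1 + 2 * \<sigma>) * \<kappa>\<^sup>2)" .
  have area: "emeasure (lborel \<Otimes>\<^sub>M lborel) (?A \<times> ?B) = ennreal (?d\<^sup>2)"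
    using r by (simp add: lborel.emeasure_pair_measure_Times power2_eq_square ennreal_mult[symmetric])
  have "ennreal (?d * norm (set_lebesgue_integral lborel ?A g - set_lebesgue_integral lborel ?B g))
      = ennreal (norm (measure lborel ?B *\<^sub>R set_lebesgue_integral lborel ?A g
          - measure lborel ?A *\<^sub>R set_lebesgue_integral lborel ?B g))"
    using r by (simp add: scaleR_diff_right[symmetric] del: scaleR_diff_right)
  also have "\<dots> \<le> (\<integral>\<^sup>+t\<in>?A. (\<integral>\<^sup>+s\<in>?B. ennreal (norm (g s - g t)) \<partial>lborel) \<partial>lborel)"
    by (rule norm_diff_of_integrals_le) (use int in \<open>auto simp: emeasure_lborel_Icc_eq\<close>)
  also have "\<dots> = (\<integral>\<^sup>+z\<in>?A \<times> ?B. ennreal (?F z) \<partial>(lborel \<Otimes>\<^sub>M lborel))"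
    by (subst iterated) simp_all
  also have "\<dots> \<le> ennreal (sqrt (?d\<^sup>2 * (r powr (1 + 2 * \<sigma>) * \<kappa>\<^sup>2)))"
    by (rule set_nn_integral_cauchy_schwarz[OF _ _ _ area _ _ square]) (use r in simp_all)
  also have "sqrt (?d\<^sup>2 * (r powr (1 + 2 * \<sigma>) * \<kappa>\<^sup>2)) = ?d * (\<kappa> * r powr (1/2 + \<sigma>))"
  proof -
    have "r powr (1 + 2 * \<sigma>) = (r powr (1/2 + \<sigma>))\<^sup>2"
      by (simp add: power2_eq_square powr_add[symmetric])
    then show ?thesis using r \<kappa> by (simp add: real_sqrt_mult)
  qed
  finally show ?thesis using r \<kappa> by (simp add: ennreal_le_iff)
qed

lemma norm_increment_le_L2:
  fixes f :: "real \<Rightarrow> real^'n"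
  assumes w: "weak_deriv f g" and \<kappa>: "0 \<le> \<kappa>"
    and L2: "(\<integral>\<^sup>+x\<in>{0..1}. ennreal ((norm (g x))\<^sup>2) \<partial>lborel) \<le> ennreal (\<kappa>\<^sup>2)"
    and y: "x \<le> y" "y \<le> x + 1"
  shows "norm (f y - f x) \<le> \<kappa>"
proof -
  have g[measurable]: "g \<in> borel_measurable borel" and per: "periodic1 g"
    using w by (simp_all add: weak_deriv_def)
  have "(\<integral>\<^sup>+t\<in>{x..x + 1}. ennreal ((norm (g t))\<^sup>2) \<partial>lborel) \<le> ennreal (\<kappa>\<^sup>2)"
    using L2 per by (subst nn_integral_periodic) (auto simp: periodic1_def)
  then have bound: "(\<integral>\<^sup>+t\<in>{x..x + 1}. ennreal (norm (g t)) \<partial>lborel) \<le> ennreal (sqrt (1 * \<kappa>\<^sup>2))"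
    by (intro set_nn_integral_cauchy_schwarz) auto
  have increment: "ennreal (norm (f y - f x)) \<le> (\<integral>\<^sup>+t\<in>{x..x + 1}. ennreal (norm (g t)) \<partial>lborel)"
  proof -
    have "ennreal (norm (f y - f x)) \<le> (\<integral>\<^sup>+t\<in>{x..y}. ennreal (norm (g t)) \<partial>lborel)"
      using norm_set_integral_le_nn_integral[OF weak_deriv_set_integrable[OF w], of x y]
      by (simp add: weak_deriv_integral[OF w y(1)])
    also have "\<dots> \<le> (\<integral>\<^sup>+t\<in>{x..x + 1}. ennreal (norm (g t)) \<partial>lborel)"
      using y by (intro nn_integral_mono) (auto simp: indicator_def)
    finally show ?thesis .
  qed
  from order_trans[OF increment bound] show ?thesis using \<kappa> by simp
qed

lemma uniform_limit_if_geometric_increments: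
  fixes G :: "nat \<Rightarrow> 'a \<Rightarrow> 'b::banach"
  assumes increment: "\<And>n x. norm (G (Suc n) x - G n x) \<le> K * q ^ n" and q: "0 \<le> q" "q < 1"
  obtains g where "uniform_limit UNIV G g sequentially" "\<And>x. norm (g x) \<le> norm (G 0 x) + K / (1 - q)"
proof
  let ?T = "\<lambda>i x. G (Suc i) x - G i x"
  have summable: "summable (\<lambda>n. K * q ^ n)" using q by (intro summable_mult summable_geometric) auto
  have "uniform_limit UNIV (\<lambda>n x. G 0 x + (\<Sum>i<n. ?T i x)) (\<lambda>x. G 0 x + (\<Sum>i. ?T i x)) sequentially"
    by (intro uniform_limit_intros Weierstrass_m_test[OF increment summable])
  moreover have telescope: "G 0 x + (\<Sum>i<n. ?T i x) = G n x" for n x by (induction n) (auto simp: algebra_simps)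
  ultimately show "uniform_limit UNIV G (\<lambda>x. G 0 x + (\<Sum>i. ?T i x)) sequentially"
    by (simp only: telescope)
  fix x
  have "norm (\<Sum>i. ?T i x) \<le> (\<Sum>i. K * q ^ i)"
    by (rule norm_suminf_le[OF increment summable])
  also have "\<dots> = K / (1 - q)" using q by (simp add: suminf_mult suminf_geometric summable_geometric)
  finally show "norm (G 0 x + (\<Sum>i. ?T i x)) \<le> norm (G 0 x) + K / (1 - q)"
    by (metis add_left_mono norm_triangle_mono order_refl)
qed

lemma continuous_antiderivative:
  fixes f :: "real \<Rightarrow> 'a::euclidean_space"
  assumes "continuous_on UNIV f"
  obtains F where "\<And>x. (F has_vector_derivative f x) (at x)"
proof -
  have "isCont f x" for x using assms by (simp add: continuous_on_eq_continuous_at)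
  then have "\<exists>F. \<forall>x::real. - \<infinity> < ereal x \<longrightarrow> ereal x < \<infinity> \<longrightarrow> (F has_vector_derivative f x) (at x)"
    by (intro einterval_antiderivative) auto
  then show thesis using that by auto
qed

definition dyadic_quotient :: "(real \<Rightarrow> 'a::real_vector) \<Rightarrow> nat \<Rightarrow> real \<Rightarrow> 'a" where
  "dyadic_quotient f n x = 2 ^ n *\<^sub>R (f (x + 1 / 2 ^ n) - f x)"

lemma continuous_on_dyadic_quotient:
  fixes f :: "real \<Rightarrow> 'a::real_normed_vector"
  assumes f: "continuous_on UNIV f"
  shows "continuous_on S (dyadic_quotient f n)"
proof -
  have "continuous_on S f" "continuous_on S (\<lambda>x. f (x + 1 / 2 ^ n))"
    by (rule continuous_on_compose2[OF f]; auto intro!: continuous_intros)+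
  then show ?thesis unfolding dyadic_quotient_def[abs_def] by (intro continuous_intros)
qed

lemma dyadic_quotient_has_integral:
  fixes f :: "real \<Rightarrow> 'a::euclidean_space"
  assumes f: "continuous_on UNIV f" and le: "a \<le> b"
  shows "(dyadic_quotient f n has_integral
    mean_velocity (subarc f (b, 1 / 2 ^ n)) - mean_velocity (subarc f (a, 1 / 2 ^ n))) {a..b}"
proof -
  obtain F where F: "\<And>x. (F has_vector_derivative f x) (at x)"
    by (rule continuous_antiderivative[OF f]) (rule that)
  have "((\<lambda>y. mean_velocity (subarc f (y, 1 / 2 ^ n))) has_vector_derivative dyadic_quotient f n y) (at y)" for y
  proof -
    have "((\<lambda>y. y + 1 / 2 ^ n) has_vector_derivative 1) (at y)" by (auto intro!: derivative_eq_intros)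
    from vector_diff_chain_at[OF this F]
    have "((\<lambda>y. F (y + 1 / 2 ^ n)) has_vector_derivative f (y + 1 / 2 ^ n)) (at y)" by (simp add: o_def)
    from bounded_linear.has_vector_derivative[OF bounded_linear_scaleR_right has_vector_derivative_diff[OF this F]]
    have "((\<lambda>y. 2 ^ n *\<^sub>R (F (y + 1 / 2 ^ n) - F y)) has_vector_derivative dyadic_quotient f n y) (at y)"
      unfolding dyadic_quotient_def .
    then show ?thesis by (simp add: increment_eq_mean_velocity[OF F])
  qed
  from fundamental_theorem_of_calculus[OF le has_vector_derivative_at_within[OF this]] show ?thesis .
qed

lemma mean_velocity_shrinking_arcs:
  fixes f :: "real \<Rightarrow> 'a::euclidean_space"
  assumes f: "continuous_on UNIV f"
  shows "(\<lambda>n. mean_velocity (subarc f (y, 1 / 2 ^ n))) \<longlonglongrightarrow> f y"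
proof -
  have "(\<lambda>n. (y, 1 / (2::real) ^ n)) \<longlonglongrightarrow> (y, 0)"
    by (intro tendsto_intros LIMSEQ_divide_realpow_zero) simp
  from continuous_on_tendsto_compose[OF continuous_on_mean_velocity_subarc[OF f] this]
  show ?thesis by (simp add: mean_velocity_def subarc_def[abs_def])
qed

lemma has_vector_derivative_if_dyadic_quotients_converge:
  fixes f :: "real \<Rightarrow> 'a::euclidean_space"
  assumes f: "continuous_on UNIV f" and lim: "uniform_limit UNIV (dyadic_quotient f) g sequentially"
  shows "(f has_vector_derivative g x) (at x)"
proof -
  have g: "continuous_on UNIV g"
    by (rule uniform_limit_theorem[OF _ lim]) (use continuous_on_dyadic_quotient[OF f] in auto)
  have primitive: "f y = integral {x-1..y} g + f (x - 1)" if y: "x - 1 \<le> y" for y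
  proof -
    let ?I = "\<lambda>n. mean_velocity (subarc f (y, 1 / 2 ^ n)) - mean_velocity (subarc f (x - 1, 1 / 2 ^ n))"
    have "uniform_limit {x-1..y} (dyadic_quotient f) g sequentially"
      by (rule uniform_limit_on_subset[OF lim]) simp
    then obtain I J where I: "\<And>n. (dyadic_quotient f n has_integral I n) {x-1..y}" "(g has_integral J) {x-1..y}" "I \<longlonglongrightarrow> J"
      by (rule uniform_limit_integral[OF _ continuous_on_dyadic_quotient[OF f]]) auto
    have "I = ?I" using has_integral_unique[OF I(1) dyadic_quotient_has_integral[OF f y]] by blast
    then have "I \<longlonglongrightarrow> f y - f (x - 1)" by (simp only: tendsto_diff mean_velocity_shrinking_arcs[OF f])
    then have "J = f y - f (x - 1)" by (rule LIMSEQ_unique[OF I(3)])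
    then show ?thesis using I(2) by (simp add: integral_unique)
  qed
  have "((\<lambda>y. integral {x-1..y} g) has_vector_derivative g x) (at x within {x-1..x+1})"
    by (rule integral_has_vector_derivative[OF continuous_on_subset[OF g]]) auto
  then have "((\<lambda>y. integral {x-1..y} g + f (x - 1)) has_vector_derivative g x) (at x within {x-1..x+1})"
    by (simp only: has_vector_derivative_add_const)
  then have "(f has_vector_derivative g x) (at x within {x-1..x+1})"
    by (rule has_vector_derivative_transform[rotated 2]) (auto intro: primitive)
  then show ?thesis by (simp add: at_within_Icc_at)
qed

lemma dyadic_quotient_increment_le:
  fixes f :: "real \<Rightarrow> real^'n"
  assumes w: "weak_deriv f g" and \<sigma>: "1/2 < \<sigma>" and \<kappa>: "0 \<le> \<kappa>" and gag: "gagliardo \<sigma> g \<le> ennreal (\<kappa>\<^sup>2)"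
  shows "norm (dyadic_quotient f (Suc (Suc n)) x - dyadic_quotient f (Suc n) x) \<le> \<kappa> * ((1/2) powr (\<sigma> - 1/2)) ^ Suc n"
proof -
  define r where "r = 1 / (2::real) ^ Suc n"
  have r: "0 < r" "r \<le> 1/2" by (auto simp: r_def field_simps)
  let ?A = "set_lebesgue_integral lborel {x..x + r / 2} g" and ?B = "set_lebesgue_integral lborel {x + r / 2..x + r} g"
  have halves: "f (x + r / 2) - f x = ?A" "f (x + r) - f (x + r / 2) = ?B"
    using r by (auto simp: weak_deriv_integral[OF w])
  have scales: "1 / (2::real) ^ Suc (Suc n) = r / 2" "1 / (2::real) ^ Suc n = r"
    "(2::real) ^ Suc (Suc n) = 2 / r" "(2::real) ^ Suc n = 1 / r"
    by (simp_all add: r_def)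
  have "dyadic_quotient f (Suc (Suc n)) x - dyadic_quotient f (Suc n) x
      = (1 / r) *\<^sub>R (2 *\<^sub>R (f (x + r / 2) - f x) - (f (x + r) - f x))"
    unfolding dyadic_quotient_def scales by (simp add: scaleR_diff_right)
  also have "2 *\<^sub>R (f (x + r / 2) - f x) - (f (x + r) - f x) = ?A - ?B"
    unfolding halves[symmetric] by (simp add: scaleR_2)
  also have "norm ((1 / r) *\<^sub>R (?A - ?B)) \<le> (1 / r) * (\<kappa> * r powr (1/2 + \<sigma>))"
    unfolding norm_scaleR using r \<sigma> \<kappa> gag w weak_deriv_set_integrable[OF w]
    by (intro mult_mono half_integrals_difference) (auto simp: weak_deriv_def)
  also have "r powr (1/2 + \<sigma>) = r * r powr (\<sigma> - 1/2)"
    using r powr_mult_base[of r "\<sigma> - 1/2"] by (simp add: add.commute)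
  also have "(1 / r) * (\<kappa> * (r * r powr (\<sigma> - 1/2))) = \<kappa> * r powr (\<sigma> - 1/2)" using r by simp
  also have "r powr (\<sigma> - 1/2) = ((1/2) powr (\<sigma> - 1/2)) ^ Suc n"
  proof -
    have "r = (1/2) powr real (Suc n)"
      by (simp only: powr_realpow r_def power_one_over zero_less_divide_1_iff zero_less_numeral)
    moreover have "((1/2 :: real) powr (\<sigma> - 1/2)) ^ Suc n = ((1/2) powr (\<sigma> - 1/2)) powr real (Suc n)"
      by (subst powr_realpow) simp_all
    ultimately show ?thesis by (simp only: powr_powr mult.commute)
  qed
  finally show ?thesis .
qed

definition sobolev_const :: "real \<Rightarrow> real" where
  "sobolev_const \<sigma> = 2 + 1 / (1 - (1/2) powr (\<sigma> - 1/2))"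

lemma sobolev_embedding:
  fixes f :: "real \<Rightarrow> real^'n"
  assumes w: "weak_deriv f g" and \<sigma>: "1/2 < \<sigma>" and \<kappa>: "0 \<le> \<kappa>"
    and gag: "gagliardo \<sigma> g \<le> ennreal (\<kappa>\<^sup>2)"
    and L2: "(\<integral>\<^sup>+x\<in>{0..1}. ennreal ((norm (g x))\<^sup>2) \<partial>lborel) \<le> ennreal (\<kappa>\<^sup>2)"
  obtains g' where "continuous_on UNIV g'" "\<And>x. (f has_vector_derivative g' x) (at x)"
    "\<And>x. norm (g' x) \<le> sobolev_const \<sigma> * \<kappa>"
proof -
  note f = weak_deriv_continuous[OF w]
  define q where "q = (1/2::real) powr (\<sigma> - 1/2)"
  have q: "0 < q" "q < 1" using \<sigma> powr_less_mono2[of "\<sigma> - 1/2" "1/2" 1] by (auto simp: q_def)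
  have "norm (dyadic_quotient f (Suc (Suc n)) x - dyadic_quotient f (Suc n) x) \<le> \<kappa> * q ^ n" for n x
  proof -
    have "\<kappa> * q ^ Suc n \<le> \<kappa> * q ^ n" using \<kappa> q by (intro mult_left_mono power_decreasing) auto
    then show ?thesis
      using dyadic_quotient_increment_le[OF w \<sigma> \<kappa> gag, of n x] unfolding q_def by (rule order_trans[rotated])
  qed
  then obtain g' where g': "uniform_limit UNIV (\<lambda>n. dyadic_quotient f (Suc n)) g' sequentially"
    "\<And>x. norm (g' x) \<le> norm (dyadic_quotient f 1 x) + \<kappa> / (1 - q)"
    using uniform_limit_if_geometric_increments[of "\<lambda>n. dyadic_quotient f (Suc n)" \<kappa> q] q by (auto simp: One_nat_def)
  have lim: "uniform_limit UNIV (dyadic_quotient f) g' sequentially"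
    using g'(1) unfolding uniform_limit_iff
    using eventually_sequentially_Suc[of "\<lambda>n. \<forall>x\<in>UNIV. dist (dyadic_quotient f n x) (g' x) < e" for e] by blast
  have "continuous_on UNIV g'"
    by (rule uniform_limit_theorem[OF _ lim]) (use continuous_on_dyadic_quotient[OF f] in auto)
  moreover have "norm (g' x) \<le> sobolev_const \<sigma> * \<kappa>" for x
  proof -
    have "norm (dyadic_quotient f 1 x) \<le> 2 * \<kappa>"
      using norm_increment_le_L2[OF w \<kappa> L2, of x "x + 1/2"] by (simp add: dyadic_quotient_def)
    then have "norm (g' x) \<le> 2 * \<kappa> + \<kappa> / (1 - q)" using g'(2)[of x] by linarith
    then show ?thesis by (simp add: sobolev_const_def q_def algebra_simps)
  qed
  ultimately show thesis
    using has_vector_derivative_if_dyadic_quotients_converge[OF f lim] that by blast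
qed

section \<open>Velocities of Sobolev curves\<close>

abbreviation (input) velocity :: "(real \<Rightarrow> real^'n) \<Rightarrow> real \<Rightarrow> real^'n" where
  "velocity f \<equiv> \<lambda>x. vector_derivative f (at x)"

lemma gagliardo_0: "gagliardo \<sigma> (\<lambda>_. 0 :: real^'n) = 0"
  by (simp add: gagliardo_def)

lemma gagliardo_scaleR:
  fixes g :: "real \<Rightarrow> real^'n"
  assumes [measurable]: "g \<in> borel_measurable borel"
  shows "gagliardo \<sigma> (\<lambda>x. c *\<^sub>R g x) = ennreal (c\<^sup>2) * gagliardo \<sigma> g"
proof -
  have scale: "(norm (c *\<^sub>R x - c *\<^sub>R y))\<^sup>2 / a = c\<^sup>2 * ((norm (x - y))\<^sup>2 / a)" for x y :: "real^'n" and a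
    by (simp add: scaleR_diff_right[symmetric] power_mult_distrib del: scaleR_diff_right)
  show ?thesis
    unfolding gagliardo_def scale by (simp add: ennreal_mult nn_integral_cmult mult.assoc del: times_divide_eq_right)
qed

lemma gagliardo_add_le:
  fixes g k :: "real \<Rightarrow> real^'n"
  assumes [measurable]: "g \<in> borel_measurable borel" "k \<in> borel_measurable borel"
  shows "gagliardo \<sigma> (\<lambda>x. g x + k x) \<le> 2 * gagliardo \<sigma> g + 2 * gagliardo \<sigma> k"
proof -
  let ?I = "\<lambda>g u w. ennreal ((norm (g (u + w) - g u))\<^sup>2 / \<bar>w\<bar> powr (1 + 2 * \<sigma>)) * indicator {-1/2..1/2} w"
  have pointwise: "?I (\<lambda>x. g x + k x) u w \<le> 2 * ?I g u w + 2 * ?I k u w" for u w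
  proof -
    let ?a = "g (u + w) - g u" and ?b = "k (u + w) - k u" and ?W = "\<bar>w\<bar> powr (1 + 2 * \<sigma>)"
    have "(norm (?a + ?b))\<^sup>2 \<le> (norm ?a + norm ?b)\<^sup>2" by (intro power_mono norm_triangle_ineq) auto
    also have "\<dots> \<le> 2 * (norm ?a)\<^sup>2 + 2 * (norm ?b)\<^sup>2"
      using zero_le_power2[of "norm ?a - norm ?b"] by (simp add: power2_eq_square algebra_simps)
    finally have "(norm (?a + ?b))\<^sup>2 / ?W \<le> (2 * (norm ?a)\<^sup>2 + 2 * (norm ?b)\<^sup>2) / ?W"
      by (rule divide_right_mono) simp
    moreover have sum_eq: "g (u + w) + k (u + w) - (g u + k u) = ?a + ?b" by simp
    ultimately have "ennreal ((norm (g (u + w) + k (u + w) - (g u + k u)))\<^sup>2 / ?W)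
        \<le> ennreal (2 * ((norm ?a)\<^sup>2 / ?W) + 2 * ((norm ?b)\<^sup>2 / ?W))"
      unfolding sum_eq by (intro ennreal_leI) (simp add: add_divide_distrib)
    also have "\<dots> = 2 * ennreal ((norm ?a)\<^sup>2 / ?W) + 2 * ennreal ((norm ?b)\<^sup>2 / ?W)"
      by (subst ennreal_plus) (auto simp: numeral_mult_ennreal)
    finally show ?thesis by (auto simp: indicator_def)
  qed
  have "gagliardo \<sigma> (\<lambda>x. g x + k x)
      \<le> (\<integral>\<^sup>+u. (\<integral>\<^sup>+w. 2 * ?I g u w + 2 * ?I k u w \<partial>lborel) * indicator {0..1} u \<partial>lborel)"
    unfolding gagliardo_def by (intro nn_integral_mono mult_right_mono) (use pointwise in auto)
  also have "\<dots> = 2 * gagliardo \<sigma> g + 2 * gagliardo \<sigma> k"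
    unfolding gagliardo_def by (simp add: nn_integral_add nn_integral_cmult distrib_right mult.assoc)
  finally show ?thesis .
qed

lemma HsobI:
  fixes f :: "real \<Rightarrow> real^'n"
  assumes "periodic1 f" "\<And>x. (f has_vector_derivative g x) (at x)" "continuous_on UNIV g" "gagliardo \<sigma> g < \<infinity>"
  shows "Hsob \<sigma> f"
  unfolding Hsob_def using assms weak_deriv_if_continuous_derivative[OF assms(1-3)] by auto

lemma sobolev_const_ge: "1/2 < \<sigma> \<Longrightarrow> 2 \<le> sobolev_const \<sigma>"
  using powr_less_mono2[of "\<sigma> - 1/2" "1/2" 1] by (simp add: sobolev_const_def)

lemma Hnorm_nonneg: "0 \<le> Hnorm \<sigma> f"
  unfolding Hnorm_def Let_def set_lebesgue_integral_def
  by (intro add_nonneg_nonneg real_sqrt_ge_zero Bochner_Integration.integral_nonneg) auto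

definition unit_direction :: "real \<Rightarrow> (real \<Rightarrow> real^'n) \<Rightarrow> bool" where
  "unit_direction \<sigma> k \<longleftrightarrow> continuous_on UNIV k \<and> periodic1 k \<and> (\<forall>u. norm (k u) \<le> 1) \<and> gagliardo \<sigma> k \<le> 1"

context
  fixes \<sigma> :: real
  assumes \<sigma>: "1/2 < \<sigma>"
begin

lemma Hsob_has_velocity:
  fixes f :: "real \<Rightarrow> real^'n"
  assumes f: "Hsob \<sigma> f"
  shows "(f has_vector_derivative velocity f x) (at x)" "continuous_on UNIV (velocity f)"
proof -
  obtain g where w: "weak_deriv f g" and gag: "gagliardo \<sigma> g < \<infinity>" using f by (auto simp: Hsob_def)
  let ?N = "\<integral>\<^sup>+x\<in>{0..1}. ennreal ((norm (g x))\<^sup>2) \<partial>lborel"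
  have L2: "?N < \<infinity>" using w by (simp add: weak_deriv_def)
  define \<kappa> where "\<kappa> = sqrt (enn2real (gagliardo \<sigma> g) + enn2real ?N)"
  have \<kappa>: "0 \<le> \<kappa>" by (simp add: \<kappa>_def)
  have "gagliardo \<sigma> g \<le> ennreal (\<kappa>\<^sup>2)" "?N \<le> ennreal (\<kappa>\<^sup>2)"
    using gag L2 by (simp_all add: \<kappa>_def ennreal_plus add_increasing add_increasing2)
  from sobolev_embedding[OF w \<sigma> \<kappa> this]
  obtain g' where g': "continuous_on UNIV g'" "\<And>x. (f has_vector_derivative g' x) (at x)" by metis
  have "velocity f = g'" using g'(2) vector_derivative_at by blast
  with g' show "(f has_vector_derivative velocity f x) (at x)" "continuous_on UNIV (velocity f)" by auto
qed

lemma Hsob_periodic: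
  fixes f :: "real \<Rightarrow> real^'n"
  assumes "Hsob \<sigma> f"
  shows "periodic1 f" "periodic1 (velocity f)"
proof -
  show "periodic1 f" using assms by (simp add: Hsob_def)
  then show "periodic1 (velocity f)" by (rule periodic1_derivative) (rule Hsob_has_velocity(1)[OF assms])
qed

lemma Hsob_weak_deriv_velocity:
  fixes f :: "real \<Rightarrow> real^'n"
  assumes "Hsob \<sigma> f"
  shows "weak_deriv f (velocity f)"
  by (intro weak_deriv_if_continuous_derivative Hsob_periodic Hsob_has_velocity assms)

lemma gagliardo_velocity_finite:
  fixes f :: "real \<Rightarrow> real^'n"
  assumes "Hsob \<sigma> f"
  shows "gagliardo \<sigma> (velocity f) < \<infinity>"
proof -
  obtain g where "weak_deriv f g" "gagliardo \<sigma> g < \<infinity>" using assms by (auto simp: Hsob_def)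
  then show ?thesis
    using gagliardo_cong_AE[OF weak_deriv_unique_AE[OF _ Hsob_weak_deriv_velocity[OF assms]]] by metis
qed

lemma Hnorm_eq_velocity:
  fixes f :: "real \<Rightarrow> real^'n"
  assumes "Hsob \<sigma> f"
  shows "Hnorm \<sigma> f = sqrt (set_lebesgue_integral lborel {0..1} (\<lambda>x. (norm (f x))\<^sup>2))
    + sqrt (set_lebesgue_integral lborel {0..1} (\<lambda>x. (norm (velocity f x))\<^sup>2))
    + sqrt (enn2real (gagliardo \<sigma> (velocity f)))"
proof -
  define g where "g = (SOME g. weak_deriv f g)"
  have w: "weak_deriv f g" unfolding g_def by (rule someI[of "weak_deriv f"]) (rule Hsob_weak_deriv_velocity[OF assms])
  have ae: "AE x in lborel. g x = velocity f x"
    by (rule weak_deriv_unique_AE[OF w Hsob_weak_deriv_velocity[OF assms]])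
  have [measurable]: "g \<in> borel_measurable borel" "velocity f \<in> borel_measurable borel"
    using w borel_measurable_continuous_onI[OF Hsob_has_velocity(2)[OF assms]] by (simp_all add: weak_deriv_def)
  have "set_lebesgue_integral lborel {0..1} (\<lambda>x. (norm (g x))\<^sup>2)
      = set_lebesgue_integral lborel {0..1} (\<lambda>x. (norm (velocity f x))\<^sup>2)"
    unfolding set_lebesgue_integral_def
    by (rule integral_cong_AE) (use ae in \<open>measurable, eventually_elim, simp\<close>)
  then show ?thesis
    by (simp add: Hnorm_def g_def[symmetric] gagliardo_cong_AE[OF ae])
qed

lemma gagliardo_velocity_le:
  fixes f :: "real \<Rightarrow> real^'n"
  assumes "Hsob \<sigma> f"
  shows "gagliardo \<sigma> (velocity f) \<le> ennreal ((Hnorm \<sigma> f)\<^sup>2)"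
proof -
  have "sqrt (enn2real (gagliardo \<sigma> (velocity f))) \<le> Hnorm \<sigma> f"
    unfolding Hnorm_eq_velocity[OF assms] set_lebesgue_integral_def
    by (intro add_increasing add_nonneg_nonneg real_sqrt_ge_zero Bochner_Integration.integral_nonneg) auto
  then have "(sqrt (enn2real (gagliardo \<sigma> (velocity f))))\<^sup>2 \<le> (Hnorm \<sigma> f)\<^sup>2" by (intro power_mono) auto
  then have "enn2real (gagliardo \<sigma> (velocity f)) \<le> (Hnorm \<sigma> f)\<^sup>2" by simp
  from ennreal_leI[OF this] show ?thesis
    using ennreal_enn2real[OF gagliardo_velocity_finite[OF assms, unfolded infinity_ennreal_def]] by simp
qed

lemma L2_velocity_le:
  fixes f :: "real \<Rightarrow> real^'n"
  assumes "Hsob \<sigma> f"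
  shows "(\<integral>\<^sup>+x\<in>{0..1}. ennreal ((norm (velocity f x))\<^sup>2) \<partial>lborel) \<le> ennreal ((Hnorm \<sigma> f)\<^sup>2)"
proof -
  let ?B = "set_lebesgue_integral lborel {0..1} (\<lambda>x. (norm (velocity f x))\<^sup>2)"
  have "continuous_on {0..1} (\<lambda>x. (norm (velocity f x))\<^sup>2)"
    by (intro continuous_intros continuous_on_subset[OF Hsob_has_velocity(2)[OF assms]]) simp
  then have "((\<lambda>x. (norm (velocity f x))\<^sup>2) has_integral ?B) {0..1}"
    by (rule has_integral_set_lebesgue_lborel)
  then have "(\<integral>\<^sup>+x\<in>{0..1}. ennreal ((norm (velocity f x))\<^sup>2) \<partial>lborel) = ennreal ?B"
    by (rule nn_integral_has_integral_lebesgue'[rotated]) simp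
  moreover have "0 \<le> ?B" unfolding set_lebesgue_integral_def by (intro Bochner_Integration.integral_nonneg) simp
  moreover have "sqrt ?B \<le> Hnorm \<sigma> f"
    unfolding Hnorm_eq_velocity[OF assms] set_lebesgue_integral_def by (simp add: Bochner_Integration.integral_nonneg)
  then have "(sqrt ?B)\<^sup>2 \<le> (Hnorm \<sigma> f)\<^sup>2" using \<open>0 \<le> ?B\<close> by (intro power_mono) auto
  ultimately show ?thesis by (simp add: ennreal_leI)
qed

lemma norm_velocity_le:
  fixes f :: "real \<Rightarrow> real^'n"
  assumes "Hsob \<sigma> f"
  shows "norm (velocity f x) \<le> sobolev_const \<sigma> * Hnorm \<sigma> f"
proof -
  obtain g where "\<And>x. (f has_vector_derivative g x) (at x)" "\<And>x. norm (g x) \<le> sobolev_const \<sigma> * Hnorm \<sigma> f"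
    using sobolev_embedding[OF Hsob_weak_deriv_velocity[OF assms] \<sigma> Hnorm_nonneg gagliardo_velocity_le[OF assms]
        L2_velocity_le[OF assms]] by metis
  then show ?thesis using vector_derivative_at by metis
qed

lemma Hsob_add_scaleR:
  fixes f h :: "real \<Rightarrow> real^'n"
  assumes f: "Hsob \<sigma> f" and h: "Hsob \<sigma> h"
  shows "Hsob \<sigma> (\<lambda>x. f x + c *\<^sub>R h x)" "velocity (\<lambda>x. f x + c *\<^sub>R h x) = (\<lambda>x. velocity f x + c *\<^sub>R velocity h x)"
proof -
  note F = Hsob_has_velocity[OF f] and K = Hsob_has_velocity[OF h]
  have deriv: "((\<lambda>x. f x + c *\<^sub>R h x) has_vector_derivative velocity f x + c *\<^sub>R velocity h x) (at x)" for x
    using F(1)[of x] K(1)[of x] by (auto intro!: derivative_eq_intros)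
  then show "velocity (\<lambda>x. f x + c *\<^sub>R h x) = (\<lambda>x. velocity f x + c *\<^sub>R velocity h x)"
    using vector_derivative_at by blast
  have "velocity f \<in> borel_measurable borel" "velocity h \<in> borel_measurable borel"
    by (intro borel_measurable_continuous_onI F K)+
  then have "gagliardo \<sigma> (\<lambda>x. velocity f x + c *\<^sub>R velocity h x)
      \<le> 2 * gagliardo \<sigma> (velocity f) + 2 * (ennreal (c\<^sup>2) * gagliardo \<sigma> (velocity h))"
    using gagliardo_add_le[of "velocity f" "\<lambda>x. c *\<^sub>R velocity h x" \<sigma>] by (simp add: gagliardo_scaleR)
  also have "\<dots> < \<infinity>"
    using gagliardo_velocity_finite[OF f] gagliardo_velocity_finite[OF h] by (simp add: ennreal_mult_less_top)
  finally show "Hsob \<sigma> (\<lambda>x. f x + c *\<^sub>R h x)"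
    using Hsob_periodic(1)[OF f] Hsob_periodic(1)[OF h] deriv F(2) K(2)
    by (intro HsobI[where g="\<lambda>x. velocity f x + c *\<^sub>R velocity h x"])
       (auto simp: periodic1_def intro!: continuous_intros)
qed

lemma Hsob_add:
  fixes f h :: "real \<Rightarrow> real^'n"
  assumes "Hsob \<sigma> f" "Hsob \<sigma> h"
  shows "Hsob \<sigma> (\<lambda>x. f x + h x)" "velocity (\<lambda>x. f x + h x) = (\<lambda>x. velocity f x + velocity h x)"
  using Hsob_add_scaleR[OF assms, of 1] by simp_all

lemma Hsob_diff:
  fixes f h :: "real \<Rightarrow> real^'n"
  assumes "Hsob \<sigma> f" "Hsob \<sigma> h"
  shows "Hsob \<sigma> (\<lambda>x. f x - h x)" "velocity (\<lambda>x. f x - h x) = (\<lambda>x. velocity f x - velocity h x)"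
  using Hsob_add_scaleR[OF assms, of "-1"] by simp_all

lemma velocity_eq_scaled_unit_direction:
  fixes h :: "real \<Rightarrow> real^'n"
  assumes h: "Hsob \<sigma> h"
  obtains k where "unit_direction \<sigma> k" "velocity h = (\<lambda>u. (sobolev_const \<sigma> * Hnorm \<sigma> h) *\<^sub>R k u)"
proof -
  define \<kappa> where "\<kappa> = sobolev_const \<sigma> * Hnorm \<sigma> h"
  let ?k = "\<lambda>u. inverse \<kappa> *\<^sub>R velocity h u"
  have velocity_cont: "continuous_on UNIV (velocity h)" by (rule Hsob_has_velocity(2)[OF h])
  have velocity_le: "norm (velocity h u) \<le> \<kappa>" for u unfolding \<kappa>_def by (rule norm_velocity_le[OF h])
  have Hnorm_le: "Hnorm \<sigma> h \<le> \<kappa>"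
    using mult_right_mono[of 1 "sobolev_const \<sigma>" "Hnorm \<sigma> h"] sobolev_const_ge[OF \<sigma>] Hnorm_nonneg[of \<sigma> h]
    by (simp add: \<kappa>_def)
  then have \<kappa>: "0 \<le> \<kappa>" using Hnorm_nonneg[of \<sigma> h] by simp
  have inverse_le: "inverse \<kappa> * x \<le> 1" if "x \<le> \<kappa>" for x
    using that \<kappa> by (cases "\<kappa> = 0") (simp_all add: field_simps)
  show thesis
  proof (rule that)
    show "velocity h = (\<lambda>u. (sobolev_const \<sigma> * Hnorm \<sigma> h) *\<^sub>R ?k u)"
      using velocity_le unfolding \<kappa>_def[symmetric] by (cases "\<kappa> = 0") (auto simp: fun_eq_iff)
    have "norm (?k u) \<le> 1" for u
      using inverse_le[OF velocity_le] \<kappa> by simp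
    moreover have "gagliardo \<sigma> ?k \<le> 1"
    proof -
      have "(inverse \<kappa> * Hnorm \<sigma> h)\<^sup>2 \<le> 1"
        using inverse_le[OF Hnorm_le] \<kappa> Hnorm_nonneg[of \<sigma> h] by (intro power_le_one) auto
      have "gagliardo \<sigma> ?k \<le> ennreal ((inverse \<kappa>)\<^sup>2) * ennreal ((Hnorm \<sigma> h)\<^sup>2)"
        unfolding gagliardo_scaleR[OF borel_measurable_continuous_onI[OF velocity_cont]]
        by (rule mult_left_mono[OF gagliardo_velocity_le[OF h]]) simp
      also have "\<dots> = ennreal ((inverse \<kappa> * Hnorm \<sigma> h)\<^sup>2)"
        by (simp add: ennreal_mult[symmetric] power_mult_distrib)
      also have "\<dots> \<le> 1" using \<open>(inverse \<kappa> * Hnorm \<sigma> h)\<^sup>2 \<le> 1\<close> by (simp only: ennreal_le_1)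
      finally show ?thesis .
    qed
    ultimately show "unit_direction \<sigma> ?k"
      using velocity_cont Hsob_periodic(2)[OF h]
      by (auto simp: unit_direction_def periodic1_def intro!: continuous_intros)
  qed
qed

end

section \<open>Admissible curves\<close>

definition nondegenerate :: "real \<Rightarrow> (real \<Rightarrow> 'a::euclidean_space) \<Rightarrow> bool" where
  "nondegenerate c g \<longleftrightarrow> (\<forall>u. \<forall>w\<in>{-1/2..1/2}. c \<le> norm (mean_velocity (subarc g (u, w))))"

lemma nondegenerateD:
  "nondegenerate c g \<Longrightarrow> w \<in> {-1/2..1/2} \<Longrightarrow> c \<le> norm (mean_velocity (subarc g (u, w)))"
  by (simp add: nondegenerate_def)

lemma mean_velocity_subarc_0: "mean_velocity (subarc g (u, 0)) = g u"
  by (simp add: mean_velocity_def subarc_def[abs_def])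

lemma nondegenerate_norm_ge: "nondegenerate c g \<Longrightarrow> c \<le> norm (g u)"
  using nondegenerateD[of c g 0 u] by (simp add: mean_velocity_subarc_0)

lemma subarc_periodic: "periodic1 g \<Longrightarrow> subarc g (u + of_int n, w) = subarc g (u, w)"
  using periodic1_of_int[of g] by (auto simp: subarc_def fun_eq_iff) (metis add.commute add.left_commute)

lemma nondegenerate_if_mean_velocity_nonzero:
  fixes g :: "real \<Rightarrow> 'a::euclidean_space"
  assumes g: "continuous_on UNIV g" "periodic1 g"
    and nz: "\<And>u w. w \<in> {-1/2..1/2} \<Longrightarrow> mean_velocity (subarc g (u, w)) \<noteq> 0"
  obtains c where "0 < c" "nondegenerate c g"
proof -
  let ?B = "{0..1} \<times> {-1/2..1/2} :: (real \<times> real) set"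
  let ?m = "\<lambda>x. norm (mean_velocity (subarc g x))"
  have "continuous_on ?B ?m"
    by (intro continuous_intros continuous_on_subset[OF continuous_on_mean_velocity_subarc[OF g(1)]]) auto
  moreover have "compact ?B" "?B \<noteq> {}" by (auto intro!: compact_Times)
  ultimately obtain x where x: "x \<in> ?B" "\<And>y. y \<in> ?B \<Longrightarrow> ?m x \<le> ?m y"
    using continuous_attains_inf by metis
  show thesis
  proof
    show "0 < ?m x" using nz[of "snd x" "fst x"] x(1) by auto
    show "nondegenerate (?m x) g"
      unfolding nondegenerate_def
    proof (intro allI ballI)
      fix u w :: real assume "w \<in> {-1/2..1/2}"
      then have "(frac u, w) \<in> ?B" using frac_ge_0[of u] frac_lt_1[of u] by auto
      moreover have "subarc g (u, w) = subarc g (frac u, w)"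
        using subarc_periodic[OF g(2), of "frac u" "\<lfloor>u\<rfloor>" w] by (simp add: frac_def)
      ultimately show "?m x \<le> norm (mean_velocity (subarc g (u, w)))" using x(2) by metis
    qed
  qed
qed

lemma admissible_imp_nondegenerate:
  fixes \<gamma> :: "real \<Rightarrow> real^'n"
  assumes \<sigma>: "1/2 < \<sigma>" and \<gamma>: "admissible \<sigma> \<gamma>"
  obtains c where "0 < c" "nondegenerate c (velocity \<gamma>)"
proof (rule nondegenerate_if_mean_velocity_nonzero)
  have H: "Hsob \<sigma> \<gamma>" using \<gamma> by (simp add: admissible_def)
  show "continuous_on UNIV (velocity \<gamma>)" "periodic1 (velocity \<gamma>)"
    by (rule Hsob_has_velocity(2)[OF \<sigma> H] Hsob_periodic(2)[OF \<sigma> H])+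
  show "mean_velocity (subarc (velocity \<gamma>) (u, w)) \<noteq> 0" if w: "w \<in> {-1/2..1/2}" for u w
  proof (cases "w = 0")
    case True
    then show ?thesis using \<gamma> by (simp add: mean_velocity_subarc_0 admissible_def regular_curve_def)
  next
    case False
    have "w \<notin> \<int>" using False w by (auto elim!: Ints_cases)
    then have "\<gamma> (u + w) \<noteq> \<gamma> u"
      using \<gamma> unfolding admissible_def injective_RZ_def by (metis add_diff_cancel_left')
    then show ?thesis using increment_eq_mean_velocity[OF Hsob_has_velocity(1)[OF \<sigma> H], of u w] by auto
  qed
qed (rule that)

lemma injective_RZ_if_nondegenerate:
  fixes \<gamma> :: "real \<Rightarrow> real^'n"
  assumes \<gamma>: "periodic1 \<gamma>" "\<And>x. (\<gamma> has_vector_derivative g x) (at x)" and c: "0 < c" "nondegenerate c g"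
  shows "injective_RZ \<gamma>"
  unfolding injective_RZ_def
proof (intro allI impI)
  fix u v assume eq: "\<gamma> u = \<gamma> v"
  define n where "n = round (u - v)"
  define w where "w = u - v - of_int n"
  have "\<bar>of_int n - (u - v)\<bar> \<le> 1/2" unfolding n_def by (rule of_int_round_abs_le)
  then have "-1/2 \<le> w" "w \<le> 1/2" unfolding w_def by arith+
  then have w: "w \<in> {-1/2..1/2}" by simp
  have "\<gamma> (v + w) = \<gamma> u"
    using periodic1_of_int[OF \<gamma>(1), of "u - of_int n" n] by (simp add: w_def)
  then have "w *\<^sub>R mean_velocity (subarc g (v, w)) = 0"
    using increment_eq_mean_velocity[OF \<gamma>(2), of v w] eq by simp
  moreover have "mean_velocity (subarc g (v, w)) \<noteq> 0" using nondegenerateD[OF c(2) w, of v] c(1) by auto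
  ultimately show "u - v \<in> \<int>" by (simp add: w_def)
qed

lemma nondegenerate_imp_admissible:
  fixes \<gamma> :: "real \<Rightarrow> real^'n"
  assumes \<sigma>: "1/2 < \<sigma>" and H: "Hsob \<sigma> \<gamma>" and c: "0 < c" "nondegenerate c (velocity \<gamma>)"
  shows "admissible \<sigma> \<gamma>"
  unfolding admissible_def regular_curve_def C1_curve_def
proof (intro conjI allI H)
  note velocity = Hsob_has_velocity[OF \<sigma> H]
  show "\<gamma> differentiable (at u)" for u by (rule differentiableI_vector[OF velocity(1)])
  show "continuous_on UNIV (velocity \<gamma>)" by (rule velocity(2))
  show "velocity \<gamma> u \<noteq> 0" for u using nondegenerate_norm_ge[OF c(2), of u] c(1) by auto
  show "injective_RZ \<gamma>" by (rule injective_RZ_if_nondegenerate[OF Hsob_periodic(1)[OF \<sigma> H] velocity(1) c])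
qed

lemma nondegenerate_perturb:
  fixes g g' :: "real \<Rightarrow> 'a::euclidean_space"
  assumes g: "nondegenerate c g" "continuous_on UNIV g" and g': "continuous_on UNIV g'" "\<And>u. norm (g' u - g u) \<le> d"
  shows "nondegenerate (c - d) g'"
  unfolding nondegenerate_def
proof (intro allI ballI)
  fix u w :: real assume w: "w \<in> {-1/2..1/2}"
  let ?x = "(u, w)"
  have cont: "continuous_on {0..1} (subarc g ?x)" "continuous_on {0..1} (subarc g' ?x)"
    by (rule continuous_on_subarc[OF g(2)] continuous_on_subarc[OF g'(1)]; simp)+
  have "norm (mean_velocity (\<lambda>s. subarc g' ?x s + (-1) *\<^sub>R subarc g ?x s)) \<le> d"
    by (intro norm_mean_velocity_le continuous_intros cont) (simp add: subarc_def g'(2))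
  then have "norm (mean_velocity (subarc g' ?x) - mean_velocity (subarc g ?x)) \<le> d"
    unfolding mean_velocity_add_scaleR[OF cont(2,1)] by simp
  then show "c - d \<le> norm (mean_velocity (subarc g' ?x))"
    using nondegenerateD[OF g(1) w, of u]
      norm_triangle_ineq2[of "mean_velocity (subarc g ?x)" "mean_velocity (subarc g' ?x)"]
    by (simp add: norm_minus_commute)
qed

definition tame :: "real \<Rightarrow> real \<Rightarrow> (real \<Rightarrow> 'a::euclidean_space) \<Rightarrow> bool" where
  "tame c C g \<longleftrightarrow> continuous_on UNIV g \<and> periodic1 g \<and> nondegenerate c g \<and> (\<forall>u. norm (g u) \<le> C)"

lemma tameD:
  assumes "tame c C g"
  shows "continuous_on UNIV g" "periodic1 g" "nondegenerate c g" "norm (g u) \<le> C" "c \<le> norm (g u)"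
    "w \<in> {-1/2..1/2} \<Longrightarrow> c \<le> norm (mean_velocity (subarc g (u, w)))"
  using assms nondegenerate_norm_ge[of c g] by (auto simp: tame_def nondegenerate_def)

lemma admissible_tame_neighbourhood:
  fixes \<gamma> :: "real \<Rightarrow> real^'n"
  assumes \<sigma>: "1/2 < \<sigma>" and \<gamma>: "admissible \<sigma> \<gamma>"
  obtains c C where "0 < c" "c \<le> 1"
    "\<And>g. continuous_on UNIV g \<Longrightarrow> periodic1 g \<Longrightarrow> (\<And>u. norm (g u - velocity \<gamma> u) \<le> c) \<Longrightarrow> tame c C g"
proof -
  obtain c0 where c0: "0 < c0" "nondegenerate c0 (velocity \<gamma>)" by (rule admissible_imp_nondegenerate[OF \<sigma> \<gamma>])
  have H: "Hsob \<sigma> \<gamma>" using \<gamma> by (simp add: admissible_def)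
  define c where "c = min (c0 / 2) 1"
  have c: "0 < c" "c \<le> 1" "c \<le> c0 - c" using c0 by (auto simp: c_def)
  show thesis
  proof (rule that[OF c(1,2)])
    fix g assume g: "continuous_on UNIV g" "periodic1 g" "\<And>u. norm (g u - velocity \<gamma> u) \<le> c"
    have "nondegenerate (c0 - c) g"
      by (rule nondegenerate_perturb[OF c0(2) Hsob_has_velocity(2)[OF \<sigma> H] g(1,3)])
    then have "nondegenerate c g" using c(3) unfolding nondegenerate_def by (meson order_trans)
    moreover have "norm (g u) \<le> sobolev_const \<sigma> * Hnorm \<sigma> \<gamma> + c" for u
      using norm_triangle_sub[of "g u" "velocity \<gamma> u"] g(3)[of u] norm_velocity_le[OF \<sigma> H, of u] by simp
    ultimately show "tame c (sobolev_const \<sigma> * Hnorm \<sigma> \<gamma> + c) g" using g by (simp add: tame_def)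
  qed
qed

section \<open>Energy estimates on the level of velocities\<close>

definition parameter_box :: "(real \<times> real) set" where
  "parameter_box = {0..1} \<times> {-1/2..1/2}"

definition weighted_box :: "real \<Rightarrow> (real \<times> real) measure" where
  "weighted_box \<alpha> = density lborel (\<lambda>x. indicator parameter_box x * ennreal (\<bar>snd x\<bar> powr (-\<alpha>)))"

lemma parameter_box_measurable [measurable]: "parameter_box \<in> sets borel"
  unfolding parameter_box_def by (intro borel_closed closed_Times) auto

lemma weight_measurable [measurable]: "(\<lambda>x::real \<times> real. \<bar>snd x\<bar> powr a) \<in> borel_measurable borel"
proof -
  have [measurable]: "(snd :: real \<times> real \<Rightarrow> real) \<in> borel_measurable borel"
    by (intro borel_measurable_continuous_onI continuous_intros)
  show ?thesis by measurable
qed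

lemma sets_weighted_box [simp, measurable_cong]: "sets (weighted_box \<alpha>) = sets borel"
  by (simp add: weighted_box_def)

lemma nn_integral_weighted_box:
  assumes [measurable]: "F \<in> borel_measurable borel"
  shows "(\<integral>\<^sup>+x. F x \<partial>weighted_box \<alpha>) =
    (\<integral>\<^sup>+u\<in>{0..1}. (\<integral>\<^sup>+w\<in>{-1/2..1/2}. ennreal (\<bar>w\<bar> powr (-\<alpha>)) * F (u, w) \<partial>lborel) \<partial>lborel)"
proof -
  let ?G = "\<lambda>x. indicator parameter_box x * ennreal (\<bar>snd x\<bar> powr (-\<alpha>)) * F x"
  have "?G \<in> borel_measurable borel" by measurable
  then have "?G \<in> borel_measurable (lborel \<Otimes>\<^sub>M lborel)" by (simp add: lborel_prod)
  from lborel.nn_integral_fst[OF this]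
  have "(\<integral>\<^sup>+x. ?G x \<partial>lborel) = (\<integral>\<^sup>+u. \<integral>\<^sup>+w. ?G (u, w) \<partial>lborel \<partial>lborel)" by (simp add: lborel_prod)
  also have "\<dots> = (\<integral>\<^sup>+u\<in>{0..1}. (\<integral>\<^sup>+w\<in>{-1/2..1/2}. ennreal (\<bar>w\<bar> powr (-\<alpha>)) * F (u, w) \<partial>lborel) \<partial>lborel)"
    by (intro nn_integral_cong) (auto simp: indicator_def parameter_box_def mult.commute intro!: nn_integral_cong)
  finally show ?thesis by (simp add: weighted_box_def nn_integral_density)
qed

lemma AE_weighted_box: "AE x in weighted_box \<alpha>. x \<in> parameter_box \<and> snd x \<noteq> 0"
proof -
  have "(\<lambda>x. indicator parameter_box x * ennreal (\<bar>snd x\<bar> powr (-\<alpha>))) \<in> borel_measurable lborel" by measurable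
  then show ?thesis unfolding weighted_box_def by (subst AE_density) (auto simp: indicator_def)
qed

lemma nn_integral_contract_le:
  fixes \<phi> :: "real \<Rightarrow> real"
  assumes \<phi>[measurable]: "\<phi> \<in> borel_measurable borel" and \<phi>_nonneg: "\<And>w. 0 \<le> \<phi> w" "\<phi> 0 = 0"
    and \<alpha>: "1 \<le> \<alpha>" and s: "0 \<le> s" "s \<le> 1" and b: "0 \<le> b"
  shows "(\<integral>\<^sup>+w\<in>{-b..b}. ennreal (\<bar>w\<bar> powr (-\<alpha>) * \<phi> (s * w)) \<partial>lborel)
    \<le> (\<integral>\<^sup>+w\<in>{-b..b}. ennreal (\<bar>w\<bar> powr (-\<alpha>) * \<phi> w) \<partial>lborel)"
proof (cases "s = 0")
  case False
  with s have s: "0 < s" "s \<le> 1" by auto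
  let ?F = "\<lambda>w. ennreal (\<bar>w\<bar> powr (-\<alpha>) * \<phi> w) * indicator {-b..b} w"
  have "ennreal (\<bar>w\<bar> powr (-\<alpha>) * \<phi> (s * w)) * indicator {-b..b} w \<le> ennreal s * ?F (0 + s * w)" for w
  proof -
    have "s powr 0 \<le> s powr (1 - \<alpha>)" using s \<alpha> by (intro powr_mono') auto
    then have "\<bar>w\<bar> powr (-\<alpha>) * \<phi> (s * w) \<le> s powr (1 - \<alpha>) * (\<bar>w\<bar> powr (-\<alpha>) * \<phi> (s * w))"
      using mult_right_mono[of 1 "s powr (1 - \<alpha>)" "\<bar>w\<bar> powr (-\<alpha>) * \<phi> (s * w)"] s \<phi>_nonneg(1) by simp
    also have "s powr (1 - \<alpha>) * (\<bar>w\<bar> powr (-\<alpha>) * \<phi> (s * w)) = s * (\<bar>s * w\<bar> powr (-\<alpha>) * \<phi> (s * w))"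
      using s by (simp add: abs_mult powr_mult powr_diff powr_minus field_simps)
    finally have "ennreal (\<bar>w\<bar> powr (-\<alpha>) * \<phi> (s * w)) \<le> ennreal s * ennreal (\<bar>s * w\<bar> powr (-\<alpha>) * \<phi> (s * w))"
      using s \<phi>_nonneg(1) by (simp add: ennreal_leI ennreal_mult[symmetric])
    moreover have "s * w \<in> {-b..b}" if w: "w \<in> {-b..b}"
    proof -
      have "\<bar>s * w\<bar> \<le> 1 * b" unfolding abs_mult using s w by (intro mult_mono) auto
      then show ?thesis by (simp add: abs_le_iff)
    qed
    ultimately show ?thesis by (auto simp: indicator_def)
  qed
  then have "(\<integral>\<^sup>+w\<in>{-b..b}. ennreal (\<bar>w\<bar> powr (-\<alpha>) * \<phi> (s * w)) \<partial>lborel) \<le> (\<integral>\<^sup>+w. ennreal s * ?F (0 + s * w) \<partial>lborel)"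
    by (intro nn_integral_mono)
  also have "\<dots> = \<bar>s\<bar> * (\<integral>\<^sup>+w. ?F (0 + s * w) \<partial>lborel)" using s by (simp add: nn_integral_cmult)
  also have "\<dots> = (\<integral>\<^sup>+w. ?F w \<partial>lborel)" using s by (intro nn_integral_real_affine[symmetric]) auto
  finally show ?thesis .
qed (simp add: \<phi>_nonneg)

lemma continuous_on_square_increment_subarc:
  fixes g :: "real \<Rightarrow> 'a::euclidean_space"
  assumes g: "continuous_on UNIV g"
  shows "continuous_on UNIV (\<lambda>x. square_increment (subarc g x))"
  unfolding square_increment_def subarc_def
  by (intro continuous_on_unit_integral)
     (auto simp: split_def intro!: continuous_intros continuous_on_compose2[OF g])

lemma square_increment_subarc_eq_nn_integral:
  fixes g :: "real \<Rightarrow> 'a::euclidean_space"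
  assumes g: "continuous_on UNIV g" and a: "0 \<le> a"
  shows "ennreal (a * square_increment (subarc g (u, w)))
    = (\<integral>\<^sup>+s\<in>{0..1}. ennreal (a * (norm (g (u + s * w) - g u))\<^sup>2) \<partial>lborel)"
proof -
  have "continuous_on {0..1} (\<lambda>s. (norm (g (u + s * w) - g u))\<^sup>2)"
    by (intro continuous_intros continuous_on_compose2[OF g _ subset_UNIV])
  then have "((\<lambda>s. a * (norm (g (u + s * w) - g u))\<^sup>2) has_integral a * square_increment (subarc g (u, w))) {0..1}"
    unfolding square_increment_def subarc_def
    by (intro has_integral_mult_right) (simp add: integrable_integral integrable_continuous_real)
  with a show ?thesis by (intro nn_integral_has_integral_lebesgue'[symmetric]) auto
qed

lemma nn_integral_square_increment_le:
  fixes g :: "real \<Rightarrow> 'a::euclidean_space"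
  assumes g: "continuous_on UNIV g" and \<alpha>: "1 \<le> \<alpha>"
  shows "(\<integral>\<^sup>+w\<in>{-1/2..1/2}. ennreal (\<bar>w\<bar> powr (-\<alpha>) * square_increment (subarc g (u, w))) \<partial>lborel)
    \<le> (\<integral>\<^sup>+w\<in>{-1/2..1/2}. ennreal ((norm (g (u + w) - g u))\<^sup>2 / \<bar>w\<bar> powr \<alpha>) \<partial>lborel)"
proof -
  have [measurable]: "g \<in> borel_measurable borel" using g by (rule borel_measurable_continuous_onI)
  let ?\<phi> = "\<lambda>w. (norm (g (u + w) - g u))\<^sup>2"
  let ?I = "\<integral>\<^sup>+w\<in>{-1/2..1/2}. ennreal (\<bar>w\<bar> powr (-\<alpha>) * ?\<phi> w) \<partial>lborel"
  have "(\<integral>\<^sup>+w\<in>{-1/2..1/2}. ennreal (\<bar>w\<bar> powr (-\<alpha>) * square_increment (subarc g (u, w))) \<partial>lborel)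
     = (\<integral>\<^sup>+w. (\<integral>\<^sup>+s. indicator {0..1} s * (ennreal (\<bar>w\<bar> powr (-\<alpha>) * ?\<phi> (s * w)) * indicator {-1/2..1/2} w) \<partial>lborel) \<partial>lborel)"
    unfolding square_increment_subarc_eq_nn_integral[OF g powr_ge_zero]
    by (intro nn_integral_cong) (subst nn_integral_multc[symmetric], measurable, simp add: mult_ac)
  also have "\<dots> = (\<integral>\<^sup>+s. (\<integral>\<^sup>+w. indicator {0..1} s *
      (ennreal (\<bar>w\<bar> powr (-\<alpha>) * ?\<phi> (s * w)) * indicator {-1/2..1/2} w) \<partial>lborel) \<partial>lborel)"
    by (rule lborel_pair.Fubini') measurable
  also have "\<dots> \<le> (\<integral>\<^sup>+s. indicator {0..1} (s::real) * ?I \<partial>lborel)"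
  proof (rule nn_integral_mono)
    fix s :: real
    have "?\<phi> \<in> borel_measurable borel" by measurable
    from nn_integral_contract_le[OF this _ _ \<alpha>, of s "1/2"]
    have contract: "(\<integral>\<^sup>+w\<in>{-(1/2)..1/2}. ennreal (\<bar>w\<bar> powr (-\<alpha>) * ?\<phi> (s * w)) \<partial>lborel) \<le> ?I" if "s \<in> {0..1}"
      using that by simp
    have "(\<integral>\<^sup>+w. indicator {0..1} s * (ennreal (\<bar>w\<bar> powr (-\<alpha>) * ?\<phi> (s * w)) * indicator {-1/2..1/2} w) \<partial>lborel)
        = indicator {0..1} s * (\<integral>\<^sup>+w\<in>{-(1/2)..1/2}. ennreal (\<bar>w\<bar> powr (-\<alpha>) * ?\<phi> (s * w)) \<partial>lborel)"
      by (subst nn_integral_cmult) simp_all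
    also have "\<dots> \<le> indicator {0..1} s * ?I"
      using contract by (cases "s \<in> {0..1}") (simp_all del: atLeastAtMost_iff)
    finally show "(\<integral>\<^sup>+w. indicator {0..1} s * (ennreal (\<bar>w\<bar> powr (-\<alpha>) * ?\<phi> (s * w)) * indicator {-1/2..1/2} w) \<partial>lborel)
        \<le> indicator {0..1} s * ?I" .
  qed
  also have "\<dots> = ?I" by (subst nn_integral_multc) simp_all
  also have "?I = (\<integral>\<^sup>+w\<in>{-1/2..1/2}. ennreal (?\<phi> w / \<bar>w\<bar> powr \<alpha>) \<partial>lborel)"
    by (simp add: powr_minus_divide)
  finally show ?thesis .
qed

lemma nn_integral_weighted_square_increment_le:
  fixes g :: "real \<Rightarrow> real^'n"
  assumes g: "continuous_on UNIV g" and \<alpha>: "1 \<le> \<alpha>"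
  shows "(\<integral>\<^sup>+x. ennreal (square_increment (subarc g x)) \<partial>weighted_box \<alpha>) \<le> gagliardo ((\<alpha> - 1) / 2) g"
proof -
  have "(\<lambda>x. square_increment (subarc g x)) \<in> borel_measurable borel"
    by (rule borel_measurable_continuous_onI[OF continuous_on_square_increment_subarc[OF g]])
  then have "(\<integral>\<^sup>+x. ennreal (square_increment (subarc g x)) \<partial>weighted_box \<alpha>) =
      (\<integral>\<^sup>+u\<in>{0..1}. (\<integral>\<^sup>+w\<in>{-1/2..1/2}. ennreal (\<bar>w\<bar> powr (-\<alpha>) * square_increment (subarc g (u, w))) \<partial>lborel) \<partial>lborel)"
    by (subst nn_integral_weighted_box) (simp_all add: ennreal_mult')
  also have "\<dots> \<le> gagliardo ((\<alpha> - 1) / 2) g"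
  proof -
    have exponent: "1 + 2 * ((\<alpha> - 1) / 2) = \<alpha>" by (simp add: field_simps)
    show ?thesis
      unfolding gagliardo_def exponent
      by (intro nn_integral_mono mult_right_mono nn_integral_square_increment_le[OF g \<alpha>]) simp
  qed
  finally show ?thesis .
qed

lemma chord_arc_density_measurable:
  fixes g :: "real \<Rightarrow> 'a::euclidean_space"
  assumes g: "continuous_on UNIV g"
  shows "(\<lambda>x. chord_arc_density \<alpha> (subarc g x)) \<in> borel_measurable borel"
proof -
  note [measurable] = borel_measurable_continuous_onI[OF continuous_on_mean_velocity_subarc[OF g]]
    borel_measurable_continuous_onI[OF continuous_on_mean_speed_subarc[OF g]]
  have [measurable]: "(\<lambda>x. g (fst x + snd x)) \<in> borel_measurable borel"
    "(\<lambda>x::real \<times> real. g (fst x)) \<in> borel_measurable borel"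
    by (intro borel_measurable_continuous_onI continuous_on_compose2[OF g _ subset_UNIV] continuous_intros)+
  show ?thesis unfolding chord_arc_density_def subarc_0 subarc_1 by measurable
qed

lemma chord_arc_density_deriv_measurable:
  fixes g k :: "real \<Rightarrow> 'a::euclidean_space"
  assumes g: "continuous_on UNIV g" "\<And>u. g u \<noteq> 0" and k: "continuous_on UNIV k"
  shows "(\<lambda>x. chord_arc_density_deriv \<alpha> (subarc g x) (subarc k x)) \<in> borel_measurable borel"
proof -
  note [measurable] = borel_measurable_continuous_onI[OF continuous_on_mean_velocity_subarc[OF g(1)]]
    borel_measurable_continuous_onI[OF continuous_on_mean_velocity_subarc[OF k]]
    borel_measurable_continuous_onI[OF continuous_on_mean_speed_subarc[OF g(1)]]
    borel_measurable_continuous_onI[OF continuous_on_mean_speed_deriv_subarc[OF g k]]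
  have [measurable]: "(\<lambda>x. g (fst x + snd x)) \<in> borel_measurable borel"
    "(\<lambda>x::real \<times> real. g (fst x)) \<in> borel_measurable borel"
    "(\<lambda>x. k (fst x + snd x)) \<in> borel_measurable borel" "(\<lambda>x::real \<times> real. k (fst x)) \<in> borel_measurable borel"
    by (intro borel_measurable_continuous_onI continuous_on_compose2[OF g(1) _ subset_UNIV]
        continuous_on_compose2[OF k _ subset_UNIV] continuous_intros)+
  show ?thesis unfolding chord_arc_density_deriv_def subarc_0 subarc_1 by measurable
qed

definition velocity_energy :: "real \<Rightarrow> (real \<Rightarrow> 'a::euclidean_space) \<Rightarrow> real" where
  "velocity_energy \<alpha> g = (\<integral>x. chord_arc_density \<alpha> (subarc g x) \<partial>weighted_box \<alpha>)
     - set_lebesgue_integral lborel {0..1} (\<lambda>u. wrap_defect \<alpha> (subarc g (u, 1)))"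

definition velocity_energy_deriv :: "real \<Rightarrow> (real \<Rightarrow> 'a::euclidean_space) \<Rightarrow> (real \<Rightarrow> 'a) \<Rightarrow> real" where
  "velocity_energy_deriv \<alpha> g k = (\<integral>x. chord_arc_density_deriv \<alpha> (subarc g x) (subarc k x) \<partial>weighted_box \<alpha>)
     - set_lebesgue_integral lborel {0..1} (\<lambda>u. wrap_defect_deriv \<alpha> (subarc g (u, 1)) (subarc k (u, 1)))"

lemma velocity_energy_deriv_scaleR:
  "velocity_energy_deriv \<alpha> g (\<lambda>u. c *\<^sub>R k u) = c * velocity_energy_deriv \<alpha> g k"
  by (simp add: velocity_energy_deriv_def subarc_scaleR chord_arc_density_deriv_scaleR
      wrap_defect_deriv_scaleR right_diff_distrib)

definition arc_variation ::
    "real \<Rightarrow> (real \<Rightarrow> 'a) \<Rightarrow> (real \<Rightarrow> 'a) \<Rightarrow> (real \<Rightarrow> 'a) \<Rightarrow> real \<times> real \<Rightarrow> 'a path_variation" where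
  "arc_variation \<nu> g f k x = Path_Variation \<nu> (subarc g x) (subarc f x) (subarc k x)"

lemma arc_variation_simps [simp]:
  "var_step (arc_variation \<nu> g f k x) = \<nu>" "var_dir (arc_variation \<nu> g f k x) = subarc k x"
  "varied_path (arc_variation \<nu> g f k x) True = subarc (\<lambda>u. g u + \<nu> *\<^sub>R f u) x"
  "varied_path (arc_variation \<nu> g f k x) False = subarc g x"
  by (simp_all add: arc_variation_def varied_path_def subarc_def fun_eq_iff)

lemma var_square_increment_arc_variation:
  "var_square_increment (arc_variation \<nu> g f k x) =
    square_increment (subarc g x) + square_increment (subarc f x) + square_increment (subarc k x)"
  by (simp add: var_square_increment_def arc_variation_def)

lemma arc_variation_mem:
  assumes g: "tame c C g" "tame c C (\<lambda>u. g u + \<nu> *\<^sub>R f u)"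
    and f: "unit_direction \<sigma> f" and k: "unit_direction \<sigma> k" and \<nu>: "0 \<le> \<nu>" "\<nu> \<le> 1"
  shows "arc_variation \<nu> g f k x \<in> path_variations c C"
    and "snd x \<in> {-1/2..1/2} \<Longrightarrow> arc_variation \<nu> g f k x \<in> chord_variations c C"
proof -
  let ?i = "arc_variation \<nu> g f k x"
  have path: "varied_path ?i t = subarc (if t then \<lambda>u. g u + \<nu> *\<^sub>R f u else g) x" for t
    by (cases t) simp_all
  have tame_t: "tame c C (if t then \<lambda>u. g u + \<nu> *\<^sub>R f u else g)" for t
    using g by simp
  have "c \<le> norm (varied_path ?i t s)" for t s
    using tameD(5)[OF tame_t[of t]] unfolding path by (simp add: subarc_def)
  moreover have "norm (subarc g x s) \<le> C" "norm (subarc f x s) \<le> 1" "norm (subarc k x s) \<le> 1" for s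
    using tameD(4)[OF g(1)] f k by (simp_all add: subarc_def unit_direction_def)
  moreover have "continuous_on {0..1} (subarc g x)" "continuous_on {0..1} (subarc f x)" "continuous_on {0..1} (subarc k x)"
    using tameD(1)[OF g(1)] f k unfolding unit_direction_def by (auto intro: continuous_on_subarc)
  ultimately show mem: "?i \<in> path_variations c C"
    using \<nu> unfolding path_variations_def arc_variation_def by simp
  show "?i \<in> chord_variations c C" if "snd x \<in> {-1/2..1/2}"
  proof -
    have "c \<le> norm (mean_velocity (varied_path ?i t))" for t
      using tameD(6)[OF tame_t that, of t "fst x"] unfolding path by simp
    then show ?thesis using mem by (simp add: chord_variations_def)
  qed
qed

lemma tame_nonzero: "0 < c \<Longrightarrow> tame c C g \<Longrightarrow> g u \<noteq> 0"
  using tameD(5)[of c C g u] by auto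

lemma tame_mean_speed_ge:
  assumes "tame c C g"
  shows "c \<le> mean_speed (subarc g x)"
  by (intro mean_speed_ge continuous_on_subarc[OF tameD(1)[OF assms]]) (auto simp: subarc_def tameD(5)[OF assms])

lemma wrap_halves:
  "subarc (subarc g (u, 1)) (0, 1/2) = subarc g (u, 1/2)"
  "subarc (subarc g (u, 1)) (1/2, 1/2) = subarc g (u + 1/2, 1/2)"
  by (simp_all add: subarc_subarc)

lemma continuous_on_half_arcs:
  assumes "continuous_on UNIV (\<lambda>x::real \<times> real. F x)"
  shows "continuous_on S (\<lambda>u. F (u, 1/2))" "continuous_on S (\<lambda>u. F (u + 1/2, 1/2))"
  by (rule continuous_on_compose2[OF assms _ subset_UNIV]; intro continuous_intros)+

lemma wrap_defect_continuous:
  assumes c: "0 < c" and g: "tame c C g"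
  shows "continuous_on S (\<lambda>u. wrap_defect \<alpha> (subarc g (u, 1)))"
proof -
  note speed = continuous_on_half_arcs[OF continuous_on_mean_speed_subarc[OF tameD(1)[OF g]]]
  have pos: "0 < mean_speed (subarc g x)" for x
    using tame_mean_speed_ge[OF g, of x] c by simp
  then have sum_pos: "0 < mean_speed (subarc g x) / 2 + mean_speed (subarc g y) / 2" for x y
    by (intro add_pos_pos divide_pos_pos) auto
  have cont: "continuous_on S g"
    using tameD(1)[OF g] continuous_on_subset by blast
  show ?thesis
    unfolding wrap_defect_def wrap_halves subarc_0 fst_conv wrap_term_def divide_inverse[of _ "\<alpha> - 1"]
    using pos sum_pos by (intro continuous_intros speed cont ballI) (auto simp: less_imp_neq[symmetric])
qed

lemma wrap_defect_deriv_continuous: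
  assumes c: "0 < c" and g: "tame c C g" and k: "continuous_on UNIV k"
  shows "continuous_on S (\<lambda>u. wrap_defect_deriv \<alpha> (subarc g (u, 1)) (subarc k (u, 1)))"
proof -
  note speed = continuous_on_half_arcs[OF continuous_on_mean_speed_subarc[OF tameD(1)[OF g]]]
    continuous_on_half_arcs[OF continuous_on_mean_speed_deriv_subarc[OF tameD(1)[OF g] tame_nonzero[OF c g] k]]
  have pos: "0 < mean_speed (subarc g x)" for x
    using tame_mean_speed_ge[OF g, of x] c by simp
  then have sum_pos: "0 < mean_speed (subarc g x) / 2 + mean_speed (subarc g y) / 2" for x y
    by (intro add_pos_pos divide_pos_pos) auto
  have cont: "continuous_on S g" "continuous_on S k"
    using tameD(1)[OF g] k continuous_on_subset by blast+
  show ?thesis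
    unfolding wrap_defect_deriv_def wrap_halves subarc_0 fst_conv wrap_term_deriv_def divide_inverse[of _ "\<alpha> - 1"]
    using pos sum_pos tame_nonzero[OF c g]
    by (intro continuous_intros speed cont ballI) (auto simp: less_imp_neq[symmetric])
qed

lemma set_integral_unit_bound:
  fixes f :: "real \<Rightarrow> real"
  assumes "continuous_on {0..1} f" "\<And>u. u \<in> {0..1} \<Longrightarrow> \<bar>f u\<bar> \<le> B"
  shows "\<bar>set_lebesgue_integral lborel {0..1} f\<bar> \<le> B"
  using set_borel_integral_eq_integral(2)[OF borel_integrable_atLeastAtMost'[OF assms(1)]]
    integral_bound[of 0 1 f B] assms by simp

lemma set_integral_unit_diff_bound:
  fixes f h :: "real \<Rightarrow> real"
  assumes f: "continuous_on {0..1} f" and h: "continuous_on {0..1} h" and "\<And>u. u \<in> {0..1} \<Longrightarrow> \<bar>f u - h u\<bar> \<le> B"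
  shows "\<bar>set_lebesgue_integral lborel {0..1} f - set_lebesgue_integral lborel {0..1} h\<bar> \<le> B"
  using set_integral_unit_bound[OF continuous_on_diff[OF f h] assms(3)]
  by (simp add: set_integral_diff(2) borel_integrable_atLeastAtMost' f h)

lemma first_order_error_bound:
  fixes \<phi> :: "real \<Rightarrow> real"
  assumes "\<And>t. t \<in> {0..\<nu>} \<Longrightarrow> (\<phi> has_real_derivative \<phi>' t) (at t within {0..\<nu>})"
    and "\<And>t. t \<in> {0..\<nu>} \<Longrightarrow> \<bar>\<phi>' t - \<phi>' 0\<bar> \<le> B" and "0 \<le> \<nu>"
  shows "\<bar>\<phi> \<nu> - \<phi> 0 - \<nu> * \<phi>' 0\<bar> \<le> B * \<nu>"
proof -
  have "norm ((\<phi> \<nu> - \<nu> * \<phi>' 0) - (\<phi> 0 - 0 * \<phi>' 0)) \<le> B * norm (\<nu> - 0)"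
    by (rule field_differentiable_bound[where S="{0..\<nu>}" and f'="\<lambda>t. \<phi>' t - \<phi>' 0"])
       (use assms in \<open>auto intro!: derivative_eq_intros\<close>)
  then show ?thesis using assms(3) by (simp add: algebra_simps)
qed

lemma mem_parameter_boxD: "x \<in> parameter_box \<Longrightarrow> snd x \<in> {-1/2..1/2}"
  by (auto simp: parameter_box_def)

definition increment_energy :: "real \<Rightarrow> (real \<Rightarrow> real^'n) \<Rightarrow> real" where
  "increment_energy \<alpha> g = enn2real (gagliardo ((\<alpha> - 1) / 2) g) + 2"

context
  fixes \<alpha> c C :: real and g :: "real \<Rightarrow> real^'n"
  assumes \<alpha>: "1 < \<alpha>" and c: "0 < c" and g: "tame c C g" and gagliardo_g: "gagliardo ((\<alpha> - 1) / 2) g < \<infinity>"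
begin

private abbreviation (input) unit :: "(real \<Rightarrow> real^'n) \<Rightarrow> bool" where
  "unit \<equiv> unit_direction ((\<alpha> - 1) / 2)"

private abbreviation (input) increments :: "(real \<Rightarrow> real^'n) \<Rightarrow> (real \<Rightarrow> real^'n) \<Rightarrow> real \<times> real \<Rightarrow> real" where
  "increments f k x \<equiv>
  square_increment (subarc g x) + square_increment (subarc f x) + square_increment (subarc k x)"


lemma unit_0: "unit (\<lambda>_. 0)"
  by (simp add: unit_direction_def periodic1_def gagliardo_0)

lemma unit_continuous: "unit k \<Longrightarrow> continuous_on UNIV k"
  by (simp add: unit_direction_def)

lemma nn_integral_increments_le:
  fixes f k :: "real \<Rightarrow> real^'n"
  assumes f: "unit f" and k: "unit k"
  shows "(\<integral>\<^sup>+x. ennreal (increments f k x) \<partial>weighted_box \<alpha>) \<le> ennreal (increment_energy \<alpha> g)"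
proof -
  let ?Q = "\<lambda>k x. ennreal (square_increment (subarc k x))"
  have cont: "continuous_on UNIV g" "continuous_on UNIV f" "continuous_on UNIV k"
    using tameD(1)[OF g] f k by (auto intro: unit_continuous)
  note [measurable] = cont[THEN continuous_on_square_increment_subarc, THEN borel_measurable_continuous_onI]
  have nonneg: "0 \<le> square_increment (subarc k x)" if "continuous_on UNIV k" for k :: "real \<Rightarrow> real^'n" and x
    by (intro square_increment_nonneg continuous_on_subarc[OF that]) simp
  have "(\<integral>\<^sup>+x. ennreal (increments f k x) \<partial>weighted_box \<alpha>) =
      (\<integral>\<^sup>+x. ?Q g x \<partial>weighted_box \<alpha>) + (\<integral>\<^sup>+x. ?Q f x \<partial>weighted_box \<alpha>) + (\<integral>\<^sup>+x. ?Q k x \<partial>weighted_box \<alpha>)"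
    using nonneg[OF cont(1)] nonneg[OF cont(2)] nonneg[OF cont(3)]
    by (simp add: nn_integral_add)
  also have "\<dots> \<le> gagliardo ((\<alpha> - 1) / 2) g + gagliardo ((\<alpha> - 1) / 2) f + gagliardo ((\<alpha> - 1) / 2) k"
    using cont \<alpha> by (intro add_mono nn_integral_weighted_square_increment_le) auto
  also have "\<dots> \<le> gagliardo ((\<alpha> - 1) / 2) g + 1 + 1"
    using f k by (intro add_mono) (auto simp: unit_direction_def)
  also have "\<dots> = ennreal (increment_energy \<alpha> g)"
    using gagliardo_g by (simp add: increment_energy_def ennreal_plus add.assoc)
  finally show ?thesis .
qed

lemma weighted_integral_bound:
  fixes f k :: "real \<Rightarrow> real^'n"
  assumes f: "unit f" and k: "unit k" and H[measurable]: "H \<in> borel_measurable borel" and L: "0 \<le> L"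
    and bound: "\<And>x. x \<in> parameter_box \<Longrightarrow> \<bar>H x\<bar> \<le> L * increments f k x"
  shows "integrable (weighted_box \<alpha>) H" "\<bar>\<integral>x. H x \<partial>weighted_box \<alpha>\<bar> \<le> L * increment_energy \<alpha> g"
proof -
  have bound_nonneg: "0 \<le> L * increment_energy \<alpha> g"
    using L by (simp add: increment_energy_def)
  have cont: "continuous_on UNIV (\<lambda>x. increments f k x)"
    using tameD(1)[OF g] f k
    by (intro continuous_intros continuous_on_square_increment_subarc) (auto intro: unit_continuous)
  note [measurable] = borel_measurable_continuous_onI[OF cont]
  have "(\<integral>\<^sup>+x. ennreal \<bar>H x\<bar> \<partial>weighted_box \<alpha>) \<le> (\<integral>\<^sup>+x. ennreal L * ennreal (increments f k x) \<partial>weighted_box \<alpha>)"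
  proof (rule nn_integral_mono_AE)
    show "AE x in weighted_box \<alpha>. ennreal \<bar>H x\<bar> \<le> ennreal L * ennreal (increments f k x)"
      using AE_weighted_box
    proof eventually_elim
      case (elim x)
      then show ?case using bound[of x] L by (simp add: ennreal_leI flip: ennreal_mult')
    qed
  qed
  also have "\<dots> = ennreal L * (\<integral>\<^sup>+x. ennreal (increments f k x) \<partial>weighted_box \<alpha>)"
    by (intro nn_integral_cmult) measurable
  also have "\<dots> \<le> ennreal L * ennreal (increment_energy \<alpha> g)"
    by (intro mult_left_mono nn_integral_increments_le f k) simp
  finally have norm_le: "(\<integral>\<^sup>+x. ennreal (norm (H x)) \<partial>weighted_box \<alpha>) \<le> ennreal (L * increment_energy \<alpha> g)"
    using L by (simp add: ennreal_mult')
  then show int: "integrable (weighted_box \<alpha>) H"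
    by (intro integrableI_bounded) (auto intro: le_less_trans)
  have "ennreal (\<integral>x. norm (H x) \<partial>weighted_box \<alpha>) \<le> ennreal (L * increment_energy \<alpha> g)"
    using norm_le nn_integral_eq_integral[OF integrable_norm[OF int]] by simp
  then have "(\<integral>x. norm (H x) \<partial>weighted_box \<alpha>) \<le> L * increment_energy \<alpha> g"
    using bound_nonneg by simp
  then show "\<bar>\<integral>x. H x \<partial>weighted_box \<alpha>\<bar> \<le> L * increment_energy \<alpha> g"
    using order_trans[OF integral_abs_bound[of "weighted_box \<alpha>" H]] by simp
qed

private abbreviation (input) varies :: "real \<Rightarrow> (real \<Rightarrow> real^'n) \<Rightarrow> (real \<Rightarrow> real^'n) \<Rightarrow> bool" where
  "varies \<nu> f k \<equiv>
  0 \<le> \<nu> \<and> \<nu> \<le> 1 \<and> unit f \<and> unit k \<and> tame c C (\<lambda>u. g u + \<nu> *\<^sub>R f u)"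

lemma varies_0: "unit k \<Longrightarrow> varies 0 (\<lambda>_. 0) k"
  using g unit_0 by simp

lemma weighted_integral_diff_bound:
  fixes f k :: "real \<Rightarrow> real^'n"
  assumes "unit f" "unit k" "F \<in> borel_measurable borel" "integrable (weighted_box \<alpha>) H" "0 \<le> L"
    and "\<And>x. x \<in> parameter_box \<Longrightarrow> \<bar>F x - H x\<bar> \<le> L * increments f k x"
  shows "\<bar>(\<integral>x. F x \<partial>weighted_box \<alpha>) - (\<integral>x. H x \<partial>weighted_box \<alpha>)\<bar> \<le> L * increment_energy \<alpha> g"
proof -
  have "H \<in> borel_measurable borel" using borel_measurable_integrable[OF assms(4)] by simp
  note difference = weighted_integral_bound[OF assms(1,2) borel_measurable_diff[OF assms(3) this] assms(5,6)]
  have "integrable (weighted_box \<alpha>) (\<lambda>x. (F x - H x) + H x)"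
    by (rule Bochner_Integration.integrable_add[OF difference(1) assms(4)])
  then show ?thesis using difference(2) assms(4) by simp
qed

lemma increments_nonneg: "unit f \<Longrightarrow> unit k \<Longrightarrow> 0 \<le> increments f k x"
  by (intro add_nonneg_nonneg square_increment_nonneg continuous_on_subarc[of UNIV] tameD(1)[OF g] unit_continuous) simp_all

lemma lip_arc_variation:
  fixes X :: "(real^'n) path_variation \<Rightarrow> bool \<Rightarrow> real"
  assumes X: "lip_family (chord_variations c C) var_step var_square_increment X"
  obtains K where "0 \<le> K"
    "\<And>\<nu> f k x t. varies \<nu> f k \<Longrightarrow> x \<in> parameter_box \<Longrightarrow> \<bar>X (arc_variation \<nu> g f k x) t\<bar> \<le> K * increments f k x"
    "\<And>\<nu> f k x. varies \<nu> f k \<Longrightarrow> x \<in> parameter_box \<Longrightarrow>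
      \<bar>X (arc_variation \<nu> g f k x) True - X (arc_variation \<nu> g f k x) False\<bar> \<le> (K * \<nu>) * increments f k x"
proof -
  obtain K where K: "0 \<le> K" "\<And>i t. i \<in> chord_variations c C \<Longrightarrow> norm (X i t) \<le> K * \<bar>var_square_increment i\<bar>"
    "\<And>i. i \<in> chord_variations c C \<Longrightarrow> norm (X i True - X i False) \<le> K * \<bar>var_step i * var_square_increment i\<bar>"
    using lip_familyE[OF X] by blast
  have square_increment: "\<bar>var_square_increment (arc_variation \<nu> g f k x)\<bar> = increments f k x"
    if "varies \<nu> f k" for \<nu> f k x
    using that increments_nonneg[of f k x] by (simp add: var_square_increment_arc_variation)
  show thesis
  proof (rule that[OF K(1)])
    fix \<nu> f k x t assume v: "varies \<nu> f k" and x: "x \<in> parameter_box"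
    have mem: "arc_variation \<nu> g f k x \<in> chord_variations c C"
      using v by (intro arc_variation_mem(2) g mem_parameter_boxD[OF x]) auto
    show "\<bar>X (arc_variation \<nu> g f k x) t\<bar> \<le> K * increments f k x"
      using K(2)[OF mem] square_increment[OF v] by simp
    show "\<bar>X (arc_variation \<nu> g f k x) True - X (arc_variation \<nu> g f k x) False\<bar> \<le> (K * \<nu>) * increments f k x"
      using K(3)[OF mem] square_increment[OF v] v by (simp add: abs_mult mult.assoc)
  qed
qed

lemma wrap_defect_deriv_bounds:
  obtains K where "0 \<le> K"
    "\<And>k u. unit k \<Longrightarrow> \<bar>wrap_defect_deriv \<alpha> (subarc g (u, 1)) (subarc k (u, 1))\<bar> \<le> K"
    "\<And>\<nu> f k u. varies \<nu> f k \<Longrightarrow> \<bar>wrap_defect_deriv \<alpha> (subarc (\<lambda>u. g u + \<nu> *\<^sub>R f u) (u, 1)) (subarc k (u, 1))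
      - wrap_defect_deriv \<alpha> (subarc g (u, 1)) (subarc k (u, 1))\<bar> \<le> K * \<nu>"
proof (rule lip_familyE[OF lip_wrap_defect_deriv[OF c, of C \<alpha>]])
  let ?X = "\<lambda>i t. wrap_defect_deriv \<alpha> (varied_path i t) (var_dir i)"
  fix K :: real assume K: "0 \<le> K"
    "\<And>(i :: (real^'n) path_variation) t. i \<in> path_variations c C \<Longrightarrow> norm (?X i t) \<le> K * \<bar>1\<bar>"
    "\<And>i :: (real^'n) path_variation. i \<in> path_variations c C \<Longrightarrow> norm (?X i True - ?X i False) \<le> K * \<bar>var_step i * 1\<bar>"
  have mem: "arc_variation \<nu> g f k (u, 1) \<in> path_variations c C" if "varies \<nu> f k" for \<nu> f k u
    using that by (intro arc_variation_mem(1)[OF g]) auto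
  show thesis
  proof (rule that[OF K(1)])
    show "\<bar>wrap_defect_deriv \<alpha> (subarc g (u, 1)) (subarc k (u, 1))\<bar> \<le> K" if "unit k" for k u
      using K(2)[OF mem[OF varies_0[OF that]], of u False] by simp
    show "\<bar>wrap_defect_deriv \<alpha> (subarc (\<lambda>u. g u + \<nu> *\<^sub>R f u) (u, 1)) (subarc k (u, 1))
        - wrap_defect_deriv \<alpha> (subarc g (u, 1)) (subarc k (u, 1))\<bar> \<le> K * \<nu>" if "varies \<nu> f k" for \<nu> f k u
      using K(3)[OF mem[OF that], of u] that by simp
  qed
qed

lemma chord_arc_density_deriv_bounds:
  obtains K where "0 \<le> K"
    "\<And>k x. unit k \<Longrightarrow> x \<in> parameter_box \<Longrightarrow>
      \<bar>chord_arc_density_deriv \<alpha> (subarc g x) (subarc k x)\<bar> \<le> K * increments (\<lambda>_. 0) k x"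
    "\<And>\<nu> f k x. varies \<nu> f k \<Longrightarrow> x \<in> parameter_box \<Longrightarrow>
      \<bar>chord_arc_density_deriv \<alpha> (subarc (\<lambda>u. g u + \<nu> *\<^sub>R f u) x) (subarc k x)
        - chord_arc_density_deriv \<alpha> (subarc g x) (subarc k x)\<bar> \<le> (K * \<nu>) * increments f k x"
proof (rule lip_arc_variation[OF lip_chord_arc_density_deriv[OF c, of C \<alpha>]])
  let ?X = "\<lambda>i t. chord_arc_density_deriv \<alpha> (varied_path i t) (var_dir i)"
  fix K :: real assume K: "0 \<le> K"
    "\<And>\<nu> f k x t. varies \<nu> f k \<Longrightarrow> x \<in> parameter_box \<Longrightarrow> \<bar>?X (arc_variation \<nu> g f k x) t\<bar> \<le> K * increments f k x"
    "\<And>\<nu> f k x. varies \<nu> f k \<Longrightarrow> x \<in> parameter_box \<Longrightarrow>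
      \<bar>?X (arc_variation \<nu> g f k x) True - ?X (arc_variation \<nu> g f k x) False\<bar> \<le> (K * \<nu>) * increments f k x"
  show thesis
  proof (rule that[OF K(1)])
    show "\<bar>chord_arc_density_deriv \<alpha> (subarc g x) (subarc k x)\<bar> \<le> K * increments (\<lambda>_. 0) k x"
      if "unit k" "x \<in> parameter_box" for k x
      using K(2)[OF varies_0[OF that(1)] that(2), of False] by simp
    show "\<bar>chord_arc_density_deriv \<alpha> (subarc (\<lambda>u. g u + \<nu> *\<^sub>R f u) x) (subarc k x)
        - chord_arc_density_deriv \<alpha> (subarc g x) (subarc k x)\<bar> \<le> (K * \<nu>) * increments f k x"
      if "varies \<nu> f k" "x \<in> parameter_box" for \<nu> f k x
      using K(3)[OF that] by simp
  qed
qed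

lemma integrable_chord_arc_density: "integrable (weighted_box \<alpha>) (\<lambda>x. chord_arc_density \<alpha> (subarc g x))"
proof (rule lip_arc_variation[OF lip_chord_arc_density[OF c, of C \<alpha>]])
  fix K :: real assume K: "0 \<le> K"
    "\<And>\<nu> f k x t. varies \<nu> f k \<Longrightarrow> x \<in> parameter_box \<Longrightarrow>
      \<bar>chord_arc_density \<alpha> (varied_path (arc_variation \<nu> g f k x) t)\<bar> \<le> K * increments f k x"
  have "\<bar>chord_arc_density \<alpha> (subarc g x)\<bar> \<le> K * increments (\<lambda>_. 0) (\<lambda>_. 0) x" if "x \<in> parameter_box" for x
    using K(2)[OF varies_0[OF unit_0] that, of False] by simp
  then show ?thesis
    by (rule weighted_integral_bound(1)[OF unit_0 unit_0 chord_arc_density_measurable[OF tameD(1)[OF g]] K(1)])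
qed

lemma integrable_chord_arc_density_deriv:
  assumes k: "unit k"
  shows "integrable (weighted_box \<alpha>) (\<lambda>x. chord_arc_density_deriv \<alpha> (subarc g x) (subarc k x))"
proof (rule chord_arc_density_deriv_bounds)
  fix K :: real assume K: "0 \<le> K" "\<And>k x. unit k \<Longrightarrow> x \<in> parameter_box \<Longrightarrow>
      \<bar>chord_arc_density_deriv \<alpha> (subarc g x) (subarc k x)\<bar> \<le> K * increments (\<lambda>_. 0) k x"
  show ?thesis
    by (intro weighted_integral_bound(1)[OF unit_0 k _ K(1)] K(2) k chord_arc_density_deriv_measurable
          tameD(1)[OF g] tame_nonzero[OF c g] unit_continuous)
qed

lemma velocity_energy_deriv_bound:
  obtains K where "\<And>k. unit k \<Longrightarrow> \<bar>velocity_energy_deriv \<alpha> g k\<bar> \<le> K"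
proof -
  obtain K K' where K: "0 \<le> K" "\<And>k x. unit k \<Longrightarrow> x \<in> parameter_box \<Longrightarrow>
      \<bar>chord_arc_density_deriv \<alpha> (subarc g x) (subarc k x)\<bar> \<le> K * increments (\<lambda>_. 0) k x"
    and K': "\<And>k u. unit k \<Longrightarrow> \<bar>wrap_defect_deriv \<alpha> (subarc g (u, 1)) (subarc k (u, 1))\<bar> \<le> K'"
    by (rule chord_arc_density_deriv_bounds, rule wrap_defect_deriv_bounds) (rule that)
  have "\<bar>velocity_energy_deriv \<alpha> g k\<bar> \<le> K * increment_energy \<alpha> g + K'" if k: "unit k" for k
  proof -
    have "\<bar>\<integral>x. chord_arc_density_deriv \<alpha> (subarc g x) (subarc k x) \<partial>weighted_box \<alpha>\<bar> \<le> K * increment_energy \<alpha> g"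
      by (intro weighted_integral_bound(2)[OF unit_0 k _ K(1)] K(2) k chord_arc_density_deriv_measurable
          tameD(1)[OF g] tame_nonzero[OF c g] unit_continuous)
    moreover have "\<bar>set_lebesgue_integral lborel {0..1}
        (\<lambda>u. wrap_defect_deriv \<alpha> (subarc g (u, 1)) (subarc k (u, 1)))\<bar> \<le> K'"
      by (intro set_integral_unit_bound wrap_defect_deriv_continuous[OF c g] unit_continuous K' k)
    ultimately show ?thesis unfolding velocity_energy_deriv_def by linarith
  qed
  then show thesis by (rule that)
qed

lemma velocity_energy_deriv_lipschitz:
  obtains K where "0 \<le> K" "\<And>\<nu> f k. varies \<nu> f k \<Longrightarrow>
    \<bar>velocity_energy_deriv \<alpha> (\<lambda>u. g u + \<nu> *\<^sub>R f u) k - velocity_energy_deriv \<alpha> g k\<bar> \<le> K * \<nu>"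
proof -
  obtain K K' where K: "0 \<le> K" "\<And>\<nu> f k x. varies \<nu> f k \<Longrightarrow> x \<in> parameter_box \<Longrightarrow>
      \<bar>chord_arc_density_deriv \<alpha> (subarc (\<lambda>u. g u + \<nu> *\<^sub>R f u) x) (subarc k x)
        - chord_arc_density_deriv \<alpha> (subarc g x) (subarc k x)\<bar> \<le> (K * \<nu>) * increments f k x"
    and K': "0 \<le> K'" "\<And>\<nu> f k u. varies \<nu> f k \<Longrightarrow>
      \<bar>wrap_defect_deriv \<alpha> (subarc (\<lambda>u. g u + \<nu> *\<^sub>R f u) (u, 1)) (subarc k (u, 1))
        - wrap_defect_deriv \<alpha> (subarc g (u, 1)) (subarc k (u, 1))\<bar> \<le> K' * \<nu>"
    by (rule chord_arc_density_deriv_bounds, rule wrap_defect_deriv_bounds) (rule that)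
  have "\<bar>velocity_energy_deriv \<alpha> (\<lambda>u. g u + \<nu> *\<^sub>R f u) k - velocity_energy_deriv \<alpha> g k\<bar>
      \<le> (K * increment_energy \<alpha> g + K') * \<nu>" if v: "varies \<nu> f k" for \<nu> f k
  proof -
    let ?g = "\<lambda>u. g u + \<nu> *\<^sub>R f u"
    let ?D = "\<lambda>g x. chord_arc_density_deriv \<alpha> (subarc g x) (subarc k x)"
    let ?W = "\<lambda>g u. wrap_defect_deriv \<alpha> (subarc g (u, 1)) (subarc k (u, 1))"
    have f: "unit f" and k: "unit k" and \<nu>: "0 \<le> \<nu>" and g': "tame c C ?g" using v by auto
    have "\<bar>(\<integral>x. ?D ?g x \<partial>weighted_box \<alpha>) - (\<integral>x. ?D g x \<partial>weighted_box \<alpha>)\<bar> \<le> K * \<nu> * increment_energy \<alpha> g"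
      using K(1) \<nu> by (intro weighted_integral_diff_bound[OF f k] K(2)[OF v] integrable_chord_arc_density_deriv k
          chord_arc_density_deriv_measurable tameD(1)[OF g'] tame_nonzero[OF c g'] unit_continuous) simp_all
    moreover have "\<bar>set_lebesgue_integral lborel {0..1} (?W ?g) - set_lebesgue_integral lborel {0..1} (?W g)\<bar> \<le> K' * \<nu>"
      by (intro set_integral_unit_diff_bound wrap_defect_deriv_continuous[OF c g'] wrap_defect_deriv_continuous[OF c g]
          unit_continuous k K'(2)[OF v])
    ultimately show ?thesis
      unfolding velocity_energy_deriv_def by (simp add: algebra_simps abs_le_iff)
  qed
  moreover have "0 \<le> K * increment_energy \<alpha> g + K'"
    using K(1) K'(1) by (simp add: increment_energy_def)
  ultimately show thesis using that by blast
qed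

private abbreviation (input) tame_line :: "real \<Rightarrow> (real \<Rightarrow> real^'n) \<Rightarrow> bool" where
  "tame_line \<nu> k \<equiv> 0 \<le> \<nu> \<and> \<nu> \<le> 1 \<and> unit k \<and> (\<forall>t\<in>{0..\<nu>}. tame c C (\<lambda>u. g u + t *\<^sub>R k u))"

lemma tame_line_varies: "tame_line \<nu> k \<Longrightarrow> t \<in> {0..\<nu>} \<Longrightarrow> varies t k k"
  by simp

lemma chord_arc_density_taylor:
  obtains K where "0 \<le> K" "\<And>\<nu> k x. tame_line \<nu> k \<Longrightarrow> x \<in> parameter_box \<Longrightarrow>
    \<bar>chord_arc_density \<alpha> (subarc (\<lambda>u. g u + \<nu> *\<^sub>R k u) x) - chord_arc_density \<alpha> (subarc g x)
      - \<nu> * chord_arc_density_deriv \<alpha> (subarc g x) (subarc k x)\<bar> \<le> (K * \<nu>\<^sup>2) * increments k k x"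
proof (rule chord_arc_density_deriv_bounds)
  fix K :: real assume K: "0 \<le> K" "\<And>\<nu> f k x. varies \<nu> f k \<Longrightarrow> x \<in> parameter_box \<Longrightarrow>
      \<bar>chord_arc_density_deriv \<alpha> (subarc (\<lambda>u. g u + \<nu> *\<^sub>R f u) x) (subarc k x)
        - chord_arc_density_deriv \<alpha> (subarc g x) (subarc k x)\<bar> \<le> (K * \<nu>) * increments f k x"
  show thesis
  proof (rule that[OF K(1)])
    fix \<nu> k x assume line: "tame_line \<nu> k" and x: "x \<in> parameter_box"
    let ?\<phi> = "\<lambda>t. chord_arc_density \<alpha> (subarc (\<lambda>u. g u + t *\<^sub>R k u) x)"
    let ?\<phi>' = "\<lambda>t. chord_arc_density_deriv \<alpha> (subarc (\<lambda>u. g u + t *\<^sub>R k u) x) (subarc k x)"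
    have k: "unit k" and \<nu>: "0 \<le> \<nu>" using line by simp_all
    have cont: "continuous_on {0..1} (subarc g x)" "continuous_on {0..1} (subarc k x)"
      using tameD(1)[OF g] unit_continuous[OF k] by (auto intro: continuous_on_subarc)
    have "\<bar>?\<phi> \<nu> - ?\<phi> 0 - \<nu> * ?\<phi>' 0\<bar> \<le> (K * \<nu> * increments k k x) * \<nu>"
    proof (rule first_order_error_bound[OF _ _ \<nu>])
      fix t assume t: "t \<in> {0..\<nu>}"
      have tame: "tame c C (\<lambda>u. g u + s *\<^sub>R k u)" if "s \<in> {0..\<nu>}" for s using line that by blast
      have "mean_velocity (subarc (\<lambda>u. g u + t *\<^sub>R k u) x) \<noteq> 0"
        using tameD(6)[OF tame[OF t] mem_parameter_boxD[OF x], of "fst x"] c by auto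
      then show "(?\<phi> has_real_derivative ?\<phi>' t) (at t within {0..\<nu>})"
        unfolding subarc_add_scaleR
        using tame_nonzero[OF c tame] t
        by (intro chord_arc_density_line_derivative cont) (auto simp: subarc_def)
      have "(K * t) * increments k k x \<le> (K * \<nu>) * increments k k x"
        using t K(1) by (intro mult_right_mono mult_left_mono increments_nonneg k) auto
      then show "\<bar>?\<phi>' t - ?\<phi>' 0\<bar> \<le> K * \<nu> * increments k k x"
        using K(2)[OF tame_line_varies[OF line t] x] by simp
    qed
    then show "\<bar>?\<phi> \<nu> - chord_arc_density \<alpha> (subarc g x)
      - \<nu> * chord_arc_density_deriv \<alpha> (subarc g x) (subarc k x)\<bar> \<le> (K * \<nu>\<^sup>2) * increments k k x"
      by (simp add: power2_eq_square mult_ac)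
  qed
qed

lemma wrap_defect_taylor:
  obtains K where "0 \<le> K" "\<And>\<nu> k u. tame_line \<nu> k \<Longrightarrow>
    \<bar>wrap_defect \<alpha> (subarc (\<lambda>u. g u + \<nu> *\<^sub>R k u) (u, 1)) - wrap_defect \<alpha> (subarc g (u, 1))
      - \<nu> * wrap_defect_deriv \<alpha> (subarc g (u, 1)) (subarc k (u, 1))\<bar> \<le> K * \<nu>\<^sup>2"
proof (rule wrap_defect_deriv_bounds)
  fix K :: real assume K: "0 \<le> K" "\<And>\<nu> f k u. varies \<nu> f k \<Longrightarrow>
      \<bar>wrap_defect_deriv \<alpha> (subarc (\<lambda>u. g u + \<nu> *\<^sub>R f u) (u, 1)) (subarc k (u, 1))
        - wrap_defect_deriv \<alpha> (subarc g (u, 1)) (subarc k (u, 1))\<bar> \<le> K * \<nu>"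
  show thesis
  proof (rule that[OF K(1)])
    fix \<nu> k u assume line: "tame_line \<nu> k"
    let ?\<phi> = "\<lambda>t. wrap_defect \<alpha> (subarc (\<lambda>u. g u + t *\<^sub>R k u) (u, 1))"
    let ?\<phi>' = "\<lambda>t. wrap_defect_deriv \<alpha> (subarc (\<lambda>u. g u + t *\<^sub>R k u) (u, 1)) (subarc k (u, 1))"
    have k: "unit k" and \<nu>: "0 \<le> \<nu>" using line by simp_all
    have cont: "continuous_on {0..1} (subarc g (u, 1))" "continuous_on {0..1} (subarc k (u, 1))"
      using tameD(1)[OF g] unit_continuous[OF k] by (auto intro: continuous_on_subarc)
    have "\<bar>?\<phi> \<nu> - ?\<phi> 0 - \<nu> * ?\<phi>' 0\<bar> \<le> (K * \<nu>) * \<nu>"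
    proof (rule first_order_error_bound[OF _ _ \<nu>])
      fix t assume t: "t \<in> {0..\<nu>}"
      have tame: "tame c C (\<lambda>u. g u + s *\<^sub>R k u)" if "s \<in> {0..\<nu>}" for s using line that by blast
      show "(?\<phi> has_real_derivative ?\<phi>' t) (at t within {0..\<nu>})"
        unfolding subarc_add_scaleR
        using tameD(5)[OF tame] t \<alpha>
        by (intro wrap_defect_line_derivative[OF cont c]) (auto simp: subarc_def)
      have "K * t \<le> K * \<nu>" using t K(1) by (intro mult_left_mono) auto
      then show "\<bar>?\<phi>' t - ?\<phi>' 0\<bar> \<le> K * \<nu>"
        using K(2)[OF tame_line_varies[OF line t], of u] by simp
    qed
    then show "\<bar>?\<phi> \<nu> - wrap_defect \<alpha> (subarc g (u, 1))
      - \<nu> * wrap_defect_deriv \<alpha> (subarc g (u, 1)) (subarc k (u, 1))\<bar> \<le> K * \<nu>\<^sup>2"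
      by (simp add: power2_eq_square mult_ac)
  qed
qed

lemma velocity_energy_taylor:
  obtains K where "0 \<le> K" "\<And>\<nu> k. tame_line \<nu> k \<Longrightarrow>
    \<bar>velocity_energy \<alpha> (\<lambda>u. g u + \<nu> *\<^sub>R k u) - velocity_energy \<alpha> g - \<nu> * velocity_energy_deriv \<alpha> g k\<bar> \<le> K * \<nu>\<^sup>2"
proof -
  obtain K K' where K: "0 \<le> K" "\<And>\<nu> k x. tame_line \<nu> k \<Longrightarrow> x \<in> parameter_box \<Longrightarrow>
    \<bar>chord_arc_density \<alpha> (subarc (\<lambda>u. g u + \<nu> *\<^sub>R k u) x) - chord_arc_density \<alpha> (subarc g x)
      - \<nu> * chord_arc_density_deriv \<alpha> (subarc g x) (subarc k x)\<bar> \<le> (K * \<nu>\<^sup>2) * increments k k x"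
    and K': "0 \<le> K'" "\<And>\<nu> k u. tame_line \<nu> k \<Longrightarrow>
    \<bar>wrap_defect \<alpha> (subarc (\<lambda>u. g u + \<nu> *\<^sub>R k u) (u, 1)) - wrap_defect \<alpha> (subarc g (u, 1))
      - \<nu> * wrap_defect_deriv \<alpha> (subarc g (u, 1)) (subarc k (u, 1))\<bar> \<le> K' * \<nu>\<^sup>2"
    by (rule chord_arc_density_taylor, rule wrap_defect_taylor) (rule that)
  have "\<bar>velocity_energy \<alpha> (\<lambda>u. g u + \<nu> *\<^sub>R k u) - velocity_energy \<alpha> g - \<nu> * velocity_energy_deriv \<alpha> g k\<bar>
      \<le> (K * increment_energy \<alpha> g + K') * \<nu>\<^sup>2" if line: "tame_line \<nu> k" for \<nu> k
  proof -
    let ?g = "\<lambda>u. g u + \<nu> *\<^sub>R k u"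
    let ?F = "\<lambda>g x. chord_arc_density \<alpha> (subarc g x)" and ?D = "\<lambda>x. chord_arc_density_deriv \<alpha> (subarc g x) (subarc k x)"
    let ?W = "\<lambda>g u. wrap_defect \<alpha> (subarc g (u, 1))"
    let ?V = "\<lambda>u. wrap_defect_deriv \<alpha> (subarc g (u, 1)) (subarc k (u, 1))"
    have k: "unit k" and g': "tame c C ?g" using line by auto
    note int = integrable_chord_arc_density integrable_chord_arc_density_deriv[OF k]
    note cont = wrap_defect_continuous[OF c g] wrap_defect_deriv_continuous[OF c g unit_continuous[OF k]]
    have "\<bar>(\<integral>x. ?F ?g x \<partial>weighted_box \<alpha>) - (\<integral>x. ?F g x + \<nu> * ?D x \<partial>weighted_box \<alpha>)\<bar> \<le> K * \<nu>\<^sup>2 * increment_energy \<alpha> g"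
      using K(1) K(2)[OF line] by (intro weighted_integral_diff_bound[OF k k] chord_arc_density_measurable tameD(1)[OF g']
          Bochner_Integration.integrable_add integrable_mult_right int) (simp_all add: algebra_simps)
    moreover have "\<bar>set_lebesgue_integral lborel {0..1} (?W ?g)
        - set_lebesgue_integral lborel {0..1} (\<lambda>u. ?W g u + \<nu> * ?V u)\<bar> \<le> K' * \<nu>\<^sup>2"
      using K'(2)[OF line] by (intro set_integral_unit_diff_bound wrap_defect_continuous[OF c g'] continuous_intros cont)
        (simp add: algebra_simps)
    moreover have "set_lebesgue_integral lborel {0..1} (\<lambda>u. ?W g u + \<nu> * ?V u)
        = set_lebesgue_integral lborel {0..1} (?W g) + \<nu> * set_lebesgue_integral lborel {0..1} ?V"
      by (simp add: set_integral_add(2) borel_integrable_atLeastAtMost' continuous_intros cont)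
    ultimately show ?thesis
      unfolding velocity_energy_deriv_def velocity_energy_def using int by (simp add: algebra_simps abs_le_iff)
  qed
  moreover have "0 \<le> K * increment_energy \<alpha> g + K'"
    using K(1) K'(1) by (simp add: increment_energy_def)
  ultimately show thesis using that by blast
qed

end

lemma velocity_energy_deriv_add_scaleR:
  assumes c: "0 < c" and g: "tame c C g" and h: "continuous_on UNIV h" "continuous_on UNIV h'"
    and int: "integrable (weighted_box \<alpha>) (\<lambda>x. chord_arc_density_deriv \<alpha> (subarc g x) (subarc h x))"
      "integrable (weighted_box \<alpha>) (\<lambda>x. chord_arc_density_deriv \<alpha> (subarc g x) (subarc h' x))"
  shows "velocity_energy_deriv \<alpha> g (\<lambda>u. h u + a *\<^sub>R h' u) = velocity_energy_deriv \<alpha> g h + a * velocity_energy_deriv \<alpha> g h'"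
proof -
  have cont: "continuous_on {0..1} (subarc g x)" "continuous_on {0..1} (subarc h x)"
    "continuous_on {0..1} (subarc h' x)" for x
    using tameD(1)[OF g] h by (auto intro: continuous_on_subarc)
  have nz: "subarc g x s \<noteq> 0" for x s
    using tame_nonzero[OF c g] by (simp add: subarc_def)
  have density: "chord_arc_density_deriv \<alpha> (subarc g x) (subarc (\<lambda>u. h u + a *\<^sub>R h' u) x)
      = chord_arc_density_deriv \<alpha> (subarc g x) (subarc h x) + a * chord_arc_density_deriv \<alpha> (subarc g x) (subarc h' x)" for x
    unfolding subarc_add_scaleR by (intro chord_arc_density_deriv_add_scaleR cont nz)
  have wrap: "wrap_defect_deriv \<alpha> (subarc g x) (subarc (\<lambda>u. h u + a *\<^sub>R h' u) x)
      = wrap_defect_deriv \<alpha> (subarc g x) (subarc h x) + a * wrap_defect_deriv \<alpha> (subarc g x) (subarc h' x)" for x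
    unfolding subarc_add_scaleR by (intro wrap_defect_deriv_add_scaleR cont nz)
  have "set_integrable lborel {0..1} (\<lambda>u. wrap_defect_deriv \<alpha> (subarc g (u, 1)) (subarc h (u, 1)))"
    "set_integrable lborel {0..1} (\<lambda>u. wrap_defect_deriv \<alpha> (subarc g (u, 1)) (subarc h' (u, 1)))"
    by (intro borel_integrable_atLeastAtMost' wrap_defect_deriv_continuous[OF c g] h)+
  then show ?thesis
    using int by (simp add: velocity_energy_deriv_def density wrap set_integral_add algebra_simps)
qed

section \<open>The energy as an integral of path functionals\<close>

lemma antiderivative_periodic_increment:
  fixes F :: "real \<Rightarrow> real"
  assumes F: "\<And>x. (F has_real_derivative f x) (at x)" and f: "periodic1 f"
  shows "F (x + 1) - F x = F 1 - F 0"
proof -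
  have "((\<lambda>x. F (x + 1)) has_real_derivative f x) (at x)" for x
    using F[of "x + 1"] f by (simp add: DERIV_shift periodic1_def)
  from DERIV_diff[OF this F] have "((\<lambda>x. F (x + 1) - F x) has_real_derivative 0) (at x)" for x by simp
  then have "F (x + 1) - F x = F (0 + 1) - F 0" by (intro DERIV_isconst_all allI)
  then show ?thesis by simp
qed

lemma DERIV_max_stationary:
  fixes F :: "real \<Rightarrow> real"
  assumes F: "\<And>y. m \<le> y \<Longrightarrow> y < b \<Longrightarrow> (F has_real_derivative F' y) (at y)" and stationary: "F' m = 0"
    and x: "x < b" "m < b"
  shows "((\<lambda>x. F (max x m)) has_real_derivative F' (max x m)) (at x)"
proof (cases x m rule: linorder_cases)
  case less
  then have "\<forall>\<^sub>F y in nhds x. y < m" using eventually_nhds_in_open[of "{..<m}" x] by simp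
  then have "\<forall>\<^sub>F y in nhds x. F (max y m) = F m" by eventually_elim simp
  then show ?thesis
    using less stationary DERIV_cong_ev[of x x "\<lambda>y. F (max y m)" "\<lambda>_. F m" 0 0] by simp
next
  case equal
  have "((\<lambda>y. (F y - F m) / (y - m)) \<longlongrightarrow> 0) (at m)"
    using F[OF order_refl x(2)] stationary by (simp add: has_field_derivative_iff)
  then have "((\<lambda>y. (F (max y m) - F m) / (y - m)) \<longlongrightarrow> 0) (at m)"
    by (rule Lim_null_comparison[rotated, OF tendsto_rabs_zero]) (auto simp: max_def divide_simps)
  then show ?thesis using equal stationary by (simp add: has_field_derivative_iff)
next
  case greater
  then have "\<forall>\<^sub>F y in nhds x. m < y" using eventually_nhds_in_open[of "{m<..}" x] by simp
  then have "\<forall>\<^sub>F y in nhds x. F (max y m) = F y" by eventually_elim simp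
  then show ?thesis
    using greater F[of x] x DERIV_cong_ev[of x x "\<lambda>y. F (max y m)" F "F' x" "F' x"] by simp
qed

text \<open>Folding at \<open>L / 2\<close> removes the kink of \<open>min x (L - x)\<close>: the antiderivative of the
  difference between the two powers is stationary there.\<close>

definition folded_antiderivative :: "real \<Rightarrow> real \<Rightarrow> real \<Rightarrow> real" where
  "folded_antiderivative \<alpha> L x = wrap_term \<alpha> 1 (max x (L / 2)) (L - max x (L / 2))"

lemma folded_antiderivative_has_derivative:
  assumes \<alpha>: "1 < \<alpha>" and L: "0 < L" and x: "x < L"
  shows "(folded_antiderivative \<alpha> L has_real_derivative min x (L - x) powr (-\<alpha>) - x powr (-\<alpha>)) (at x)"
proof -
  have deriv: "((\<lambda>y. wrap_term \<alpha> 1 y (L - y)) has_real_derivative (L - y) powr (-\<alpha>) - y powr (-\<alpha>)) (at y)"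
    if "L / 2 \<le> y" "y < L" for y
  proof -
    have "((\<lambda>y. wrap_term \<alpha> 1 y (L - y)) has_real_derivative wrap_term_deriv \<alpha> 1 y (L - y) 0 1 (-1)) (at y)"
      using that L \<alpha> by (intro wrap_term_has_derivative) (auto intro!: derivative_eq_intros)
    then show ?thesis by (simp add: wrap_term_deriv_def)
  qed
  have "((\<lambda>x. wrap_term \<alpha> 1 (max x (L / 2)) (L - max x (L / 2))) has_real_derivative
      (L - max x (L / 2)) powr (-\<alpha>) - max x (L / 2) powr (-\<alpha>)) (at x)"
    by (rule DERIV_max_stationary[OF deriv]) (use x L in auto)
  moreover have "(L - max x (L / 2)) powr (-\<alpha>) - max x (L / 2) powr (-\<alpha>) = min x (L - x) powr (-\<alpha>) - x powr (-\<alpha>)"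
    by (auto simp: max_def min_def)
  ultimately show ?thesis by (simp add: folded_antiderivative_def[abs_def])
qed

lemma folded_antiderivative_0: "0 \<le> L \<Longrightarrow> folded_antiderivative \<alpha> L 0 = 0"
  by (simp add: folded_antiderivative_def wrap_term_def)

lemma folded_antiderivative_sum:
  assumes "a + b = L"
  shows "folded_antiderivative \<alpha> L a + folded_antiderivative \<alpha> L b = wrap_term \<alpha> 1 a b"
proof -
  have half: "wrap_term \<alpha> 1 (L / 2) (L / 2) = 0" by (simp add: wrap_term_def)
  show ?thesis
  proof (cases "L / 2 \<le> a")
    case True
    then have "max a (L / 2) = a" "max b (L / 2) = L / 2" "L - a = b" using assms by auto
    then show ?thesis by (simp add: folded_antiderivative_def half)
  next
    case False
    then have "max a (L / 2) = L / 2" "max b (L / 2) = b" "L - b = a" using assms by auto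
    then show ?thesis by (simp add: folded_antiderivative_def half wrap_term_def add_ac)
  qed
qed

definition arc_excess :: "real \<Rightarrow> (real \<Rightarrow> real^'n) \<Rightarrow> real \<Rightarrow> real \<Rightarrow> real" where
  "arc_excess \<alpha> \<gamma> u w = (intr_dist \<gamma> u w powr (-\<alpha>) - arc_length \<gamma> u w powr (-\<alpha>))
     * (norm (velocity \<gamma> (u + w)) * norm (velocity \<gamma> u))"

context
  fixes \<gamma> g :: "real \<Rightarrow> real^'n" and S :: "real \<Rightarrow> real" and c C \<alpha> :: real
  assumes \<alpha>: "1 < \<alpha>" and c: "0 < c" and g: "tame c C g"
    and \<gamma>: "\<And>x. (\<gamma> has_vector_derivative g x) (at x)" "periodic1 \<gamma>"
    and S: "\<And>x. (S has_real_derivative norm (g x)) (at x)"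
begin

lemma velocity_eq: "velocity \<gamma> x = g x"
  by (rule vector_derivative_at[OF \<gamma>(1)])

lemma arc_function_diff: "S (u + w) - S u = w * mean_speed (subarc g (u, w))"
proof -
  have "S (u + w) - S u = w *\<^sub>R mean_velocity (subarc (\<lambda>x. norm (g x)) (u, w))"
    by (rule increment_eq_mean_velocity) (use S in \<open>simp add: has_real_derivative_iff_has_vector_derivative\<close>)
  then show ?thesis by (simp add: mean_velocity_def mean_speed_def subarc_def[abs_def])
qed

lemma arc_function_strict_mono:
  assumes "x < y"
  shows "S x < S y"
proof -
  have "0 < mean_speed (subarc g (x, y - x))" by (rule less_le_trans[OF c tame_mean_speed_ge[OF g]])
  then have "0 < (y - x) * mean_speed (subarc g (x, y - x))" using assms by simp
  then show ?thesis using arc_function_diff[of x "y - x"] by simp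
qed

lemma arc_function_integral: "x \<le> y \<Longrightarrow> integral {x..y} (\<lambda>t. norm (velocity \<gamma> t)) = S y - S x"
  unfolding velocity_eq using S
  by (intro integral_unique fundamental_theorem_of_calculus)
     (auto simp: has_real_derivative_iff_has_vector_derivative intro: has_vector_derivative_at_within)

lemma arc_function_add_1: "S (x + 1) = S x + curve_length \<gamma>"
proof -
  have "periodic1 (\<lambda>x. norm (g x))" using tameD(2)[OF g] by (simp add: periodic1_def)
  from antiderivative_periodic_increment[OF S this, of x] show ?thesis
    using arc_function_integral[of 0 1] by (simp add: curve_length_def)
qed

lemma curve_length_pos: "0 < curve_length \<gamma>"
  using arc_function_add_1[of 0] arc_function_strict_mono[of 0 1] by simp

lemma arc_length_eq: "arc_length \<gamma> u w = \<bar>S (u + w) - S u\<bar>"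
  using arc_function_strict_mono[of u "u + w"] arc_function_strict_mono[of "u + w" u]
  by (cases w "0 :: real" rule: linorder_cases) (simp_all add: arc_length_def arc_function_integral)

lemma arc_length_eq_mean_speed: "arc_length \<gamma> u w = \<bar>w\<bar> * mean_speed (subarc g (u, w))"
  using less_le_trans[OF c tame_mean_speed_ge[OF g, of "(u, w)"]]
  by (simp add: arc_length_eq arc_function_diff abs_mult)

lemma norm_chord_eq: "norm (\<gamma> (u + w) - \<gamma> u) = \<bar>w\<bar> * norm (mean_velocity (subarc g (u, w)))"
  by (simp add: increment_eq_mean_velocity[OF \<gamma>(1)])

lemma norm_chord_le_arc_length: "norm (\<gamma> (u + w) - \<gamma> u) \<le> arc_length \<gamma> u w"
  unfolding norm_chord_eq arc_length_eq_mean_speed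
  by (intro mult_left_mono norm_mean_velocity_le_mean_speed continuous_on_subarc[OF tameD(1)[OF g]]) simp_all

lemma norm_chord_le_intr_dist:
  assumes w: "w \<in> {-1/2..1/2}"
  shows "norm (\<gamma> (u + w) - \<gamma> u) \<le> intr_dist \<gamma> u w"
proof -
  have "norm (\<gamma> (u + w) - \<gamma> u) \<le> curve_length \<gamma> - arc_length \<gamma> u w"
  proof (cases "0 \<le> w")
    case True
    then have "arc_length \<gamma> (u + w) (1 - w) = curve_length \<gamma> - arc_length \<gamma> u w"
      using w arc_function_strict_mono[of "u + w" "u + 1"] arc_function_strict_mono[of u "u + w"] arc_function_add_1[of u]
      by (cases "w = 0") (simp_all add: arc_length_eq)
    moreover have "\<gamma> (u + 1) = \<gamma> u" using \<gamma>(2) by (simp add: periodic1_def)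
    ultimately show ?thesis
      using norm_chord_le_arc_length[of "u + w" "1 - w"] by (simp add: norm_minus_commute)
  next
    case False
    then have "arc_length \<gamma> u (w + 1) = curve_length \<gamma> - arc_length \<gamma> u w"
      using w arc_function_strict_mono[of "u + w" u] arc_function_strict_mono[of u "u + w + 1"]
        arc_function_add_1[of "u + w"]
      by (simp add: arc_length_eq add.assoc)
    moreover have "\<gamma> (u + (w + 1)) = \<gamma> (u + w)" using \<gamma>(2) unfolding periodic1_def by (metis add.assoc)
    ultimately show ?thesis using norm_chord_le_arc_length[of u "w + 1"] by simp
  qed
  then show ?thesis using norm_chord_le_arc_length by (simp add: intr_dist_def)
qed

lemma chord_nonzero:
  assumes "w \<in> {-1/2..1/2}" "w \<noteq> 0"
  shows "\<gamma> (u + w) \<noteq> \<gamma> u"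
  using tameD(6)[OF g assms(1), of u] c assms(2) norm_chord_eq[of u w] by auto

lemma ohara_integrand_plus_arc_excess:
  assumes w: "w \<in> {-1/2..1/2}" "w \<noteq> 0"
  shows "0 \<le> arc_excess \<alpha> \<gamma> u w"
    and "ohara_integrand \<alpha> \<gamma> u w + ennreal (arc_excess \<alpha> \<gamma> u w)
      = ennreal (\<bar>w\<bar> powr (-\<alpha>) * chord_arc_density \<alpha> (subarc g (u, w)))"
proof -
  let ?d = "norm (\<gamma> (u + w) - \<gamma> u)" and ?s = "norm (g (u + w)) * norm (g u)"
  have chord: "0 < ?d" "?d \<le> intr_dist \<gamma> u w"
    using chord_nonzero[OF w, of u] norm_chord_le_intr_dist[OF w(1)] by simp_all
  have "0 < intr_dist \<gamma> u w" by (rule less_le_trans[OF chord])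
  then have "arc_length \<gamma> u w powr (-\<alpha>) \<le> intr_dist \<gamma> u w powr (-\<alpha>)"
    using \<alpha> by (intro powr_mono2') (auto simp: intr_dist_def)
  moreover have "intr_dist \<gamma> u w powr (-\<alpha>) \<le> ?d powr (-\<alpha>)"
    using chord \<alpha> by (intro powr_mono2') auto
  ultimately have nonneg: "0 \<le> (?d powr (-\<alpha>) - intr_dist \<gamma> u w powr (-\<alpha>)) * ?s"
    and excess: "0 \<le> arc_excess \<alpha> \<gamma> u w" by (simp_all add: arc_excess_def)
  show "0 \<le> arc_excess \<alpha> \<gamma> u w" by (rule excess)
  have "0 < mean_speed (subarc g (u, w))" by (rule less_le_trans[OF c tame_mean_speed_ge[OF g]])
  then have "(?d powr (-\<alpha>) - intr_dist \<gamma> u w powr (-\<alpha>)) * ?s + arc_excess \<alpha> \<gamma> u w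
      = \<bar>w\<bar> powr (-\<alpha>) * chord_arc_density \<alpha> (subarc g (u, w))"
    unfolding arc_excess_def velocity_eq arc_length_eq_mean_speed norm_chord_eq chord_arc_density_def
    by (simp add: powr_mult algebra_simps)
  then show "ohara_integrand \<alpha> \<gamma> u w + ennreal (arc_excess \<alpha> \<gamma> u w)
      = ennreal (\<bar>w\<bar> powr (-\<alpha>) * chord_arc_density \<alpha> (subarc g (u, w)))"
    using nonneg excess chord(1) by (simp add: ohara_integrand_def velocity_eq mult.assoc flip: ennreal_plus)
qed

lemma arc_excess_has_antiderivative:
  assumes w: "0 \<le> z * w" "z * w \<le> 1/2" and z: "z \<in> {1, -1}"
  shows "((\<lambda>w. norm (g u) * folded_antiderivative \<alpha> (curve_length \<gamma>) (z * (S (u + w) - S u)))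
    has_vector_derivative z * arc_excess \<alpha> \<gamma> u w) (at w within A)"
proof -
  let ?L = "curve_length \<gamma>" and ?a = "z * (S (u + w) - S u)"
  have a: "arc_length \<gamma> u w = ?a"
    using w z arc_function_strict_mono[of u "u + w"] arc_function_strict_mono[of "u + w" u]
    by (cases w "0 :: real" rule: linorder_cases) (auto simp: arc_length_eq)
  have "-1 < w" "w < 1" using w z by auto
  then have "S u < S (u + w) + ?L" "S (u + w) < S u + ?L"
    using arc_function_strict_mono[of u "u + w + 1"] arc_function_strict_mono[of "u + w" "u + 1"]
    unfolding arc_function_add_1 by linarith+
  then have "?a < ?L" using z by auto
  from folded_antiderivative_has_derivative[OF \<alpha> curve_length_pos this]
  have folded: "(folded_antiderivative \<alpha> ?L has_real_derivative
      intr_dist \<gamma> u w powr (-\<alpha>) - arc_length \<gamma> u w powr (-\<alpha>)) (at ?a)"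
    by (simp add: intr_dist_def a)
  have "((\<lambda>w. S (u + w)) has_real_derivative norm (g (u + w)) * 1) (at w)"
    by (rule DERIV_chain2[OF S]) (auto intro!: derivative_eq_intros)
  then have "((\<lambda>w. z * (S (u + w) - S u)) has_real_derivative z * norm (g (u + w))) (at w)"
    by (auto intro!: derivative_eq_intros)
  from DERIV_cmult[OF DERIV_chain2[OF folded this], of "norm (g u)"]
  have "((\<lambda>w. norm (g u) * folded_antiderivative \<alpha> ?L (z * (S (u + w) - S u))) has_real_derivative
      z * arc_excess \<alpha> \<gamma> u w) (at w)"
    by (rule DERIV_cong) (simp add: arc_excess_def velocity_eq)
  then show ?thesis
    unfolding has_real_derivative_iff_has_vector_derivative by (rule has_vector_derivative_at_within)
qed

lemma arc_excess_integral:
  "(arc_excess \<alpha> \<gamma> u has_integral wrap_defect \<alpha> (subarc g (u, 1))) {-1/2..1/2}"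
proof -
  let ?L = "curve_length \<gamma>" and ?v = "norm (g u)"
  let ?G = "folded_antiderivative \<alpha> ?L"
  have arguments: "u - 1/2 + 1 = u + 1/2" "u + 1/2 + 1/2 = u + 1" by simp_all
  note shift = arc_function_add_1[of "u - 1/2", unfolded arguments(1)]
    and halves = arc_function_diff[of u "1/2"]
      arc_function_diff[of "u + 1/2" "1/2", unfolded arguments(2) arc_function_add_1]
  have half_speeds: "mean_speed (subarc g (u, 1/2)) / 2 = S (u + 1/2) - S u"
    "mean_speed (subarc g (u + 1/2, 1/2)) / 2 = S u - S (u - 1/2)"
    using halves shift by linarith+
  have "((\<lambda>w. 1 * arc_excess \<alpha> \<gamma> u w) has_integral
      ?v * ?G (1 * (S (u + 1/2) - S u)) - ?v * ?G (1 * (S (u + 0) - S u))) {0..1/2}"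
    by (intro fundamental_theorem_of_calculus arc_excess_has_antiderivative) auto
  moreover have "((\<lambda>w. -1 * arc_excess \<alpha> \<gamma> u w) has_integral
      ?v * ?G (-1 * (S (u + 0) - S u)) - ?v * ?G (-1 * (S (u + - (1/2)) - S u))) {- (1/2)..0}"
    by (intro fundamental_theorem_of_calculus arc_excess_has_antiderivative) auto
  ultimately have "(arc_excess \<alpha> \<gamma> u has_integral
      ?v * ?G (S u - S (u - 1/2)) + ?v * ?G (S (u + 1/2) - S u)) {- (1/2)..1/2}"
    using curve_length_pos by (intro has_integral_combine[where c=0])
      (auto simp: folded_antiderivative_0 dest: has_integral_neg)
  moreover have "?G (S u - S (u - 1/2)) + ?G (S (u + 1/2) - S u) = wrap_term \<alpha> 1 (S u - S (u - 1/2)) (S (u + 1/2) - S u)"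
    using shift by (intro folded_antiderivative_sum) linarith
  moreover have "wrap_defect \<alpha> (subarc g (u, 1)) = ?v * wrap_term \<alpha> 1 (S u - S (u - 1/2)) (S (u + 1/2) - S u)"
    unfolding wrap_defect_def wrap_halves half_speeds by (simp add: wrap_term_def add_ac)
  ultimately show ?thesis by (simp flip: distrib_left)
qed

lemma arc_excess_nonneg:
  assumes "w \<in> {-1/2..1/2}"
  shows "0 \<le> arc_excess \<alpha> \<gamma> u w"
proof (cases "w = 0")
  case True
  show ?thesis using True curve_length_pos by (simp add: arc_excess_def intr_dist_def arc_length_eq)
qed (use assms in \<open>rule ohara_integrand_plus_arc_excess(1)\<close>)

lemma wrap_defect_nonneg: "0 \<le> wrap_defect \<alpha> (subarc g (u, 1))"
  by (rule has_integral_nonneg[OF arc_excess_integral arc_excess_nonneg])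

lemma ohara_integrands_measurable [measurable]:
  assumes [measurable]: "f \<in> borel_measurable M" "h \<in> borel_measurable M"
  shows "(\<lambda>x. ohara_integrand \<alpha> \<gamma> (f x) (h x)) \<in> borel_measurable M"
    and "(\<lambda>x. arc_excess \<alpha> \<gamma> (f x) (h x)) \<in> borel_measurable M"
proof -
  have "continuous_on UNIV \<gamma>" "continuous_on UNIV S"
    by (intro continuous_at_imp_continuous_on ballI has_vector_derivative_continuous[OF \<gamma>(1)] DERIV_isCont[OF S])+
  note [measurable] = this[THEN borel_measurable_continuous_onI] borel_measurable_continuous_onI[OF tameD(1)[OF g]]
  show "(\<lambda>x. ohara_integrand \<alpha> \<gamma> (f x) (h x)) \<in> borel_measurable M" "(\<lambda>x. arc_excess \<alpha> \<gamma> (f x) (h x)) \<in> borel_measurable M"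
    unfolding ohara_integrand_def arc_excess_def intr_dist_def arc_length_eq velocity_eq by measurable
qed

lemma inner_OHara_add_wrap_defect:
  "(\<integral>\<^sup>+w\<in>{-1/2..1/2}. ohara_integrand \<alpha> \<gamma> u w \<partial>lborel) + ennreal (wrap_defect \<alpha> (subarc g (u, 1)))
    = (\<integral>\<^sup>+w\<in>{-1/2..1/2}. ennreal (\<bar>w\<bar> powr (-\<alpha>)) * ennreal (chord_arc_density \<alpha> (subarc g (u, w))) \<partial>lborel)"
proof -
  let ?I = "indicator {-1/2..1/2} :: real \<Rightarrow> ennreal"
  have "ennreal (wrap_defect \<alpha> (subarc g (u, 1))) = (\<integral>\<^sup>+w\<in>{-1/2..1/2}. ennreal (arc_excess \<alpha> \<gamma> u w) \<partial>lborel)"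
    by (rule nn_integral_has_integral_lebesgue'[OF arc_excess_nonneg arc_excess_integral, symmetric])
  then have "(\<integral>\<^sup>+w\<in>{-1/2..1/2}. ohara_integrand \<alpha> \<gamma> u w \<partial>lborel) + ennreal (wrap_defect \<alpha> (subarc g (u, 1)))
      = (\<integral>\<^sup>+w. ohara_integrand \<alpha> \<gamma> u w * ?I w + ennreal (arc_excess \<alpha> \<gamma> u w) * ?I w \<partial>lborel)"
    by (simp add: nn_integral_add)
  also have "\<dots> = (\<integral>\<^sup>+w\<in>{-1/2..1/2}. ennreal (\<bar>w\<bar> powr (-\<alpha>)) * ennreal (chord_arc_density \<alpha> (subarc g (u, w))) \<partial>lborel)"
  proof (rule nn_integral_cong_AE)
    have "AE w in lborel. w \<noteq> (0::real)" by (rule AE_lborel_singleton)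
    then show "AE w in lborel. ohara_integrand \<alpha> \<gamma> u w * ?I w + ennreal (arc_excess \<alpha> \<gamma> u w) * ?I w
        = ennreal (\<bar>w\<bar> powr (-\<alpha>)) * ennreal (chord_arc_density \<alpha> (subarc g (u, w))) * ?I w"
    proof eventually_elim
      case (elim w)
      then show ?case
        using ohara_integrand_plus_arc_excess(2)[of w u] by (simp add: ennreal_mult' indicator_def)
    qed
  qed
  finally show ?thesis .
qed

lemma OHara_add_wrap_defect:
  "OHara \<alpha> \<gamma> + (\<integral>\<^sup>+u\<in>{0..1}. ennreal (wrap_defect \<alpha> (subarc g (u, 1))) \<partial>lborel)
    = (\<integral>\<^sup>+x. ennreal (chord_arc_density \<alpha> (subarc g x)) \<partial>weighted_box \<alpha>)"
proof -
  note [measurable] = borel_measurable_continuous_onI[OF wrap_defect_continuous[OF c g]]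
  have "OHara \<alpha> \<gamma> + (\<integral>\<^sup>+u\<in>{0..1}. ennreal (wrap_defect \<alpha> (subarc g (u, 1))) \<partial>lborel)
      = (\<integral>\<^sup>+u\<in>{0..1}. ((\<integral>\<^sup>+w\<in>{-1/2..1/2}. ohara_integrand \<alpha> \<gamma> u w \<partial>lborel)
          + ennreal (wrap_defect \<alpha> (subarc g (u, 1)))) \<partial>lborel)"
    unfolding OHara_def distrib_right by (rule nn_integral_add[symmetric]) measurable
  also have "\<dots> = (\<integral>\<^sup>+x. ennreal (chord_arc_density \<alpha> (subarc g x)) \<partial>weighted_box \<alpha>)"
    unfolding inner_OHara_add_wrap_defect
    by (rule nn_integral_weighted_box[symmetric])
       (use chord_arc_density_measurable[OF tameD(1)[OF g]] in measurable)
  finally show ?thesis .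
qed

lemma OHara_eq_if_arc_function:
  assumes finite_gagliardo: "gagliardo ((\<alpha> - 1) / 2) g < \<infinity>"
  shows "OHara \<alpha> \<gamma> = ennreal (velocity_energy \<alpha> g)" "0 \<le> velocity_energy \<alpha> g"
proof -
  let ?F = "\<integral>x. chord_arc_density \<alpha> (subarc g x) \<partial>weighted_box \<alpha>"
  let ?W = "set_lebesgue_integral lborel {0..1} (\<lambda>u. wrap_defect \<alpha> (subarc g (u, 1)))"
  have nonneg: "AE x in weighted_box \<alpha>. 0 \<le> chord_arc_density \<alpha> (subarc g x)"
    using AE_weighted_box
  proof eventually_elim
    case (elim x)
    have "0 < norm (mean_velocity (subarc g x))"
      using less_le_trans[OF c tameD(6)[OF g mem_parameter_boxD, of x "fst x"]] elim by simp
    moreover have "norm (mean_velocity (subarc g x)) \<le> mean_speed (subarc g x)"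
      by (intro norm_mean_velocity_le_mean_speed continuous_on_subarc[OF tameD(1)[OF g]]) simp
    ultimately show ?case using \<alpha> by (simp add: chord_arc_density_def powr_mono2')
  qed
  have "(\<integral>\<^sup>+x. ennreal (chord_arc_density \<alpha> (subarc g x)) \<partial>weighted_box \<alpha>) = ennreal ?F"
    by (rule nn_integral_eq_integral[OF integrable_chord_arc_density[OF \<alpha> c g finite_gagliardo] nonneg])
  moreover have wrap: "((\<lambda>u. wrap_defect \<alpha> (subarc g (u, 1))) has_integral ?W) {0..1}"
    by (rule has_integral_set_lebesgue_lborel[OF wrap_defect_continuous[OF c g]])
  moreover note nn_integral_has_integral_lebesgue'[OF wrap_defect_nonneg wrap]
    has_integral_nonneg[OF wrap wrap_defect_nonneg]
  ultimately have sum: "OHara \<alpha> \<gamma> + ennreal ?W = ennreal ?F" and W: "0 \<le> ?W"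
    using OHara_add_wrap_defect by simp_all
  have "0 \<le> ?F" by (rule integral_nonneg_AE[OF nonneg])
  with sum W show "OHara \<alpha> \<gamma> = ennreal (velocity_energy \<alpha> g)" "0 \<le> velocity_energy \<alpha> g"
    unfolding velocity_energy_def by (cases "OHara \<alpha> \<gamma>"; simp flip: ennreal_plus)+
qed

end

lemma OHara_eq_velocity_energy:
  assumes \<alpha>: "1 < \<alpha>" and c: "0 < c" and g: "tame c C g" and finite_gagliardo: "gagliardo ((\<alpha> - 1) / 2) g < \<infinity>"
    and \<gamma>: "\<And>x. (\<gamma> has_vector_derivative g x) (at x)" "periodic1 \<gamma>"
  shows "OHara \<alpha> \<gamma> = ennreal (velocity_energy \<alpha> g)" "0 \<le> velocity_energy \<alpha> g"
proof -
  have speed: "continuous_on UNIV (\<lambda>x. norm (g x))" by (intro continuous_intros tameD(1)[OF g])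
  obtain S where "\<And>x. (S has_vector_derivative norm (g x)) (at x)"
    by (rule continuous_antiderivative[OF speed]) (rule that)
  from OHara_eq_if_arc_function[OF \<alpha> c g \<gamma> this[folded has_real_derivative_iff_has_vector_derivative] finite_gagliardo]
  show "OHara \<alpha> \<gamma> = ennreal (velocity_energy \<alpha> g)" "0 \<le> velocity_energy \<alpha> g" by blast+
qed

section \<open>Curves parametrized by arc length\<close>

lemma integral_periodic_translate:
  fixes f :: "real \<Rightarrow> real"
  assumes f: "continuous_on UNIV f" "periodic1 f"
  shows "((\<lambda>u. f (u + w)) has_integral integral {0..1} f) {0..1}"
proof -
  obtain F where "\<And>x. (F has_vector_derivative f x) (at x)"
    by (rule continuous_antiderivative[OF f(1)]) (rule that)
  note F = this[folded has_real_derivative_iff_has_vector_derivative]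
  then have deriv: "((\<lambda>u. F (u + w)) has_vector_derivative f (u + w)) (at u)" for u w
    by (simp flip: DERIV_shift has_real_derivative_iff_has_vector_derivative)
  have "((\<lambda>u. f (u + w)) has_integral F (1 + w) - F (0 + w)) {0..1}" for w
    by (rule fundamental_theorem_of_calculus[OF _ has_vector_derivative_at_within[OF deriv]]) simp
  from this[of w] integral_unique[OF this[of 0]] show ?thesis
    using antiderivative_periodic_increment[OF F f(2), of w] by (simp add: add.commute)
qed

lemma set_integral_odd:
  fixes q :: "real \<Rightarrow> real"
  assumes "\<And>w. - w \<in> W \<longleftrightarrow> w \<in> W" "\<And>w. q (- w) = - q w"
  shows "set_lebesgue_integral lborel W q = 0"
proof -
  have "set_lebesgue_integral lborel W q = (\<integral>w. indicator W (0 + (-1) * w) *\<^sub>R q (0 + (-1) * w) \<partial>lborel)"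
    unfolding set_lebesgue_integral_def using lborel_integral_real_affine[of "-1" "\<lambda>w. indicator W w *\<^sub>R q w" 0] by simp
  also have "\<dots> = - set_lebesgue_integral lborel W q"
    using assms by (simp add: set_lebesgue_integral_def indicator_def)
  finally show ?thesis by simp
qed

lemma set_integral_Times:
  fixes H :: "real \<times> real \<Rightarrow> real"
  assumes H: "set_integrable lborel (A \<times> B) H"
  shows "set_lebesgue_integral lborel (A \<times> B) H =
      set_lebesgue_integral lborel A (\<lambda>u. set_lebesgue_integral lborel B (\<lambda>w. H (u, w)))" (is ?fst)
    and "set_lebesgue_integral lborel (A \<times> B) H =
      set_lebesgue_integral lborel B (\<lambda>w. set_lebesgue_integral lborel A (\<lambda>u. H (u, w)))" (is ?snd)
    and "set_integrable lborel B (\<lambda>w. set_lebesgue_integral lborel A (\<lambda>u. H (u, w)))" (is ?integrable)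
proof -
  let ?H = "\<lambda>u w. indicator A u *\<^sub>R indicator B w *\<^sub>R H (u, w)"
  have prod: "indicator (A \<times> B) x *\<^sub>R H x = (case x of (u, w) \<Rightarrow> ?H u w)" for x
    by (auto simp: indicator_def split: prod.split)
  then have int: "integrable (lborel \<Otimes>\<^sub>M lborel) (\<lambda>(u, w). ?H u w)"
    using H by (simp add: set_integrable_def lborel_prod)
  have total: "set_lebesgue_integral lborel (A \<times> B) H = integral\<^sup>L (lborel \<Otimes>\<^sub>M lborel) (\<lambda>(u, w). ?H u w)"
    unfolding set_lebesgue_integral_def lborel_prod by (intro Bochner_Integration.integral_cong refl prod)
  have inner: "(\<integral>u. ?H u w \<partial>lborel) = indicator B w *\<^sub>R set_lebesgue_integral lborel A (\<lambda>u. H (u, w))" for w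
    by (simp add: set_lebesgue_integral_def mult.left_commute[of _ "indicator B w"])
  show ?fst unfolding total lborel_pair.integral_fst[OF int, symmetric] by (simp add: set_lebesgue_integral_def)
  show ?snd unfolding total lborel_pair.integral_snd[OF int, symmetric] inner by (simp add: set_lebesgue_integral_def)
  show ?integrable using lborel_pair.integrable_snd[OF int] unfolding inner set_integrable_def .
qed

definition cutoff :: "real \<Rightarrow> real set" where
  "cutoff \<epsilon> = {-1/2..-\<epsilon>} \<union> {\<epsilon>..1/2}"

lemma cutoff_uminus: "- w \<in> cutoff \<epsilon> \<longleftrightarrow> w \<in> cutoff \<epsilon>"
  by (auto simp: cutoff_def)

lemma compact_cutoff: "compact (cutoff \<epsilon>)"
  by (auto simp: cutoff_def intro: compact_Un)

lemma cutoffD: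
  assumes "0 < \<epsilon>" "w \<in> cutoff \<epsilon>"
  shows "w \<noteq> 0" "w \<in> {-1/2..1/2}"
  using assms by (auto simp: cutoff_def)

lemma weighted_box_truncated:
  assumes \<epsilon>: "0 < \<epsilon>" and H: "integrable (weighted_box \<alpha>) H"
  shows "set_integrable lborel ({0..1} \<times> cutoff \<epsilon>) (\<lambda>x. \<bar>snd x\<bar> powr (-\<alpha>) * H x)"
    and "(\<integral>x. indicator ({0..1} \<times> cutoff \<epsilon>) x * H x \<partial>weighted_box \<alpha>) =
      set_lebesgue_integral lborel ({0..1} \<times> cutoff \<epsilon>) (\<lambda>x. \<bar>snd x\<bar> powr (-\<alpha>) * H x)"
proof -
  let ?S = "{0..1} \<times> cutoff \<epsilon> :: (real \<times> real) set"
  let ?weight = "\<lambda>x :: real \<times> real. indicator parameter_box x * \<bar>snd x\<bar> powr (-\<alpha>)"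
  have [measurable]: "?S \<in> sets borel" by (intro borel_closed closed_Times compact_imp_closed compact_cutoff) simp
  have [measurable]: "H \<in> borel_measurable borel" using borel_measurable_integrable[OF H] by simp
  have box: "?S \<subseteq> parameter_box" using cutoffD[OF \<epsilon>] by (auto simp: parameter_box_def)
  have density: "weighted_box \<alpha> = density lborel (\<lambda>x. ennreal (?weight x))"
    unfolding weighted_box_def by (intro density_cong) (auto simp: indicator_def)
  have pointwise: "?weight x * (indicator ?S x * H x) = indicator ?S x *\<^sub>R (\<bar>snd x\<bar> powr (-\<alpha>) * H x)" for x
    using box by (auto simp: indicator_def)
  have "integrable (weighted_box \<alpha>) (\<lambda>x. indicator ?S x *\<^sub>R H x)"
    by (rule integrable_mult_indicator[OF _ H]) simp
  then show "set_integrable lborel ?S (\<lambda>x. \<bar>snd x\<bar> powr (-\<alpha>) * H x)"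
    unfolding density set_integrable_def pointwise[symmetric] by (subst (asm) integrable_density) auto
  show "(\<integral>x. indicator ?S x * H x \<partial>weighted_box \<alpha>) = set_lebesgue_integral lborel ?S (\<lambda>x. \<bar>snd x\<bar> powr (-\<alpha>) * H x)"
    unfolding density set_lebesgue_integral_def pointwise[symmetric] by (subst integral_density) auto
qed

lemma weighted_box_truncated_tendsto:
  fixes H :: "real \<times> real \<Rightarrow> real"
  assumes H: "integrable (weighted_box \<alpha>) H"
  shows "((\<lambda>\<epsilon>. \<integral>x. indicator ({0..1} \<times> cutoff \<epsilon>) x * H x \<partial>weighted_box \<alpha>) \<longlongrightarrow> (\<integral>x. H x \<partial>weighted_box \<alpha>)) (at_right 0)"
  unfolding filterlim_at_right_to_top
proof (rule integral_dominated_convergence_at_top[where w="\<lambda>x. \<bar>H x\<bar>"])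
  show "H \<in> borel_measurable (weighted_box \<alpha>)" "integrable (weighted_box \<alpha>) (\<lambda>x. \<bar>H x\<bar>)"
    using H by auto
  show "(\<lambda>x. indicator ({0..1} \<times> cutoff (inverse t)) x * H x) \<in> borel_measurable (weighted_box \<alpha>)" for t
  proof -
    have [measurable]: "{0..1} \<times> cutoff (inverse t) \<in> sets (borel :: (real \<times> real) measure)"
      by (intro borel_closed closed_Times compact_imp_closed compact_cutoff) simp
    show ?thesis using H by measurable
  qed
  show "\<forall>\<^sub>F t in at_top. AE x in weighted_box \<alpha>. norm (indicator ({0..1} \<times> cutoff (inverse t)) x * H x) \<le> \<bar>H x\<bar>"
    by (simp add: indicator_def)
  show "AE x in weighted_box \<alpha>. ((\<lambda>t. indicator ({0..1} \<times> cutoff (inverse t)) x * H x) \<longlongrightarrow> H x) at_top"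
    using AE_weighted_box
  proof eventually_elim
    case (elim x)
    have "\<forall>\<^sub>F t in at_top. inverse t < \<bar>snd x\<bar>"
      using elim by (intro order_tendstoD[OF tendsto_inverse_0_at_top[OF filterlim_ident]]) simp
    then have "\<forall>\<^sub>F t in at_top. indicator ({0..1} \<times> cutoff (inverse t)) x * H x = H x"
    proof eventually_elim
      case (elim t)
      then show ?case
        using \<open>x \<in> parameter_box \<and> snd x \<noteq> 0\<close> by (auto simp: parameter_box_def cutoff_def indicator_def)
    qed
    then show ?case by (rule tendsto_eventually)
  qed
qed

context
  fixes \<gamma> h g k :: "real \<Rightarrow> real^'n" and c C \<alpha> :: real
  assumes c: "0 < c" and g: "tame c C g" and \<gamma>: "\<And>x. (\<gamma> has_vector_derivative g x) (at x)" "periodic1 \<gamma>"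
    and k: "continuous_on UNIV k" and h: "\<And>x. (h has_vector_derivative k x) (at x)" "periodic1 h"
    and unit_speed: "\<And>u. norm (g u) = 1"
begin

private abbreviation (input) "gk \<equiv> \<lambda>u. g u \<bullet> k u"
private abbreviation (input) "weighted_density u w \<equiv>
  \<bar>w\<bar> powr (-\<alpha>) * chord_arc_density_deriv \<alpha> (subarc g (u, w)) (subarc k (u, w))"

lemma gk_continuous: "continuous_on UNIV gk" and gk_periodic: "periodic1 gk"
  using tameD(1,2)[OF g] k periodic1_derivative[OF h(2,1)] by (auto simp: periodic1_def intro!: continuous_intros)

lemma sgn_velocity: "sgn (g u) = g u"
  by (simp add: sgn_div_norm unit_speed)

lemma mean_speed_unit: "mean_speed (subarc g x) = 1"
  by (simp add: mean_speed_def subarc_def unit_speed)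

lemma mean_speed_deriv_unit: "mean_speed_deriv (subarc g x) (subarc k x) = integral {0..1} (subarc gk x)"
  by (simp add: mean_speed_deriv_def subarc_def[abs_def] sgn_velocity)

lemma wrap_defect_deriv_unit: "wrap_defect_deriv \<alpha> (subarc g (u, 1)) (subarc k (u, 1)) = 0"
  unfolding wrap_defect_deriv_def wrap_halves mean_speed_unit wrap_term_deriv_def by (simp add: algebra_simps)

lemma arc_unequal: "w \<in> {-1/2..1/2} \<Longrightarrow> w \<noteq> 0 \<Longrightarrow> \<gamma> (u + w) \<noteq> \<gamma> u"
  using tameD(6)[OF g, of w u] increment_eq_mean_velocity[OF \<gamma>(1), of u w] c by auto

lemma weighted_density_eq:
  assumes w: "w \<in> {-1/2..1/2}" "w \<noteq> 0"
  shows "weighted_density u w = dE_integrand \<alpha> \<gamma> h u w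
    + \<bar>w\<bar> powr (-\<alpha>) * (\<alpha> * (integral {0..1} (subarc gk (u, w)) - gk u) - (gk (u + w) - gk u))
    + norm (\<gamma> (u + w) - \<gamma> u) powr (-\<alpha>) * (gk (u + w) - gk u)"
proof -
  let ?D = "mean_velocity (subarc g (u, w))" and ?K = "mean_velocity (subarc k (u, w))"
  have D: "?D \<noteq> 0" using tameD(6)[OF g w(1), of u] c by auto
  have d: "\<gamma> (u + w) - \<gamma> u = w *\<^sub>R ?D" "h (u + w) - h u = w *\<^sub>R ?K"
    by (rule increment_eq_mean_velocity[OF \<gamma>(1)] increment_eq_mean_velocity[OF h(1)])+
  have velocities: "velocity \<gamma> u = g u" "velocity h u = k u"
    by (rule vector_derivative_at[OF \<gamma>(1)] vector_derivative_at[OF h(1)])+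
  have powr_neg: "x / y powr b = x * y powr (- b)" for x y b :: real by (simp add: powr_minus divide_inverse)
  have "w * w * \<bar>w\<bar> powr (- (\<alpha> + 2)) = \<bar>w\<bar> powr (-\<alpha>)"
    using w(2) by (simp add: powr_diff powr_numeral power2_eq_square)
  then have product: "(w *\<^sub>R ?D) \<bullet> (w *\<^sub>R ?K) * (\<bar>w\<bar> powr (- (\<alpha> + 2)) * norm ?D powr (- (\<alpha> + 2)))
      = \<bar>w\<bar> powr (-\<alpha>) * norm ?D powr (- (\<alpha> + 2)) * (?D \<bullet> ?K)"
    by (simp add: mult_ac)
  have dE: "dE_integrand \<alpha> \<gamma> h u w = \<bar>w\<bar> powr (-\<alpha>) * ((\<alpha> - 2) * gk u + 2 * norm ?D powr (-\<alpha>) * gk u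
      - \<alpha> * (norm ?D powr (- (\<alpha> + 2)) * (?D \<bullet> ?K)))"
    unfolding dE_integrand_def Let_def velocities d norm_scaleR powr_mult powr_neg mult.assoc product
    by (simp add: algebra_simps)
  have sgn: "norm ?D powr (-\<alpha> - 1) * (sgn ?D \<bullet> ?K) = norm ?D powr (- (\<alpha> + 2)) * (?D \<bullet> ?K)"
    using D by (simp add: sgn_div_norm powr_diff power2_eq_square field_simps powr_numeral)
  show ?thesis
    unfolding dE chord_arc_density_deriv_def mean_speed_unit mean_speed_deriv_unit sgn d norm_scaleR powr_mult
      subarc_0 subarc_1 fst_conv snd_conv unit_speed sgn_velocity
    by (simp add: algebra_simps)
qed

definition chord_moment :: "real \<Rightarrow> real" where
  "chord_moment w = integral {0..1} (\<lambda>u. norm (\<gamma> (u + w) - \<gamma> u) powr (-\<alpha>) * gk u)"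

lemma curves_continuous: "continuous_on UNIV \<gamma>" "continuous_on UNIV h"
  by (intro continuous_at_imp_continuous_on ballI has_vector_derivative_continuous[OF \<gamma>(1)]
      has_vector_derivative_continuous[OF h(1)])+

lemma chord_moment_has_integral:
  assumes w: "w \<in> {-1/2..1/2}" "w \<noteq> 0"
  shows "((\<lambda>u. norm (\<gamma> (u + w) - \<gamma> u) powr (-\<alpha>) * gk u) has_integral chord_moment w) {0..1}"
    and "((\<lambda>u. norm (\<gamma> (u + w) - \<gamma> u) powr (-\<alpha>) * gk (u + w)) has_integral chord_moment (- w)) {0..1}"
proof -
  have chord: "continuous_on UNIV (\<lambda>u. norm (\<gamma> (u + v) - \<gamma> u) powr (-\<alpha>) * gk u)" if "v \<in> {-1/2..1/2}" "v \<noteq> 0" for v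
    using arc_unequal[OF that]
    by (intro continuous_intros gk_continuous continuous_on_compose2[OF curves_continuous(1)]) auto
  have "continuous_on {0..1} (\<lambda>u. norm (\<gamma> (u + w) - \<gamma> u) powr (-\<alpha>) * gk u)"
    by (rule continuous_on_subset[OF chord[OF w] subset_UNIV])
  then show "((\<lambda>u. norm (\<gamma> (u + w) - \<gamma> u) powr (-\<alpha>) * gk u) has_integral chord_moment w) {0..1}"
    unfolding chord_moment_def by (intro integrable_integral integrable_continuous_real)
  have neg: "- w \<in> {-1/2..1/2}" "- w \<noteq> 0" using w by auto
  have "periodic1 (\<lambda>u. norm (\<gamma> (u + - w) - \<gamma> u) powr (-\<alpha>) * gk u)"
    using \<gamma>(2) gk_periodic unfolding periodic1_def by (metis add.assoc add.commute)
  from integral_periodic_translate[OF chord[OF neg] this, of w]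
  show "((\<lambda>u. norm (\<gamma> (u + w) - \<gamma> u) powr (-\<alpha>) * gk (u + w)) has_integral chord_moment (- w)) {0..1}"
    by (simp add: chord_moment_def norm_minus_commute)
qed

lemma arc_mean_has_integral:
  "((\<lambda>u. integral {0..1} (subarc gk (u, w))) has_integral integral {0..1} gk) {0..1}"
proof -
  have "continuous_on (cbox (0, 0) (1, 1)) (\<lambda>(u, s). gk (u + s * w))"
    unfolding split_def by (rule continuous_on_compose2[OF gk_continuous]) (auto intro!: continuous_intros)
  from integral_swap_continuous[OF this]
  have "integral {0..1} (\<lambda>u. integral {0..1} (subarc gk (u, w))) = integral {0..1} gk"
    using integral_periodic_translate[OF gk_continuous gk_periodic, THEN integral_unique] by (simp add: subarc_def[abs_def])
  moreover have "continuous_on {0..1} (\<lambda>u. integral {0..1} (subarc gk (u, w)))"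
    using continuous_on_mean_velocity_subarc[OF gk_continuous] unfolding mean_velocity_def
    by (rule continuous_on_compose2) (auto intro!: continuous_intros)
  note integrable_integral[OF integrable_continuous_real[OF this]]
  ultimately show ?thesis by simp
qed

lemma weighted_density_has_integral:
  assumes w: "w \<in> {-1/2..1/2}" "w \<noteq> 0" and dE: "(\<lambda>u. dE_integrand \<alpha> \<gamma> h u w) integrable_on {0..1}"
  shows "((\<lambda>u. weighted_density u w) has_integral
    integral {0..1} (\<lambda>u. dE_integrand \<alpha> \<gamma> h u w) + (chord_moment (- w) - chord_moment w)) {0..1}"
proof -
  have mean: "(gk has_integral integral {0..1} gk) {0..1}"
    using integral_periodic_translate[OF gk_continuous gk_periodic, of 0] by simp
  have "((\<lambda>u. dE_integrand \<alpha> \<gamma> h u w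
      + \<bar>w\<bar> powr (-\<alpha>) * (\<alpha> * (integral {0..1} (subarc gk (u, w)) - gk u) - (gk (u + w) - gk u))
      + (norm (\<gamma> (u + w) - \<gamma> u) powr (-\<alpha>) * gk (u + w) - norm (\<gamma> (u + w) - \<gamma> u) powr (-\<alpha>) * gk u))
    has_integral integral {0..1} (\<lambda>u. dE_integrand \<alpha> \<gamma> h u w)
      + \<bar>w\<bar> powr (-\<alpha>) * (\<alpha> * (integral {0..1} gk - integral {0..1} gk) - (integral {0..1} gk - integral {0..1} gk))
      + (chord_moment (- w) - chord_moment w)) {0..1}"
    by (intro has_integral_add has_integral_diff has_integral_mult_right integrable_integral dE arc_mean_has_integral mean
        integral_periodic_translate gk_continuous gk_periodic chord_moment_has_integral w)
  then show ?thesis by (simp add: weighted_density_eq[OF w] right_diff_distrib)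
qed

lemma weighted_density_continuous:
  assumes w: "w \<in> {-1/2..1/2}"
  shows "continuous_on {0..1} (\<lambda>u. weighted_density u w)"
proof -
  have arc: "continuous_on {0..1} (\<lambda>u. F (u, w))" if "continuous_on UNIV F" for F :: "real \<times> real \<Rightarrow> 'b::topological_space"
    by (rule continuous_on_compose2[OF that]) (auto intro!: continuous_intros)
  note means = arc[OF continuous_on_mean_velocity_subarc[OF tameD(1)[OF g]]] arc[OF continuous_on_mean_velocity_subarc[OF k]]
    arc[OF continuous_on_mean_speed_deriv_subarc[OF tameD(1)[OF g] tame_nonzero[OF c g] k]]
  have ends: "continuous_on {0..1} (\<lambda>u. f (u + w))" "continuous_on {0..1} f"
    if "continuous_on UNIV f" for f :: "real \<Rightarrow> real^'n"
    by (rule continuous_on_compose2[OF that]; auto intro!: continuous_intros)+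
  have "mean_velocity (subarc g (u, w)) \<noteq> 0" for u using tameD(6)[OF g w, of u] c by auto
  then show ?thesis
    unfolding chord_arc_density_deriv_def mean_speed_unit subarc_0 subarc_1 fst_conv snd_conv unit_speed sgn_velocity
    by (intro continuous_intros means ends[OF k] ends[OF tameD(1)[OF g]] ballI) auto
qed

lemma dE_integrand_continuous:
  assumes \<epsilon>: "0 < \<epsilon>"
  shows "continuous_on (S \<times> cutoff \<epsilon>) (\<lambda>x. dE_integrand \<alpha> \<gamma> h (fst x) (snd x))"
proof -
  have nz: "snd x \<noteq> 0" "\<gamma> (fst x + snd x) - \<gamma> (fst x) \<noteq> 0" if "x \<in> S \<times> cutoff \<epsilon>" for x
    using cutoffD[OF \<epsilon>] arc_unequal[of "snd x" "fst x"] that by (auto simp: mem_Times_iff)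
  have velocities: "velocity \<gamma> u = g u" "velocity h u = k u" for u
    by (rule vector_derivative_at[OF \<gamma>(1)] vector_derivative_at[OF h(1)])+
  have "continuous_on (S \<times> cutoff \<epsilon>) (\<lambda>x. f (fst x + snd x))" "continuous_on (S \<times> cutoff \<epsilon>) (\<lambda>x. f (fst x))"
    if "continuous_on UNIV f" for f :: "real \<Rightarrow> real^'n"
    by (rule continuous_on_compose2[OF that]; auto intro!: continuous_intros)+
  note cont = this[OF curves_continuous(1)] this[OF curves_continuous(2)] this(2)[OF tameD(1)[OF g]] this(2)[OF k]
  show ?thesis
    unfolding dE_integrand_def Let_def velocities using nz by (intro continuous_intros cont) auto
qed

lemma weighted_box_truncated_eq_Ieps:
  assumes \<epsilon>: "0 < \<epsilon>" and D: "integrable (weighted_box \<alpha>) (\<lambda>x. chord_arc_density_deriv \<alpha> (subarc g x) (subarc k x))"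
  shows "(\<integral>x. indicator ({0..1} \<times> cutoff \<epsilon>) x * chord_arc_density_deriv \<alpha> (subarc g x) (subarc k x) \<partial>weighted_box \<alpha>)
    = Ieps \<alpha> \<gamma> h \<epsilon>"
proof -
  let ?D = "\<lambda>x. \<bar>snd x\<bar> powr (-\<alpha>) * chord_arc_density_deriv \<alpha> (subarc g x) (subarc k x)"
  let ?E = "\<lambda>x. dE_integrand \<alpha> \<gamma> h (fst x) (snd x)"
  let ?period = "\<lambda>H w. set_lebesgue_integral lborel {0..1} (\<lambda>u. H (u, w)) :: real"
  let ?p = "\<lambda>w. chord_moment (- w) - chord_moment w"
  have E: "set_integrable lborel ({0..1} \<times> cutoff \<epsilon>) ?E"
    unfolding set_integrable_def using compact_cutoff
    by (intro borel_integrable_compact compact_Times dE_integrand_continuous \<epsilon>) auto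
  note Fubini_D = set_integral_Times[OF weighted_box_truncated(1)[OF \<epsilon> D]]
  note Fubini_E = set_integral_Times[OF E]
  have period: "?period ?D w - ?period ?E w = ?p w" if w: "w \<in> cutoff \<epsilon>" for w
  proof -
    have "continuous_on {0..1} (\<lambda>u. dE_integrand \<alpha> \<gamma> h u w)"
      using continuous_on_compose2[OF dE_integrand_continuous[OF \<epsilon>, of UNIV], of "{0..1}" "\<lambda>u. (u, w)"] w
      by (simp add: continuous_on_Pair image_subset_iff)
    note dE = borel_integrable_atLeastAtMost'[OF this] integrable_continuous_real[OF this]
    note w = cutoffD(2,1)[OF \<epsilon> w]
    note density = borel_integrable_atLeastAtMost'[OF weighted_density_continuous[OF w(1)]]
    show ?thesis
      using integral_unique[OF weighted_density_has_integral[OF w dE(2)]]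
      by (simp only: fst_conv snd_conv set_borel_integral_eq_integral(2)[OF dE(1)]
          set_borel_integral_eq_integral(2)[OF density] add_diff_cancel_left')
  qed
  have "set_lebesgue_integral lborel (cutoff \<epsilon>) (?period ?D) - set_lebesgue_integral lborel (cutoff \<epsilon>) (?period ?E)
      = set_lebesgue_integral lborel (cutoff \<epsilon>) (\<lambda>w. ?period ?D w - ?period ?E w)"
    by (rule set_integral_diff(2)[OF Fubini_D(3) Fubini_E(3), symmetric])
  also have "\<dots> = set_lebesgue_integral lborel (cutoff \<epsilon>) ?p"
    by (intro set_lebesgue_integral_cong allI impI period) (simp add: borel_compact compact_cutoff)
  also have "\<dots> = 0" by (rule set_integral_odd[OF cutoff_uminus]) simp
  finally have "set_lebesgue_integral lborel ({0..1} \<times> cutoff \<epsilon>) ?D = set_lebesgue_integral lborel ({0..1} \<times> cutoff \<epsilon>) ?E"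
    unfolding Fubini_D(2) Fubini_E(2) by simp
  then show ?thesis
    unfolding weighted_box_truncated(2)[OF \<epsilon> D] Fubini_E(1) by (simp add: Ieps_def cutoff_def)
qed

lemma Ieps_tendsto_velocity_energy_deriv:
  assumes D: "integrable (weighted_box \<alpha>) (\<lambda>x. chord_arc_density_deriv \<alpha> (subarc g x) (subarc k x))"
  shows "(Ieps \<alpha> \<gamma> h \<longlongrightarrow> velocity_energy_deriv \<alpha> g k) (at_right 0)"
proof (rule Lim_transform_eventually)
  show "((\<lambda>\<epsilon>. \<integral>x. indicator ({0..1} \<times> cutoff \<epsilon>) x * chord_arc_density_deriv \<alpha> (subarc g x) (subarc k x) \<partial>weighted_box \<alpha>)
      \<longlongrightarrow> velocity_energy_deriv \<alpha> g k) (at_right 0)"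
    using weighted_box_truncated_tendsto[OF D] by (simp add: velocity_energy_deriv_def wrap_defect_deriv_unit)
  show "\<forall>\<^sub>F \<epsilon> in at_right 0. (\<integral>x. indicator ({0..1} \<times> cutoff \<epsilon>) x *
      chord_arc_density_deriv \<alpha> (subarc g x) (subarc k x) \<partial>weighted_box \<alpha>) = Ieps \<alpha> \<gamma> h \<epsilon>"
    using eventually_at_right_less[of 0] by eventually_elim (rule weighted_box_truncated_eq_Ieps[OF _ D])
qed

end

section \<open>Continuous differentiability\<close>

definition OHara_deriv :: "real \<Rightarrow> (real \<Rightarrow> real^'n) \<Rightarrow> (real \<Rightarrow> real^'n) \<Rightarrow> real" where
  "OHara_deriv \<alpha> \<gamma> h = velocity_energy_deriv \<alpha> (velocity \<gamma>) (velocity h)"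

lemma small_radius:
  fixes s c K e :: real
  assumes "0 < s" "0 < c" "0 \<le> K" "0 < e"
  obtains \<delta> where "0 < \<delta>" "\<And>x. 0 \<le> x \<Longrightarrow> x < \<delta> \<Longrightarrow> s * x \<le> c \<and> K * x \<le> e"
proof
  show "0 < min (c / s) (e / (K + 1))" using assms by simp
  fix x assume x: "0 \<le> x" "x < min (c / s) (e / (K + 1))"
  then have "(K + 1) * x \<le> e" "s * x \<le> c" using assms by (simp_all add: field_simps)
  then show "s * x \<le> c \<and> K * x \<le> e" using x(1) by (simp add: algebra_simps)
qed

context
  fixes \<alpha> :: real
  assumes \<alpha>: "2 < \<alpha>"
begin

private abbreviation (input) "\<sigma> \<equiv> (\<alpha> - 1) / 2"
private abbreviation (input) "scaled_norm h \<equiv> sobolev_const ((\<alpha> - 1) / 2) * Hnorm ((\<alpha> - 1) / 2) h"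

lemma exponents: "1 < \<alpha>" "1/2 < \<sigma>"
  using \<alpha> by simp_all

lemma sobolev_const_pos: "0 < sobolev_const \<sigma>"
  using sobolev_const_ge[OF exponents(2)] by simp

lemma scaled_norm_nonneg: "0 \<le> scaled_norm h"
  using sobolev_const_pos Hnorm_nonneg[of \<sigma> h] by simp

lemma admissible_Hsob: "admissible \<sigma> \<gamma> \<Longrightarrow> Hsob \<sigma> \<gamma>"
  by (simp add: admissible_def)

lemma velocity_eq_add_unit_direction:
  fixes \<gamma> \<eta> :: "real \<Rightarrow> real^'n"
  assumes \<gamma>: "Hsob \<sigma> \<gamma>" and \<eta>: "Hsob \<sigma> \<eta>"
  obtains k where "unit_direction \<sigma> k" "velocity \<eta> = (\<lambda>u. velocity \<gamma> u + scaled_norm (\<lambda>x. \<eta> x - \<gamma> x) *\<^sub>R k u)"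
proof -
  obtain k where k: "unit_direction \<sigma> k" "velocity (\<lambda>x. \<eta> x - \<gamma> x) = (\<lambda>u. scaled_norm (\<lambda>x. \<eta> x - \<gamma> x) *\<^sub>R k u)"
    by (rule velocity_eq_scaled_unit_direction[OF exponents(2) Hsob_diff(1)[OF exponents(2) \<eta> \<gamma>]])
  have "velocity \<eta> u = velocity \<gamma> u + scaled_norm (\<lambda>x. \<eta> x - \<gamma> x) *\<^sub>R k u" for u
    using fun_cong[OF k(2), of u] fun_cong[OF Hsob_diff(2)[OF exponents(2) \<eta> \<gamma>], of u] by (simp add: algebra_simps)
  then show thesis using that[OF k(1)] by blast
qed

lemma admissible_tame_lines:
  fixes \<gamma> :: "real \<Rightarrow> real^'n"
  assumes \<gamma>: "admissible \<sigma> \<gamma>"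
  obtains c C where "0 < c" "c \<le> 1" "tame c C (velocity \<gamma>)"
    "\<And>k t. unit_direction \<sigma> k \<Longrightarrow> 0 \<le> t \<Longrightarrow> t \<le> c \<Longrightarrow> tame c C (\<lambda>u. velocity \<gamma> u + t *\<^sub>R k u)"
proof (rule admissible_tame_neighbourhood[OF exponents(2) \<gamma>])
  fix c C assume c: "0 < c" "c \<le> 1"
    and near: "\<And>g. continuous_on UNIV g \<Longrightarrow> periodic1 g \<Longrightarrow> (\<And>u. norm (g u - velocity \<gamma> u) \<le> c) \<Longrightarrow> tame c C g"
  note velocity = Hsob_has_velocity(2)[OF exponents(2) admissible_Hsob[OF \<gamma>]]
    Hsob_periodic(2)[OF exponents(2) admissible_Hsob[OF \<gamma>]]
  show thesis
  proof (rule that[OF c])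
    show "tame c C (velocity \<gamma>)" using c(1) by (intro near velocity) simp
    fix k :: "real \<Rightarrow> real^'n" and t :: real assume k: "unit_direction \<sigma> k" and t: "0 \<le> t" "t \<le> c"
    have "t * norm (k u) \<le> c * 1" for u
      using k t by (intro mult_mono) (auto simp: unit_direction_def)
    then show "tame c C (\<lambda>u. velocity \<gamma> u + t *\<^sub>R k u)"
      using k t velocity by (intro near) (auto simp: unit_direction_def periodic1_def intro!: continuous_intros)
  qed
qed

lemma admissible_open:
  fixes \<gamma> :: "real \<Rightarrow> real^'n"
  assumes \<gamma>: "admissible \<sigma> \<gamma>"
  shows "\<exists>\<delta>>0. \<forall>\<eta>. Hsob \<sigma> \<eta> \<and> Hnorm \<sigma> (\<lambda>x. \<eta> x - \<gamma> x) < \<delta> \<longrightarrow> admissible \<sigma> \<eta>"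
proof -
  obtain c C where c: "0 < c" and tame: "\<And>k t. unit_direction \<sigma> k \<Longrightarrow> 0 \<le> t \<Longrightarrow> t \<le> c \<Longrightarrow> tame c C (\<lambda>u. velocity \<gamma> u + t *\<^sub>R k u)"
    by (rule admissible_tame_lines[OF \<gamma>]) (rule that)
  show ?thesis
  proof (intro exI[of _ "c / sobolev_const \<sigma>"] conjI allI impI)
    fix \<eta> assume "Hsob \<sigma> \<eta> \<and> Hnorm \<sigma> (\<lambda>x. \<eta> x - \<gamma> x) < c / sobolev_const \<sigma>"
    then have \<eta>: "Hsob \<sigma> \<eta>" and small: "scaled_norm (\<lambda>x. \<eta> x - \<gamma> x) \<le> c"
      using sobolev_const_pos by (simp_all add: field_simps)
    obtain k where k: "unit_direction \<sigma> k" "velocity \<eta> = (\<lambda>u. velocity \<gamma> u + scaled_norm (\<lambda>x. \<eta> x - \<gamma> x) *\<^sub>R k u)"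
      by (rule velocity_eq_add_unit_direction[OF admissible_Hsob[OF \<gamma>] \<eta>])
    have "tame c C (velocity \<eta>)" unfolding k(2) by (rule tame[OF k(1) scaled_norm_nonneg small])
    then show "admissible \<sigma> \<eta>" by (intro nondegenerate_imp_admissible[OF exponents(2) \<eta> c] tameD(3))
  qed (use c sobolev_const_pos in simp)
qed

lemma OHara_eq_tame:
  fixes \<gamma> :: "real \<Rightarrow> real^'n"
  assumes \<gamma>: "Hsob \<sigma> \<gamma>" and c: "0 < c" "tame c C (velocity \<gamma>)"
  shows "OHara \<alpha> \<gamma> < \<infinity>" "enn2real (OHara \<alpha> \<gamma>) = velocity_energy \<alpha> (velocity \<gamma>)"
  using OHara_eq_velocity_energy[OF exponents(1) c gagliardo_velocity_finite[OF exponents(2) \<gamma>]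
      Hsob_has_velocity(1)[OF exponents(2) \<gamma>] Hsob_periodic(1)[OF exponents(2) \<gamma>]] by simp_all

lemma OHara_finite:
  fixes \<gamma> :: "real \<Rightarrow> real^'n"
  assumes \<gamma>: "admissible \<sigma> \<gamma>"
  shows "OHara \<alpha> \<gamma> < \<infinity>"
proof -
  obtain c C where "0 < c" "tame c C (velocity \<gamma>)" by (rule admissible_tame_lines[OF \<gamma>])
  then show ?thesis by (rule OHara_eq_tame(1)[OF admissible_Hsob[OF \<gamma>]])
qed

lemma integrable_density_deriv_velocity:
  fixes \<gamma> h :: "real \<Rightarrow> real^'n"
  assumes \<gamma>: "Hsob \<sigma> \<gamma>" and c: "0 < c" "tame c C (velocity \<gamma>)" and h: "Hsob \<sigma> h"
  shows "integrable (weighted_box \<alpha>) (\<lambda>x. chord_arc_density_deriv \<alpha> (subarc (velocity \<gamma>) x) (subarc (velocity h) x))"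
proof -
  obtain k where k: "unit_direction \<sigma> k" "velocity h = (\<lambda>u. scaled_norm h *\<^sub>R k u)"
    by (rule velocity_eq_scaled_unit_direction[OF exponents(2) h])
  show ?thesis
    unfolding k(2) subarc_scaleR chord_arc_density_deriv_scaleR
    by (intro integrable_mult_right
        integrable_chord_arc_density_deriv[OF exponents(1) c gagliardo_velocity_finite[OF exponents(2) \<gamma>] k(1)])
qed

lemma OHara_deriv_add_scaleR:
  fixes \<gamma> h1 h2 :: "real \<Rightarrow> real^'n"
  assumes \<gamma>: "admissible \<sigma> \<gamma>" and h: "Hsob \<sigma> h1" "Hsob \<sigma> h2"
  shows "OHara_deriv \<alpha> \<gamma> (\<lambda>x. h1 x + a *\<^sub>R h2 x) = OHara_deriv \<alpha> \<gamma> h1 + a * OHara_deriv \<alpha> \<gamma> h2"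
proof -
  obtain c C where c: "0 < c" "tame c C (velocity \<gamma>)" by (rule admissible_tame_lines[OF \<gamma>])
  show ?thesis
    unfolding OHara_deriv_def Hsob_add_scaleR(2)[OF exponents(2) h]
    by (intro velocity_energy_deriv_add_scaleR[OF c] integrable_density_deriv_velocity[OF admissible_Hsob[OF \<gamma>] c]
        Hsob_has_velocity(2)[OF exponents(2)] h)
qed

lemma OHara_deriv_bounded:
  fixes \<gamma> :: "real \<Rightarrow> real^'n"
  assumes \<gamma>: "admissible \<sigma> \<gamma>"
  shows "\<exists>C. \<forall>h. Hsob \<sigma> h \<longrightarrow> \<bar>OHara_deriv \<alpha> \<gamma> h\<bar> \<le> C * Hnorm \<sigma> h"
proof -
  obtain c C where c: "0 < c" "tame c C (velocity \<gamma>)" by (rule admissible_tame_lines[OF \<gamma>])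
  obtain K where K: "\<And>k. unit_direction \<sigma> k \<Longrightarrow> \<bar>velocity_energy_deriv \<alpha> (velocity \<gamma>) k\<bar> \<le> K"
    by (rule velocity_energy_deriv_bound[OF exponents(1) c gagliardo_velocity_finite[OF exponents(2) admissible_Hsob[OF \<gamma>]]])
       (rule that)
  have "\<bar>OHara_deriv \<alpha> \<gamma> h\<bar> \<le> (sobolev_const \<sigma> * K) * Hnorm \<sigma> h" if h: "Hsob \<sigma> h" for h
  proof -
    obtain k where k: "unit_direction \<sigma> k" "velocity h = (\<lambda>u. scaled_norm h *\<^sub>R k u)"
      by (rule velocity_eq_scaled_unit_direction[OF exponents(2) h])
    have "\<bar>OHara_deriv \<alpha> \<gamma> h\<bar> = scaled_norm h * \<bar>velocity_energy_deriv \<alpha> (velocity \<gamma>) k\<bar>"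
      by (simp only: OHara_deriv_def k(2) velocity_energy_deriv_scaleR
          abs_mult[of "scaled_norm h"] abs_of_nonneg[OF scaled_norm_nonneg])
    also have "\<dots> \<le> scaled_norm h * K" by (rule mult_left_mono[OF K[OF k(1)] scaled_norm_nonneg])
    finally show ?thesis by (simp add: mult_ac)
  qed
  then show ?thesis by blast
qed

lemma OHara_frechet_differentiable:
  fixes \<gamma> :: "real \<Rightarrow> real^'n"
  assumes \<gamma>: "admissible \<sigma> \<gamma>" and e: "0 < e"
  shows "\<exists>\<delta>>0. \<forall>h. Hsob \<sigma> h \<and> Hnorm \<sigma> h < \<delta> \<longrightarrow>
    \<bar>enn2real (OHara \<alpha> (\<lambda>x. \<gamma> x + h x)) - enn2real (OHara \<alpha> \<gamma>) - OHara_deriv \<alpha> \<gamma> h\<bar> \<le> e * Hnorm \<sigma> h"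
proof -
  note H = admissible_Hsob[OF \<gamma>]
  obtain c C where c: "0 < c" "c \<le> 1" "tame c C (velocity \<gamma>)"
    and lines: "\<And>k t. unit_direction \<sigma> k \<Longrightarrow> 0 \<le> t \<Longrightarrow> t \<le> c \<Longrightarrow> tame c C (\<lambda>u. velocity \<gamma> u + t *\<^sub>R k u)"
    by (rule admissible_tame_lines[OF \<gamma>]) (rule that)
  obtain K where K: "0 \<le> K"
    "\<And>\<nu> k. 0 \<le> \<nu> \<and> \<nu> \<le> 1 \<and> unit_direction \<sigma> k \<and> (\<forall>t\<in>{0..\<nu>}. tame c C (\<lambda>u. velocity \<gamma> u + t *\<^sub>R k u)) \<Longrightarrow>
      \<bar>velocity_energy \<alpha> (\<lambda>u. velocity \<gamma> u + \<nu> *\<^sub>R k u) - velocity_energy \<alpha> (velocity \<gamma>)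
        - \<nu> * velocity_energy_deriv \<alpha> (velocity \<gamma>) k\<bar> \<le> K * \<nu>\<^sup>2"
    by (rule velocity_energy_taylor[OF exponents(1) c(1,3) gagliardo_velocity_finite[OF exponents(2) H]]) (rule that)
  have "0 \<le> K * (sobolev_const \<sigma>)\<^sup>2" using K(1) by simp
  then obtain \<delta> where \<delta>: "0 < \<delta>"
    "\<And>x. 0 \<le> x \<Longrightarrow> x < \<delta> \<Longrightarrow> sobolev_const \<sigma> * x \<le> c \<and> K * (sobolev_const \<sigma>)\<^sup>2 * x \<le> e"
    using small_radius[OF sobolev_const_pos c(1) _ e] by metis
  show ?thesis
  proof (intro exI[of _ \<delta>] conjI \<delta>(1) allI impI)
    fix h :: "real \<Rightarrow> real^'n" assume "Hsob \<sigma> h \<and> Hnorm \<sigma> h < \<delta>"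
    then have h: "Hsob \<sigma> h" and small: "scaled_norm h \<le> c" "K * (sobolev_const \<sigma>)\<^sup>2 * Hnorm \<sigma> h \<le> e"
      using \<delta>(2)[OF Hnorm_nonneg[of \<sigma> h]] by auto
    obtain k where k: "unit_direction \<sigma> k" "velocity h = (\<lambda>u. scaled_norm h *\<^sub>R k u)"
      by (rule velocity_eq_scaled_unit_direction[OF exponents(2) h])
    note sum = Hsob_add[OF exponents(2) H h]
    have line: "tame c C (\<lambda>u. velocity \<gamma> u + t *\<^sub>R k u)" if "t \<in> {0..scaled_norm h}" for t
      using that small(1) by (intro lines k(1)) auto
    have end_point: "velocity (\<lambda>x. \<gamma> x + h x) = (\<lambda>u. velocity \<gamma> u + scaled_norm h *\<^sub>R k u)"
      using fun_cong[OF k(2)] by (simp add: sum(2))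
    have "tame c C (velocity (\<lambda>x. \<gamma> x + h x))"
      unfolding end_point by (rule lines[OF k(1) scaled_norm_nonneg small(1)])
    note energies = OHara_eq_tame(2)[OF sum(1) c(1) this] OHara_eq_tame(2)[OF H c(1,3)]
    have "\<bar>enn2real (OHara \<alpha> (\<lambda>x. \<gamma> x + h x)) - enn2real (OHara \<alpha> \<gamma>) - OHara_deriv \<alpha> \<gamma> h\<bar> \<le> K * (scaled_norm h)\<^sup>2"
      unfolding energies end_point OHara_deriv_def k(2) velocity_energy_deriv_scaleR
      using small(1) c(2) scaled_norm_nonneg k(1) line by (intro K(2)) auto
    also have "\<dots> = K * (sobolev_const \<sigma>)\<^sup>2 * Hnorm \<sigma> h * Hnorm \<sigma> h" by (simp add: power2_eq_square mult_ac)
    also have "\<dots> \<le> e * Hnorm \<sigma> h" by (rule mult_right_mono[OF small(2) Hnorm_nonneg])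
    finally show "\<bar>enn2real (OHara \<alpha> (\<lambda>x. \<gamma> x + h x)) - enn2real (OHara \<alpha> \<gamma>) - OHara_deriv \<alpha> \<gamma> h\<bar> \<le> e * Hnorm \<sigma> h" .
  qed
qed

lemma OHara_deriv_continuous:
  fixes \<gamma> :: "real \<Rightarrow> real^'n"
  assumes \<gamma>: "admissible \<sigma> \<gamma>" and e: "0 < e"
  shows "\<exists>\<delta>>0. \<forall>\<eta>. admissible \<sigma> \<eta> \<and> Hnorm \<sigma> (\<lambda>x. \<eta> x - \<gamma> x) < \<delta> \<longrightarrow>
    (\<forall>h. Hsob \<sigma> h \<longrightarrow> \<bar>OHara_deriv \<alpha> \<eta> h - OHara_deriv \<alpha> \<gamma> h\<bar> \<le> e * Hnorm \<sigma> h)"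
proof -
  note H = admissible_Hsob[OF \<gamma>]
  obtain c C where c: "0 < c" "c \<le> 1" "tame c C (velocity \<gamma>)"
    and lines: "\<And>k t. unit_direction \<sigma> k \<Longrightarrow> 0 \<le> t \<Longrightarrow> t \<le> c \<Longrightarrow> tame c C (\<lambda>u. velocity \<gamma> u + t *\<^sub>R k u)"
    by (rule admissible_tame_lines[OF \<gamma>]) (rule that)
  obtain K where K: "0 \<le> K" "\<And>\<nu> f k. 0 \<le> \<nu> \<and> \<nu> \<le> 1 \<and> unit_direction \<sigma> f \<and> unit_direction \<sigma> k
      \<and> tame c C (\<lambda>u. velocity \<gamma> u + \<nu> *\<^sub>R f u) \<Longrightarrow>
    \<bar>velocity_energy_deriv \<alpha> (\<lambda>u. velocity \<gamma> u + \<nu> *\<^sub>R f u) k - velocity_energy_deriv \<alpha> (velocity \<gamma>) k\<bar> \<le> K * \<nu>"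
    by (rule velocity_energy_deriv_lipschitz[OF exponents(1) c(1,3) gagliardo_velocity_finite[OF exponents(2) H]])
       (rule that)
  have "0 \<le> K * (sobolev_const \<sigma>)\<^sup>2" using K(1) by simp
  then obtain \<delta> where \<delta>: "0 < \<delta>"
    "\<And>x. 0 \<le> x \<Longrightarrow> x < \<delta> \<Longrightarrow> sobolev_const \<sigma> * x \<le> c \<and> K * (sobolev_const \<sigma>)\<^sup>2 * x \<le> e"
    using small_radius[OF sobolev_const_pos c(1) _ e] by metis
  show ?thesis
  proof (intro exI[of _ \<delta>] conjI \<delta>(1) allI impI)
    fix \<eta> h :: "real \<Rightarrow> real^'n"
    assume "admissible \<sigma> \<eta> \<and> Hnorm \<sigma> (\<lambda>x. \<eta> x - \<gamma> x) < \<delta>" and h: "Hsob \<sigma> h"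
    then have \<eta>: "Hsob \<sigma> \<eta>" and small: "scaled_norm (\<lambda>x. \<eta> x - \<gamma> x) \<le> c"
        "K * (sobolev_const \<sigma>)\<^sup>2 * Hnorm \<sigma> (\<lambda>x. \<eta> x - \<gamma> x) \<le> e"
      using \<delta>(2)[OF Hnorm_nonneg[of \<sigma> "\<lambda>x. \<eta> x - \<gamma> x"]] admissible_Hsob by auto
    let ?\<nu> = "scaled_norm (\<lambda>x. \<eta> x - \<gamma> x)"
    obtain f where f: "unit_direction \<sigma> f" "velocity \<eta> = (\<lambda>u. velocity \<gamma> u + ?\<nu> *\<^sub>R f u)"
      by (rule velocity_eq_add_unit_direction[OF H \<eta>])
    obtain k where k: "unit_direction \<sigma> k" "velocity h = (\<lambda>u. scaled_norm h *\<^sub>R k u)"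
      by (rule velocity_eq_scaled_unit_direction[OF exponents(2) h])
    have "\<bar>OHara_deriv \<alpha> \<eta> h - OHara_deriv \<alpha> \<gamma> h\<bar>
        = scaled_norm h * \<bar>velocity_energy_deriv \<alpha> (velocity \<eta>) k - velocity_energy_deriv \<alpha> (velocity \<gamma>) k\<bar>"
      by (simp only: OHara_deriv_def k(2) velocity_energy_deriv_scaleR right_diff_distrib[symmetric]
          abs_mult[of "scaled_norm h"] abs_of_nonneg[OF scaled_norm_nonneg])
    also have "\<dots> \<le> scaled_norm h * (K * ?\<nu>)"
      unfolding f(2) using f(1) k(1) small(1) c(2) scaled_norm_nonneg lines[OF f(1) scaled_norm_nonneg small(1)]
      by (intro mult_left_mono K(2)) auto
    also have "\<dots> = K * (sobolev_const \<sigma>)\<^sup>2 * Hnorm \<sigma> (\<lambda>x. \<eta> x - \<gamma> x) * Hnorm \<sigma> h" by (simp add: power2_eq_square mult_ac)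
    also have "\<dots> \<le> e * Hnorm \<sigma> h" by (rule mult_right_mono[OF small(2) Hnorm_nonneg])
    finally show "\<bar>OHara_deriv \<alpha> \<eta> h - OHara_deriv \<alpha> \<gamma> h\<bar> \<le> e * Hnorm \<sigma> h" .
  qed
qed

lemma Ieps_tendsto_OHara_deriv:
  fixes \<gamma> h :: "real \<Rightarrow> real^'n"
  assumes \<gamma>: "admissible \<sigma> \<gamma>" and unit_speed: "\<forall>u. norm (velocity \<gamma> u) = 1" and h: "Hsob \<sigma> h"
  shows "((\<lambda>\<epsilon>. Ieps \<alpha> \<gamma> h \<epsilon>) \<longlongrightarrow> OHara_deriv \<alpha> \<gamma> h) (at_right 0)"
proof -
  obtain c C where c: "0 < c" "tame c C (velocity \<gamma>)" by (rule admissible_tame_lines[OF \<gamma>])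
  note H = admissible_Hsob[OF \<gamma>]
  show ?thesis
    unfolding OHara_deriv_def
    by (intro Ieps_tendsto_velocity_energy_deriv[OF c] integrable_density_deriv_velocity[OF H c h]
        Hsob_has_velocity[OF exponents(2)] Hsob_periodic(1)[OF exponents(2)] H h) (simp add: unit_speed)
qed

end

theorem theorem1p1:
  fixes \<alpha> :: real
  assumes "2 < \<alpha>" and "\<alpha> < 3"
  shows
   "(\<forall>\<gamma>::real \<Rightarrow> real^'n. admissible ((\<alpha> - 1) / 2) \<gamma> \<longrightarrow>
        (\<exists>\<delta>>0. \<forall>\<eta>. Hsob ((\<alpha> - 1) / 2) \<eta> \<and> Hnorm ((\<alpha> - 1) / 2) (\<lambda>x. \<eta> x - \<gamma> x) < \<delta>
                 \<longrightarrow> admissible ((\<alpha> - 1) / 2) \<eta>))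
    \<and> (\<forall>\<gamma>::real \<Rightarrow> real^'n. admissible ((\<alpha> - 1) / 2) \<gamma> \<longrightarrow> OHara \<alpha> \<gamma> < \<infinity>)
    \<and> (\<exists>DE :: (real \<Rightarrow> real^'n) \<Rightarrow> (real \<Rightarrow> real^'n) \<Rightarrow> real.
        \<forall>\<gamma>. admissible ((\<alpha> - 1) / 2) \<gamma> \<longrightarrow>
          (\<forall>h1 h2 c. Hsob ((\<alpha> - 1) / 2) h1 \<and> Hsob ((\<alpha> - 1) / 2) h2 \<longrightarrow>
              DE \<gamma> (\<lambda>x. h1 x + c *\<^sub>R h2 x) = DE \<gamma> h1 + c * DE \<gamma> h2)
        \<and> (\<exists>C. \<forall>h. Hsob ((\<alpha> - 1) / 2) h \<longrightarrow> \<bar>DE \<gamma> h\<bar> \<le> C * Hnorm ((\<alpha> - 1) / 2) h)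
        \<and> (\<forall>e>0. \<exists>\<delta>>0. \<forall>h. Hsob ((\<alpha> - 1) / 2) h \<and> Hnorm ((\<alpha> - 1) / 2) h < \<delta> \<longrightarrow>
              \<bar>enn2real (OHara \<alpha> (\<lambda>x. \<gamma> x + h x)) - enn2real (OHara \<alpha> \<gamma>) - DE \<gamma> h\<bar>
                \<le> e * Hnorm ((\<alpha> - 1) / 2) h)
        \<and> (\<forall>e>0. \<exists>\<delta>>0. \<forall>\<eta>. admissible ((\<alpha> - 1) / 2) \<eta> \<and>
              Hnorm ((\<alpha> - 1) / 2) (\<lambda>x. \<eta> x - \<gamma> x) < \<delta> \<longrightarrow>
              (\<forall>h. Hsob ((\<alpha> - 1) / 2) h \<longrightarrow>
                 \<bar>DE \<eta> h - DE \<gamma> h\<bar> \<le> e * Hnorm ((\<alpha> - 1) / 2) h))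
        \<and> ((\<forall>u. norm (vector_derivative \<gamma> (at u)) = 1) \<longrightarrow>
            (\<forall>h. Hsob ((\<alpha> - 1) / 2) h \<longrightarrow>
               ((\<lambda>\<epsilon>. Ieps \<alpha> \<gamma> h \<epsilon>) \<longlongrightarrow> DE \<gamma> h) (at_right 0))))"
proof (intro conjI allI impI exI[of _ "OHara_deriv \<alpha>"]; (elim conjE)?)
  let ?\<sigma> = "(\<alpha> - 1) / 2"
  note \<alpha> = assms(1)
  fix \<gamma> :: "real \<Rightarrow> real^'n" assume \<gamma>: "admissible ?\<sigma> \<gamma>"
  show "\<exists>\<delta>>0. \<forall>\<eta>. Hsob ?\<sigma> \<eta> \<and> Hnorm ?\<sigma> (\<lambda>x. \<eta> x - \<gamma> x) < \<delta> \<longrightarrow> admissible ?\<sigma> \<eta>"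
    by (rule admissible_open[OF \<alpha> \<gamma>])
  show "OHara \<alpha> \<gamma> < \<infinity>" by (rule OHara_finite[OF \<alpha> \<gamma>])
  show "OHara_deriv \<alpha> \<gamma> (\<lambda>x. h1 x + c *\<^sub>R h2 x) = OHara_deriv \<alpha> \<gamma> h1 + c * OHara_deriv \<alpha> \<gamma> h2"
    if "Hsob ?\<sigma> h1" "Hsob ?\<sigma> h2" for h1 h2 c
    by (rule OHara_deriv_add_scaleR[OF \<alpha> \<gamma> that])
  show "\<exists>C. \<forall>h. Hsob ?\<sigma> h \<longrightarrow> \<bar>OHara_deriv \<alpha> \<gamma> h\<bar> \<le> C * Hnorm ?\<sigma> h"
    by (rule OHara_deriv_bounded[OF \<alpha> \<gamma>])
  show "\<exists>\<delta>>0. \<forall>h. Hsob ?\<sigma> h \<and> Hnorm ?\<sigma> h < \<delta> \<longrightarrow>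
      \<bar>enn2real (OHara \<alpha> (\<lambda>x. \<gamma> x + h x)) - enn2real (OHara \<alpha> \<gamma>) - OHara_deriv \<alpha> \<gamma> h\<bar> \<le> e * Hnorm ?\<sigma> h"
    if "0 < e" for e by (rule OHara_frechet_differentiable[OF \<alpha> \<gamma> that])
  show "\<exists>\<delta>>0. \<forall>\<eta>. admissible ?\<sigma> \<eta> \<and> Hnorm ?\<sigma> (\<lambda>x. \<eta> x - \<gamma> x) < \<delta> \<longrightarrow>
      (\<forall>h. Hsob ?\<sigma> h \<longrightarrow> \<bar>OHara_deriv \<alpha> \<eta> h - OHara_deriv \<alpha> \<gamma> h\<bar> \<le> e * Hnorm ?\<sigma> h)"
    if "0 < e" for e by (rule OHara_deriv_continuous[OF \<alpha> \<gamma> that])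
  show "(Ieps \<alpha> \<gamma> h \<longlongrightarrow> OHara_deriv \<alpha> \<gamma> h) (at_right 0)"
    if "\<forall>u. norm (vector_derivative \<gamma> (at u)) = 1" "Hsob ?\<sigma> h" for h
    by (rule Ieps_tendsto_OHara_deriv[OF \<alpha> \<gamma> that])
qed

end
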